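(* There is an absolute constant $K>0$ such that for all integers $r,\Delta\ge 2$ and every sequence of graphs $\mathcal{F}=\{F_1,F_2,\ldots\}$ with $\Delta(F_i)\le\Delta$ for all $i$, we have \[\tau_r(\mathcal{F})\le \exp^2\!\left(r^{K r\Delta^3}\right).\] In particular, $\tau_r(\mathcal{F})$ is finite whenever $\sup_{F\in\mathcal{F}}\Delta(F)$ is finite.
   Context: A sequence of graphs is a family $\mathcal{F}=\{F_1,F_2,\ldots\}$ where $F_i$ is a graph on exactly $i$ vertices for each $i\in\mathbb{N}$. $\Delta(F)$ denotes the maximum degree of $F$. For a graph $G$, an $\mathcal{F}$-tiling of $G$ is a collection of vertex-disjoint subgraphs of $G$, each a copy of some graph in $\mathcal{F}$, whose vertex sets together cover $V(G)$; if $G$ is edge-coloured, the tiling is monochromatic if each of its members is monochromatic. $\tau_r(\mathcal{F},n)$ is the minimum $t\in\mathbb{N}$ such that every $r$-edge-colouring of $K_n$ admits a monochromatic $\mathcal{F}$-tiling with at most $t$ members, and $\tau_r(\mathcal{F})=\sup_{n\in\mathbb{N}}\tau_r(\mathcal{F},n)$. $\exp^k$ denotes the $k$-fold composition of the exponential function. *)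

theory Defs
  imports Complex_Main "HOL-Library.Ramsey" "HOL-Library.Extended_Real"
begin

text \<open>Simple graphs are pairs of a vertex set and a set of two-element sets of vertices.\<close>

type_synonym 'a ugraph = "'a set \<times> 'a set set"

abbreviation verts :: "'a ugraph \<Rightarrow> 'a set" where
  "verts G \<equiv> fst G"

abbreviation edges :: "'a ugraph \<Rightarrow> 'a set set" where
  "edges G \<equiv> snd G"

definition ugraph :: "'a ugraph \<Rightarrow> bool" where
  "ugraph G \<longleftrightarrow> finite (verts G) \<and> edges G \<subseteq> [verts G]\<^bsup>2\<^esup>"

definition degree :: "'a ugraph \<Rightarrow> 'a \<Rightarrow> nat" where
  "degree G v = card {e \<in> edges G. v \<in> e}"

definition max_degree :: "'a ugraph \<Rightarrow> nat" where
  "max_degree G = Max (degree G ` verts G)"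

definition complete_graph :: "nat \<Rightarrow> nat ugraph" where
  "complete_graph n = ({..<n}, [{..<n}]\<^bsup>2\<^esup>)"

definition is_subgraph :: "'a ugraph \<Rightarrow> 'a ugraph \<Rightarrow> bool" where
  "is_subgraph H G \<longleftrightarrow> ugraph H \<and> verts H \<subseteq> verts G \<and> edges H \<subseteq> edges G"

definition is_copy_of :: "'a ugraph \<Rightarrow> 'b ugraph \<Rightarrow> bool" where
  "is_copy_of H F \<longleftrightarrow>
     (\<exists>f. bij_betw f (verts F) (verts H) \<and> edges H = (\<lambda>e. f ` e) ` edges F)"

text \<open>Sequences are indexed from 1; the value at index 0 is irrelevant throughout.\<close>

definition graph_sequence :: "(nat \<Rightarrow> 'a ugraph) \<Rightarrow> bool" where
  "graph_sequence F \<longleftrightarrow> (\<forall>i\<ge>1. ugraph (F i) \<and> card (verts (F i)) = i)"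

definition edge_colouring :: "nat \<Rightarrow> 'a ugraph \<Rightarrow> ('a set \<Rightarrow> nat) \<Rightarrow> bool" where
  "edge_colouring r G c \<longleftrightarrow> (\<forall>e\<in>edges G. c e < r)"

definition monochromatic :: "('a set \<Rightarrow> nat) \<Rightarrow> 'a ugraph \<Rightarrow> bool" where
  "monochromatic c H \<longleftrightarrow> (\<exists>k. \<forall>e\<in>edges H. c e = k)"

definition is_tiling :: "(nat \<Rightarrow> 'b ugraph) \<Rightarrow> 'a ugraph \<Rightarrow> 'a ugraph set \<Rightarrow> bool" where
  "is_tiling F G T \<longleftrightarrow>
     (\<forall>H\<in>T. is_subgraph H G \<and> (\<exists>i\<ge>1. is_copy_of H (F i))) \<and>
     (\<forall>H\<in>T. \<forall>H'\<in>T. H \<noteq> H' \<longrightarrow> verts H \<inter> verts H' = {}) \<and>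
     (\<Union>H\<in>T. verts H) = verts G"

definition monochromatic_tiling ::
  "(nat \<Rightarrow> 'b ugraph) \<Rightarrow> 'a ugraph \<Rightarrow> ('a set \<Rightarrow> nat) \<Rightarrow> 'a ugraph set \<Rightarrow> bool" where
  "monochromatic_tiling F G c T \<longleftrightarrow> is_tiling F G T \<and> (\<forall>H\<in>T. monochromatic c H)"

text \<open>The infimum in \<^typ>\<open>enat\<close> is the minimum whenever an admissible \<open>t\<close> exists, and
  \<open>\<infinity>\<close> otherwise.\<close>

definition tiling_number_at :: "nat \<Rightarrow> (nat \<Rightarrow> 'b ugraph) \<Rightarrow> nat \<Rightarrow> enat" where
  "tiling_number_at r F n = Inf {enat t | t. \<forall>c. edge_colouring r (complete_graph n) c \<longrightarrow>
     (\<exists>T. monochromatic_tiling F (complete_graph n) c T \<and> finite T \<and> card T \<le> t)}"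

definition tiling_number :: "nat \<Rightarrow> (nat \<Rightarrow> 'b ugraph) \<Rightarrow> enat" where
  "tiling_number r F = (SUP n\<in>{1..}. tiling_number_at r F n)"

end

theory Submission
  imports Defs "HOL-Library.FuncSet" "HOL-Library.Disjoint_Sets"
begin

text \<open>
  A cylinder is a tuple of disjoint vertex sets that is lower regular in one colour; a density
  increment argument finds one inside every dense family of monochromatic cliques, and bounded
  degree graphs embed greedily into it.

  An absorber is a skeleton \<open>A\<close> together with a pool \<open>B\<close> such that \<open>A \<union> B'\<close> carries a
  monochromatic tile for every \<open>B' \<subseteq> B\<close> of a prescribed size \<open>q\<close>: embed a graph of the
  sequence up to an independent set, and apply Hall's theorem inside a regular part of the bipartite
  graph between that set and the common neighbourhoods of its embedded neighbours. So up to
  \<open>card B - q\<close> vertices of the pool may be used elsewhere; the surplus is removed by further tiles of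
  the exact size needed.

  Starting from the whole vertex set, build an absorber, tile greedily until only a tiny proportion
  of the vertices is left, and recurse on the remainder with all earlier pools available. At each level
  the vertices joined to many monochromatic \<open>(\<Delta> + 1)\<close>-cliques of earlier pools are covered first:
  a bounded number of regular cylinders suffices for all of them, and one tile per cylinder
  contains all vertices assigned to it as a set of vertices at pairwise distance at least three. The
  vertices that survive, hence all later pools, are bad for the earlier pools. By Ramsey's
  theorem this cannot happen in \<open>N = r ^ (r (\<Delta> + 2))\<close> consecutive pools, so the recursion has depth
  less than \<open>N\<close>.
\<close>

section \<open>Hall's theorem, greedy colouring and Ramsey's theorem\<close>

text \<open>Pool vertices have two duties: they help to cover vertices at later levels, and enough
  of them must be left for absorption. An amortised budget controls their use. Covering a set
  \<open>R\<close> costs at most \<open>D2 * card R\<close> pool vertices, and the remainder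
  \<open>W\<close> is shrunk until \<open>D2 * card W\<close> is at most a fraction
  \<open>\<tau>\<close> of the newest pool. The number of used vertices of a pool plus
  \<open>D2 * card W\<close> never grows afterwards, so nothing has to be summed over the levels.

  Proper colourings need \<open>\<Delta> + 1\<close> sides, hence cliques of that size; Ramsey's
  theorem is asked for \<open>\<Delta> + 2\<close>, and the clique vertex in the last pool then sees
  a clique in earlier pools.

  The size of the bound comes from regularity. \<open>\<delta>\<close> and \<open>\<epsilon>\<close>
  are exponentially small in \<open>N * \<Delta>\<close>, and the order of
  \<open>1 / \<epsilon> ^ 3\<close> increments, each shrinking the sides by a factor
  \<open>\<epsilon>\<close>, leave a doubly exponentially small proportion \<open>\<mu>\<close>. The
  number of tiles is polynomial in \<open>1 / \<mu>\<close>, of degree linear in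
  \<open>\<Delta>\<close>.\<close>

abbreviation rcard :: "'a set \<Rightarrow> real" where
  "rcard A \<equiv> real (card A)"

text \<open>Induction on \<open>card X\<close> by the Halmos-Vaughan dichotomy. If all proper
  nonempty subsets have a surplus, any element may take any of its values, which is then deleted
  from the other sets. Otherwise a tight proper subset \<open>S\<close> is matched into its
  neighbourhood \<open>?U\<close>, and tightness transfers Hall's condition to the rest with
  \<open>?U\<close> removed.\<close>

lemma Hall_marriage:
  assumes "finite X" "\<And>x. x \<in> X \<Longrightarrow> finite (A x)"
    and "\<And>S. S \<subseteq> X \<Longrightarrow> card S \<le> card (\<Union>x\<in>S. A x)"
  shows "\<exists>f. inj_on f X \<and> (\<forall>x\<in>X. f x \<in> A x)"
  using assms
proof (induction "card X" arbitrary: X A rule: less_induct)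
  case less
  note fX = less.prems(1) and fA = less.prems(2) and hall = less.prems(3)
  show ?case
  proof (cases "X = {}")
    case False
    then obtain x where x: "x \<in> X" by blast
    show ?thesis
    proof (cases "\<forall>S. S \<subset> X \<longrightarrow> S \<noteq> {} \<longrightarrow> card S < card (\<Union>x\<in>S. A x)")
      case True
      have "card {x} \<le> card (A x)" using hall[of "{x}"] x by simp
      then obtain a where a: "a \<in> A x" by fastforce
      have "\<exists>f. inj_on f (X - {x}) \<and> (\<forall>y\<in>X - {x}. f y \<in> A y - {a})"
      proof (rule less.hyps)
        show "card (X - {x}) < card X" using x fX by (meson card_Diff1_less)
        show "finite (X - {x})" using fX by simp
        show "finite (A y - {a})" if "y \<in> X - {x}" for y using fA that by simp
        show "card S \<le> card (\<Union>y\<in>S. A y - {a})" if S: "S \<subseteq> X - {x}" for S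
        proof (cases "S = {}")
          case False
          have "S \<subset> X" using S x by blast
          then have "card S < card (\<Union>y\<in>S. A y)" using True False by blast
          moreover have "card (\<Union>y\<in>S. A y) - card {a} \<le> card ((\<Union>y\<in>S. A y) - {a})"
            by (rule diff_card_le_card_Diff) simp
          moreover have "(\<Union>y\<in>S. A y - {a}) = (\<Union>y\<in>S. A y) - {a}" by blast
          ultimately show ?thesis by simp
        qed simp
      qed
      then obtain f where f: "inj_on f (X - {x})" "\<forall>y\<in>X - {x}. f y \<in> A y - {a}" by blast
      have "inj_on (f(x := a)) X"
        using f by (auto simp: inj_on_def)
      moreover have "\<forall>y\<in>X. (f(x := a)) y \<in> A y" using f a by auto
      ultimately show ?thesis by blast
    next
      case False
      then obtain S where S: "S \<subset> X" "S \<noteq> {}" and "\<not> card S < card (\<Union>x\<in>S. A x)" by blast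
      then have eq: "card (\<Union>x\<in>S. A x) = card S" using hall[of S] by (simp add: psubset_imp_subset)
      have fS: "finite S" using S fX finite_subset by blast
      have "\<exists>f. inj_on f S \<and> (\<forall>y\<in>S. f y \<in> A y)"
      proof (rule less.hyps)
        show "card S < card X" using S fX by (simp add: psubset_card_mono)
        show "finite S" by (rule fS)
        show "finite (A y)" if "y \<in> S" for y using fA that S by blast
        show "card T \<le> card (\<Union>y\<in>T. A y)" if T: "T \<subseteq> S" for T using hall T S by blast
      qed
      then obtain f where f: "inj_on f S" "\<forall>y\<in>S. f y \<in> A y" by blast
      let ?U = "\<Union>y\<in>S. A y"
      have fU: "finite ?U" using fS fA S by blast
      have "\<exists>f. inj_on f (X - S) \<and> (\<forall>y\<in>X - S. f y \<in> A y - ?U)"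
      proof (rule less.hyps)
        show "card (X - S) < card X" using S fX
          by (metis Diff_subset card_mono card_seteq inf.absorb_iff2 Diff_disjoint inf.commute
              not_less psubset_imp_subset)
        show "finite (X - S)" using fX by simp
        show "finite (A y - ?U)" if "y \<in> X - S" for y using fA that by simp
        show "card T \<le> card (\<Union>y\<in>T. A y - ?U)" if T: "T \<subseteq> X - S" for T
        proof -
          have fT: "finite T" using T fX by (meson finite_Diff finite_subset)
          have "card S + card T = card (S \<union> T)"
            using T fS fT by (subst card_Un_disjoint) auto
          also have "\<dots> \<le> card (\<Union>y\<in>S \<union> T. A y)" using T S by (intro hall) blast
          also have "(\<Union>y\<in>S \<union> T. A y) = ?U \<union> (\<Union>y\<in>T. A y - ?U)" by blast
          also have "card \<dots> \<le> card ?U + card (\<Union>y\<in>T. A y - ?U)" by (rule card_Un_le)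
          finally show ?thesis using eq by simp
        qed
      qed
      then obtain g where g: "inj_on g (X - S)" "\<forall>y\<in>X - S. g y \<in> A y - ?U" by blast
      let ?h = "\<lambda>y. if y \<in> S then f y else g y"
      have "inj_on ?h X"
      proof (rule inj_onI)
        fix y z assume yz: "y \<in> X" "z \<in> X" "?h y = ?h z"
        show "y = z"
        proof (cases "y \<in> S"; cases "z \<in> S")
          assume "y \<in> S" "z \<in> S" then show ?thesis using yz f by (simp add: inj_on_def)
        next
          assume "y \<in> S" "z \<notin> S"
          then have "f y \<in> ?U" "g z \<notin> ?U" using f g yz by blast+
          then show ?thesis using yz \<open>y \<in> S\<close> \<open>z \<notin> S\<close> by simp
        next
          assume "y \<notin> S" "z \<in> S"
          then have "f z \<in> ?U" "g y \<notin> ?U" using f g yz by blast+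
          then show ?thesis using yz \<open>z \<in> S\<close> \<open>y \<notin> S\<close> by simp
        next
          assume "y \<notin> S" "z \<notin> S" then show ?thesis using yz g by (simp add: inj_on_def)
        qed
      qed
      moreover have "\<forall>y\<in>X. ?h y \<in> A y" using f g by auto
      ultimately show ?thesis by blast
    qed
  qed simp
qed

text \<open>The relation is abstract because two instances are needed: adjacency in a graph, and
  being at distance one or two.\<close>

lemma greedy_colouring:
  fixes adj :: "'a \<Rightarrow> 'a \<Rightarrow> bool"
  assumes "finite V" "\<And>x y. adj x y \<Longrightarrow> adj y x" "\<And>x. \<not> adj x x"
    and "\<And>v. v \<in> V \<Longrightarrow> card {w \<in> V. adj v w} \<le> D"
  shows "\<exists>\<chi>::'a \<Rightarrow> nat. (\<forall>v\<in>V. \<chi> v \<le> D) \<and> (\<forall>v\<in>V. \<forall>w\<in>V. adj v w \<longrightarrow> \<chi> v \<noteq> \<chi> w)"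
  using assms(1,4)
proof (induction V rule: finite_induct)
  case (insert v V)
  have "card {w \<in> V. adj x w} \<le> D" if "x \<in> V" for x
  proof -
    have "card {w \<in> V. adj x w} \<le> card {w \<in> insert v V. adj x w}"
      using insert.hyps by (intro card_mono) auto
    then show ?thesis using insert.prems[of x] that by simp
  qed
  from insert.IH[OF this] obtain \<chi> :: "'a \<Rightarrow> nat"
    where \<chi>: "\<forall>v\<in>V. \<chi> v \<le> D" "\<forall>v\<in>V. \<forall>w\<in>V. adj v w \<longrightarrow> \<chi> v \<noteq> \<chi> w" by blast
  have "card (\<chi> ` {w \<in> V. adj v w}) \<le> card {w \<in> V. adj v w}"
    using insert.hyps by (intro card_image_le) simp
  also have "\<dots> \<le> card {w \<in> insert v V. adj v w}" using insert.hyps by (intro card_mono) auto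
  also have "\<dots> \<le> D" using insert.prems[of v] by simp
  also have "\<dots> < card {..D}" by simp
  finally have "\<not> {..D} \<subseteq> \<chi> ` {w \<in> V. adj v w}"
    using insert.hyps by (metis (no_types, lifting) card_mono finite_imageI finite_subset leD
        mem_Collect_eq subsetI)
  then obtain a where a: "a \<le> D" "a \<notin> \<chi> ` {w \<in> V. adj v w}" by auto
  have "(\<forall>x\<in>insert v V. (\<chi>(v := a)) x \<le> D) \<and>
        (\<forall>x\<in>insert v V. \<forall>w\<in>insert v V. adj x w \<longrightarrow> (\<chi>(v := a)) x \<noteq> (\<chi>(v := a)) w)"
    using \<chi> a assms(2,3) by auto
  then show ?case by blast
qed simp

text \<open>Induction on the sum \<open>s\<close> of the targets \<open>q k\<close>. Some colour
  class around a vertex \<open>v\<close> still has \<open>r ^ s\<close> of the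
  \<open>r ^ Suc s\<close> vertices, and passing to it lowers the target of its colour by
  one.\<close>

lemma multicolour_Ramsey:
  fixes c :: "'a set \<Rightarrow> nat"
  assumes "r \<ge> 2" "finite A" "sum q {..<r} = s" "r ^ s \<le> card A"
    and "\<And>x y. x \<in> A \<Longrightarrow> y \<in> A \<Longrightarrow> x \<noteq> y \<Longrightarrow> c {x, y} < r"
  shows "\<exists>k<r. \<exists>S\<subseteq>A. card S = q k \<and> (\<forall>x\<in>S. \<forall>y\<in>S. x \<noteq> y \<longrightarrow> c {x, y} = k)"
  using assms(2-)
proof (induction s arbitrary: A q)
  case 0
  then have "q 0 = 0" using assms(1) by auto
  then show ?case using assms(1) by (intro exI[of _ 0]) auto
next
  case (Suc s)
  show ?case
  proof (cases "\<exists>k<r. q k = 0")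
    case True
    then show ?thesis by (metis card.empty empty_iff empty_subsetI)
  next
    case False
    have "1 \<le> r ^ Suc s" using assms(1) by (simp add: Suc_leI)
    then have "A \<noteq> {}" using Suc.prems(3) by auto
    then obtain v where v: "v \<in> A" by blast
    define B where "B k = {w \<in> A - {v}. c {v, w} = k}" for k
    have "\<exists>k<r. r ^ s \<le> card (B k)"
    proof (rule ccontr)
      assume "\<not> ?thesis"
      then have le: "card (B k) \<le> r ^ s - 1" if "k < r" for k using that by fastforce
      \<comment> \<open>With at most \<open>r ^ s - 1\<close> elements in each class,
        \<open>card A - 1\<close> would be at most \<open>r ^ Suc s - r\<close>, which is too small
        since \<open>r \<ge> 2\<close>.\<close>
      have "A - {v} = (\<Union>k<r. B k)" using Suc.prems(4)[OF v] by (auto simp: B_def)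
      then have "card (A - {v}) \<le> (\<Sum>k<r. card (B k))" by (metis card_UN_le finite_lessThan)
      also have "\<dots> \<le> (\<Sum>k<r. r ^ s - 1)" using le by (intro sum_mono) simp
      also have "\<dots> = r ^ Suc s - r" by (simp add: diff_mult_distrib2)
      finally have "card A - 1 \<le> r ^ Suc s - r" using v by simp
      moreover have "r \<le> r ^ Suc s" using assms(1) by simp
      ultimately show False using Suc.prems(3) assms(1) by linarith
    qed
    then obtain k where k: "k < r" "r ^ s \<le> card (B k)" by blast
    define q' where "q' = q(k := q k - 1)"
    have q0: "q k \<noteq> 0" using False k(1) by auto
    have 1: "sum q {..<r} = q k + sum q ({..<r} - {k})" using k(1) by (simp add: sum.remove)
    have 2: "sum q' {..<r} = q' k + sum q' ({..<r} - {k})" using k(1) by (simp add: sum.remove)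
    have 3: "sum q' ({..<r} - {k}) = sum q ({..<r} - {k})" by (rule sum.cong) (auto simp: q'_def)
    have 4: "q' k = q k - 1" by (simp add: q'_def)
    have q's: "sum q' {..<r} = s" using Suc.prems(2) q0 1 2 3 4 by linarith
    have "finite (B k)" using Suc.prems(1) by (simp add: B_def)
    then obtain l S where l: "l < r" "S \<subseteq> B k" "card S = q' l"
        "\<forall>x\<in>S. \<forall>y\<in>S. x \<noteq> y \<longrightarrow> c {x, y} = l"
    proof -
      have "c {x, y} < r" if "x \<in> B k" "y \<in> B k" "x \<noteq> y" for x y
        using Suc.prems(4) that by (simp add: B_def)
      then show ?thesis using that Suc.IH[of "B k" q'] \<open>finite (B k)\<close> q's k(2) by blast
    qed
    show ?thesis
    proof (cases "l = k")
      case False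
      then show ?thesis using l by (intro exI[of _ l] conjI exI[of _ S]) (auto simp: B_def q'_def)
    next
      case True
      have "finite S" using l \<open>finite (B k)\<close> finite_subset by blast
      moreover have "v \<notin> S" using l by (auto simp: B_def)
      ultimately have "card (insert v S) = q k" using l True q0 by (simp add: q'_def)
      moreover have "insert v S \<subseteq> A" using l v by (auto simp: B_def)
      moreover have "\<forall>x\<in>insert v S. \<forall>y\<in>insert v S. x \<noteq> y \<longrightarrow> c {x, y} = k"
        using l True by (auto simp: B_def insert_commute subset_iff)
      ultimately show ?thesis using k by blast
    qed
  qed
qed

section \<open>Averaging over subsets and double counting\<close>

text \<open>Deleting an element of least weight does not lower the average; this is repeated until
  \<open>a\<close> elements are left. Comparing averages in multiplied-out form avoids dividing by
  the size of an empty set.\<close>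

lemma exists_heavy_subset:
  fixes f :: "'a \<Rightarrow> real"
  assumes "finite T" "a \<le> card T"
  shows "\<exists>S\<subseteq>T. card S = a \<and> real a * sum f T \<le> sum f S * rcard T"
  using assms
proof (induction "card T" arbitrary: T)
  case 0
  then show ?case by auto
next
  case (Suc n)
  show ?case
  proof (cases "a = Suc n")
    case True
    then show ?thesis using Suc.hyps(2) by (intro exI[of _ T]) (simp add: mult.commute)
  next
    case False
    then have an: "a \<le> n" using Suc by simp
    have "T \<noteq> {}" using Suc by auto
    then obtain x where x: "x \<in> T" "\<forall>y\<in>T. f x \<le> f y"
      using Suc.prems(1) ex_min_if_finite[of "f ` T"] by (auto simp: not_less)
    let ?T = "T - {x}"
    have c: "card ?T = n" using Suc x by simp
    have "sum f T = f x + sum f ?T" using Suc.prems(1) x by (simp add: sum.remove)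
    moreover have "(\<Sum>y\<in>T. f x) \<le> sum f T" using x by (intro sum_mono) blast
    ultimately have 1: "real n * sum f T \<le> real (Suc n) * sum f ?T" using Suc.hyps(2)[symmetric]
      by (simp add: algebra_simps)
    obtain S where S: "S \<subseteq> ?T" "card S = a" "real a * sum f ?T \<le> sum f S * real n"
      using Suc.hyps(1)[of ?T] c an Suc.prems(1) by auto
    have "real a * sum f T \<le> sum f S * real (Suc n)"
    proof (cases "n = 0")
      case True
      then have "a = 0" "S = {}" using an S c Suc.prems(1) by (auto simp: card_eq_0_iff)
      then show ?thesis by simp
    next
      case False
      have "real n * (real a * sum f T) = real a * (real n * sum f T)" by simp
      also have "\<dots> \<le> real a * (real (Suc n) * sum f ?T)" using 1 by (intro mult_left_mono) auto
      also have "\<dots> = real (Suc n) * (real a * sum f ?T)" by simp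
      also have "\<dots> \<le> real (Suc n) * (sum f S * real n)" using S by (intro mult_left_mono) auto
      also have "\<dots> = real n * (sum f S * real (Suc n))" by simp
      finally show ?thesis using False by (simp add: mult_le_cancel_left_pos)
    qed
    then show ?thesis using S Suc.hyps(2) by auto
  qed
qed

lemma exists_light_subset:
  fixes f :: "'a \<Rightarrow> real"
  assumes "finite T" "a \<le> card T"
  shows "\<exists>S\<subseteq>T. card S = a \<and> sum f S * rcard T \<le> real a * sum f T"
  using exists_heavy_subset[OF assms, of "\<lambda>x. - f x"] by (simp add: sum_negf)

lemma double_counting:
  assumes "finite X" "finite P"
  shows "(\<Sum>x\<in>X. rcard {p \<in> P. H x p}) = (\<Sum>p\<in>P. rcard {x \<in> X. H x p})"
proof -
  have "(\<Sum>x\<in>X. rcard {p \<in> P. H x p}) = (\<Sum>x\<in>X. \<Sum>p\<in>P. if H x p then 1 else 0)"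
    using assms by (simp add: sum.If_cases Int_def)
  also have "\<dots> = (\<Sum>p\<in>P. \<Sum>x\<in>X. if H x p then 1 else 0)" by (rule sum.swap)
  also have "\<dots> = (\<Sum>p\<in>P. rcard {x \<in> X. H x p})" using assms by (simp add: sum.If_cases Int_def)
  finally show ?thesis .
qed

section \<open>Regular cylinders\<close>

text \<open>Only lower regularity is demanded: few vertices of \<open>Z i\<close> have density below
  \<open>d\<close> into a large subset of \<open>Z j\<close>, and no upper bound on densities is
  imposed. The relation \<open>G\<close> sees the two indices, so that the notion covers a symmetric
  colour class (indices ignored) as well as a bipartite graph between two sides.\<close>

definition regular_cylinder ::
  "('i \<Rightarrow> 'i \<Rightarrow> 'a \<Rightarrow> 'a \<Rightarrow> bool) \<Rightarrow> 'i set \<Rightarrow> ('i \<Rightarrow> 'a set) \<Rightarrow> real \<Rightarrow> real \<Rightarrow> bool" where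
  "regular_cylinder G I Z \<epsilon> d \<longleftrightarrow>
     (\<forall>i\<in>I. \<forall>j\<in>I. i \<noteq> j \<longrightarrow> (\<forall>T\<subseteq>Z j. \<epsilon> * rcard (Z j) \<le> rcard T \<longrightarrow>
        rcard {w \<in> Z i. rcard {t \<in> T. G i j w t} < d * rcard T}
          < \<epsilon> * rcard (Z i)))"

definition volume :: "'i set \<Rightarrow> ('i \<Rightarrow> 'a set) \<Rightarrow> real" where
  "volume I Z = (\<Prod>i\<in>I. rcard (Z i))"

lemma volume_nonneg: "0 \<le> volume I Z"
  unfolding volume_def by (intro prod_nonneg) auto

lemma volume_pos: "(\<And>i. i \<in> I \<Longrightarrow> card (Z i) > 0) \<Longrightarrow> 0 < volume I Z"
  unfolding volume_def by (intro prod_pos) auto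

lemma card_cylinder: "finite I \<Longrightarrow> rcard (Pi\<^sub>E I Z) = volume I Z"
  by (simp add: card_PiE volume_def)

lemma volume_upd:
  assumes "finite I" "i \<in> I"
  shows "volume I (Z(i := S)) = rcard S * volume (I - {i}) Z"
proof -
  have "volume I (Z(i := S)) = rcard ((Z(i := S)) i) * volume (I - {i}) (Z(i := S))"
    unfolding volume_def using assms by (rule prod.remove)
  also have "volume (I - {i}) (Z(i := S)) = volume (I - {i}) Z"
    unfolding volume_def by (rule prod.cong) auto
  finally show ?thesis by (simp only: fun_upd_same)
qed

lemma PiE_upd_subset: "S \<subseteq> Z i \<Longrightarrow> i \<in> I \<Longrightarrow> Pi\<^sub>E I (Z(i := S)) = {g \<in> Pi\<^sub>E I Z. g i \<in> S}"
  by (fastforce simp: PiE_iff extensional_def split: if_splits)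

lemma cylinder_split:
  assumes "finite I" "\<And>i. i \<in> I \<Longrightarrow> finite (Z i)" "i \<in> I" "S \<subseteq> Z i"
  shows "card (Q \<inter> Pi\<^sub>E I Z) =
    card (Q \<inter> Pi\<^sub>E I (Z(i := S))) + card (Q \<inter> Pi\<^sub>E I (Z(i := Z i - S)))"
proof -
  have fin: "finite (Pi\<^sub>E I Z)" using assms by (intro finite_PiE) auto
  have "Q \<inter> Pi\<^sub>E I Z = (Q \<inter> Pi\<^sub>E I (Z(i := S))) \<union> (Q \<inter> Pi\<^sub>E I (Z(i := Z i - S)))"
    using assms by (auto simp: PiE_upd_subset)
  moreover have "(Q \<inter> Pi\<^sub>E I (Z(i := S))) \<inter> (Q \<inter> Pi\<^sub>E I (Z(i := Z i - S))) = {}"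
    using assms by (auto simp: PiE_upd_subset)
  moreover have "finite (Q \<inter> Pi\<^sub>E I (Z(i := S)))" "finite (Q \<inter> Pi\<^sub>E I (Z(i := Z i - S)))"
    using assms fin by (auto simp: PiE_upd_subset)
  ultimately show ?thesis by (simp add: card_Un_disjoint)
qed

text \<open>Counting the members of \<open>Q\<close> by their coordinate \<open>i\<close> and
  keeping the \<open>a\<close> heaviest vertices does not lower the density. This is how the sides
  are brought to prescribed sizes after an increment.\<close>

lemma cylinder_shrink_coordinate:
  assumes "finite I" "\<And>i. i \<in> I \<Longrightarrow> finite (Z i)" "i \<in> I" "a \<le> card (Z i)" "card (Z i) > 0"
    and "D * volume I Z \<le> rcard (Q \<inter> Pi\<^sub>E I Z)"
  shows "\<exists>S\<subseteq>Z i. card S = a \<and> D * volume I (Z(i := S)) \<le> rcard (Q \<inter> Pi\<^sub>E I (Z(i := S)))"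
proof -
  have fin: "finite (Pi\<^sub>E I Z)" using assms by (intro finite_PiE) auto
  define f where "f w = rcard {g \<in> Q \<inter> Pi\<^sub>E I Z. g i = w}" for w
  have sumf: "sum f S = rcard (Q \<inter> Pi\<^sub>E I (Z(i := S)))" if S: "S \<subseteq> Z i" for S
  proof -
    have "Q \<inter> Pi\<^sub>E I (Z(i := S)) = (\<Union>w\<in>S. {g \<in> Q \<inter> Pi\<^sub>E I Z. g i = w})"
      using S assms by (auto simp: PiE_upd_subset)
    also have "card \<dots> = (\<Sum>w\<in>S. card {g \<in> Q \<inter> Pi\<^sub>E I Z. g i = w})"
    proof (rule card_UN_disjoint)
      show "finite S" using S assms(2)[OF assms(3)] finite_subset by blast
    qed (use fin in auto)
    finally show ?thesis by (simp add: f_def)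
  qed
  obtain S where S: "S \<subseteq> Z i" "card S = a" "real a * sum f (Z i) \<le> sum f S * rcard (Z i)"
    using exists_heavy_subset[of "Z i" a f] assms by blast
  have Zi: "sum f (Z i) = rcard (Q \<inter> Pi\<^sub>E I Z)" using sumf[of "Z i"]
      by (simp only: fun_upd_triv subset_refl)
  have v: "volume I Z = rcard (Z i) * volume (I - {i}) Z"
    using volume_upd[of I i Z "Z i"] assms by simp
  have "rcard (Z i) * (D * volume I (Z(i := S))) = real a * (D * volume I Z)"
    using volume_upd[OF assms(1,3), of Z S] S(2) v by simp
  also have "\<dots> \<le> real a * sum f (Z i)" using assms Zi by (intro mult_left_mono) auto
  also have "\<dots> \<le> rcard (Z i) * sum f S" using S by (simp add: mult.commute)
  finally have "D * volume I (Z(i := S)) \<le> sum f S" using assms(5)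
      by (simp add: mult_le_cancel_left_pos)
  then show ?thesis using S sumf by auto
qed

lemma cylinder_shrink:
  assumes "finite I" "\<And>i. i \<in> I \<Longrightarrow> finite (Z i)"
    "\<And>i. i \<in> I \<Longrightarrow> a i \<le> card (Z i)" "\<And>i. i \<in> I \<Longrightarrow> card (Z i) > 0"
    and "D * volume I Z \<le> rcard (Q \<inter> Pi\<^sub>E I Z)"
  shows "\<exists>Z'. (\<forall>i\<in>I. Z' i \<subseteq> Z i \<and> card (Z' i) = a i) \<and>
    D * volume I Z' \<le> rcard (Q \<inter> Pi\<^sub>E I Z')"
proof -
  have "\<exists>Z'. (\<forall>i\<in>J. Z' i \<subseteq> Z i \<and> card (Z' i) = a i) \<and> (\<forall>i\<in>I - J. Z' i = Z i) \<and>
    D * volume I Z' \<le> rcard (Q \<inter> Pi\<^sub>E I Z')" if "finite J" "J \<subseteq> I" for J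
    using that
  proof (induction J rule: finite_subset_induct')
    case empty
    then show ?case using assms(5) by (intro exI[of _ Z]) auto
  next
    case (insert i J)
    then obtain Z' where Z': "\<forall>i\<in>J. Z' i \<subseteq> Z i \<and> card (Z' i) = a i" "\<forall>i\<in>I - J. Z' i = Z i"
      "D * volume I Z' \<le> rcard (Q \<inter> Pi\<^sub>E I Z')" by blast
    have Zi: "Z' i = Z i" using Z' insert by blast
    have fin': "finite (Z' l)" if "l \<in> I" for l
    proof (cases "l \<in> J")
      case True then show ?thesis using Z' assms(2)[OF that] finite_subset by blast
    next
      case False then show ?thesis using Z' assms(2)[OF that] that by simp
    qed
    obtain S where S: "S \<subseteq> Z' i" "card S = a i"
      "D * volume I (Z'(i := S)) \<le> rcard (Q \<inter> Pi\<^sub>E I (Z'(i := S)))"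
      using cylinder_shrink_coordinate[of I Z' i "a i" D Q] assms(1,3,4) fin' Z' Zi insert by metis
    then show ?case using Z' Zi insert by (intro exI[of _ "Z'(i := S)"] conjI S(3)) auto
  qed
  from this[of I] assms(1) show ?thesis by auto
qed

text \<open>A tuple of \<open>Q\<close> is determined by its edge between the sides \<open>i\<close>
  and \<open>j\<close> together with the other coordinates. Hence few edges between \<open>S\<close>
  and \<open>T\<close> force few cliques.\<close>

lemma card_cliques_between:
  assumes I: "finite I" "\<And>l. l \<in> I \<Longrightarrow> finite (Z l)" "i \<in> I" "j \<in> I" "i \<noteq> j"
    and ST: "finite S" "finite T" and Q: "\<And>g. g \<in> Q \<Longrightarrow> G i j (g i) (g j)"
  shows "rcard (Q \<inter> Pi\<^sub>E I (Z(i := S, j := T)))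
    \<le> (\<Sum>w\<in>S. rcard {t \<in> T. G i j w t}) * volume (I - {i} - {j}) Z"
proof -
  let ?A = "Q \<inter> Pi\<^sub>E I (Z(i := S, j := T))"
  let ?K = "I - {i} - {j}"
  let ?\<phi> = "\<lambda>g. ((g i, g j), restrict g ?K)"
  let ?R = "(SIGMA w:S. {t \<in> T. G i j w t}) \<times> Pi\<^sub>E ?K Z"
  have "inj_on ?\<phi> ?A"
  proof (rule inj_onI)
    fix g h assume gh: "g \<in> ?A" "h \<in> ?A" "?\<phi> g = ?\<phi> h"
    show "g = h"
    proof
      fix l
      show "g l = h l"
      proof (cases "l \<in> ?K")
        case True
        then show ?thesis using gh by (metis (no_types, lifting) Pair_inject restrict_apply')
      next
        case False
        then show ?thesis using gh I by (cases "l \<in> I") (auto simp: PiE_iff extensional_def)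
      qed
    qed
  qed
  moreover have "?\<phi> ` ?A \<subseteq> ?R"
  proof (rule image_subsetI)
    fix g assume g: "g \<in> ?A"
    then have "g i \<in> S" "g j \<in> T" "G i j (g i) (g j)" using I Q by (auto simp: PiE_iff)
    moreover have "restrict g ?K \<in> Pi\<^sub>E ?K Z"
      using g by (fastforce simp: PiE_iff split: if_splits)
    ultimately show "?\<phi> g \<in> ?R" by auto
  qed
  moreover have fR: "finite ?R" using assms by (intro finite_cartesian_product finite_SigmaI
      finite_PiE) auto
  ultimately have "card ?A \<le> card ?R" by (meson card_inj_on_le)
  also have "card ?R = (\<Sum>w\<in>S. card {t \<in> T. G i j w t}) * card (Pi\<^sub>E ?K Z)"
    using ST by (simp add: card_cartesian_product)
  finally have "rcard ?A \<le> real ((\<Sum>w\<in>S. card {t \<in> T. G i j w t}) * card (Pi\<^sub>E ?K Z))"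
    by (rule of_nat_mono)
  then show ?thesis using card_cylinder[of ?K Z] I(1) by simp
qed

section \<open>The density increment\<close>

text \<open>Rounding up gives the least size of a subset of proportion at least
  \<open>\<epsilon>\<close> and never empties a nonempty side.\<close>

definition scale :: "real \<Rightarrow> nat \<Rightarrow> nat" where
  "scale \<epsilon> n = nat \<lceil>\<epsilon> * real n\<rceil>"

lemma scale_ge: "\<epsilon> * real n \<le> real (scale \<epsilon> n)"
  unfolding scale_def by linarith

lemma scale_pos: "\<epsilon> > 0 \<Longrightarrow> n > 0 \<Longrightarrow> scale \<epsilon> n > 0"
  unfolding scale_def by simp

lemma scale_le:
  assumes "\<epsilon> * real n \<le> real m" shows "scale \<epsilon> n \<le> m"
  using assms unfolding scale_def by linarith

lemma scale_le_self: "\<epsilon> \<le> 1 \<Longrightarrow> scale \<epsilon> n \<le> n"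
  using mult_right_mono[of \<epsilon> 1 "real n"] by (intro scale_le) simp

text \<open>The complement of a set of this size can again be shrunk to this size. For
  \<open>n \<ge> 4\<close> the rounding is harmless; for smaller \<open>n\<close> the value is at
  most 1, and strict inequality leaves one more vertex.\<close>

lemma scale_le_rest:
  assumes "0 < \<epsilon>" "\<epsilon> \<le> 1/4" "scale \<epsilon> n < n"
  shows "scale \<epsilon> n \<le> n - scale \<epsilon> n"
proof -
  have n: "real (scale \<epsilon> n) < \<epsilon> * real n + 1" using assms(1) unfolding scale_def
    by (simp add: ceiling_correct) linarith
  have e: "\<epsilon> * real n \<le> real n / 4" using assms(2) mult_right_mono[of \<epsilon> "1/4" "real n"] by simp
  have "2 * scale \<epsilon> n \<le> n"
  proof (cases "n \<ge> 4")
    case True then show ?thesis using n e by linarith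
  next
    case False
    then have "scale \<epsilon> n < 2" using n e by linarith
    then show ?thesis using assms(3) by linarith
  qed
  then show ?thesis by linarith
qed

text \<open>In units of the old density: if an \<open>s\<close> by \<open>t\<close> box has at most
  half of it and the rest of the \<open>x\<close> by \<open>y\<close> rectangle at most
  \<open>1 + \<epsilon> ^ 2 / 2\<close> times it, the total is too small. The box contains a
  proportion \<open>\<epsilon> ^ 2\<close> of the rectangle, so its deficit outweighs the gain
  elsewhere.\<close>

lemma increment_arith:
  fixes x y s t \<epsilon> :: real
  assumes "0 < \<epsilon>" "\<epsilon> * x \<le> s" "\<epsilon> * y \<le> t" "0 < x" "0 < y"
  shows "s * t / 2 + (1 + \<epsilon>\<^sup>2 / 2) * (x * y - s * t) < x * y"
proof -
  have 1: "\<epsilon>\<^sup>2 * (x * y) \<le> s * t"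
  proof -
    have "(\<epsilon> * x) * (\<epsilon> * y) \<le> s * t" using assms
        by (intro mult_mono) (auto intro: order_trans[rotated] mult_nonneg_nonneg)
    then show ?thesis by (simp add: power2_eq_square algebra_simps)
  qed
  have "0 < \<epsilon>\<^sup>2 * (x * y)" using assms by simp
  then have "0 < s * t" using 1 by linarith
  then have "0 < \<epsilon>\<^sup>2 * (s * t)" using assms by simp
  then show ?thesis using 1 by (simp add: algebra_simps)
qed

text \<open>An irregular pair yields \<open>S\<close> and \<open>T\<close> with few edges between
  them. The cylinder splits into the parts with sides \<open>S\<close> and \<open>T\<close>, with
  sides \<open>S\<close> and \<open>Z j - T\<close>, and with side \<open>Z i - S\<close>. The first
  part has clique density at most \<open>\<delta> / 2\<close>, hence at most \<open>D / 2\<close>,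
  so one of the others exceeds \<open>D\<close> by the factor \<open>?\<kappa>\<close>. That part is
  then shrunk to the sizes given by \<open>scale\<close>.\<close>

lemma density_increment:
  assumes I: "finite I" "\<And>i. i \<in> I \<Longrightarrow> finite (Z i)" "\<And>i. i \<in> I \<Longrightarrow> card (Z i) > 0"
    and Q: "\<And>g i j. g \<in> Q \<Longrightarrow> i \<in> I \<Longrightarrow> j \<in> I \<Longrightarrow> i \<noteq> j \<Longrightarrow> G i j (g i) (g j)"
    and D: "0 < \<delta>" "\<delta> \<le> D" "D * volume I Z \<le> rcard (Q \<inter> Pi\<^sub>E I Z)"
    and \<epsilon>: "0 < \<epsilon>" "\<epsilon> \<le> 1/4"
    and irr: "\<not> regular_cylinder G I Z \<epsilon> (\<delta> / 2)"
  shows "\<exists>Z'. (\<forall>i\<in>I. Z' i \<subseteq> Z i \<and> card (Z' i) = scale \<epsilon> (card (Z i))) \<and>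
    (1 + \<epsilon>\<^sup>2 / 2) * D * volume I Z' \<le> rcard (Q \<inter> Pi\<^sub>E I Z')"
proof -
  let ?\<kappa> = "1 + \<epsilon>\<^sup>2 / 2"
  have sc: "scale \<epsilon> (card (Z l)) \<le> card (Z l)" "scale \<epsilon> (card (Z l)) > 0" if "l \<in> I" for l
    using \<epsilon> I(3)[OF that] by (auto intro: scale_le_self scale_pos)
  obtain i j T0 where ij: "i \<in> I" "j \<in> I" "i \<noteq> j" and T0: "T0 \<subseteq> Z j" "\<epsilon> * rcard (Z j) \<le> rcard T0"
    and bad: "\<epsilon> * rcard (Z i) \<le> rcard {w \<in> Z i. rcard {t \<in> T0. G i j w t} < \<delta> / 2 * rcard T0}"
      (is "_ \<le> rcard ?S0")
    using irr unfolding regular_cylinder_def by (auto simp: not_less)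
  let ?x = "rcard (Z i)" and ?y = "rcard (Z j)" and ?R = "volume (I - {i} - {j}) Z"
  have "scale \<epsilon> (card (Z i)) \<le> card ?S0" by (rule scale_le[OF bad])
  \<comment> \<open>Each vertex of \<open>?S0\<close> has low degree into \<open>T0\<close>, so
    \<open>S\<close> may be any subset of the right size.\<close>
  then obtain S where S: "S \<subseteq> ?S0" "card S = scale \<epsilon> (card (Z i))"
      by (meson obtain_subset_with_card_n)
  have fT0: "finite T0" and fS: "finite S" using T0 S I(2) ij by (auto intro: finite_subset)
  define f where "f t = rcard {w \<in> S. G i j w t}" for t
  have dc: "(\<Sum>w\<in>S. rcard {t \<in> T. G i j w t}) = sum f T" if "finite T" for T
    using double_counting[OF fS that] by (simp add: f_def)
  \<comment> \<open>\<open>T0\<close> has unknown size. A subset of exact size that is lightest with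
    respect to the degrees into \<open>S\<close> keeps the low density.\<close>
  obtain T where T: "T \<subseteq> T0" "card T = scale \<epsilon> (card (Z j))"
    "sum f T * rcard T0 \<le> real (scale \<epsilon> (card (Z j))) * sum f T0"
    using exists_light_subset[OF fT0 scale_le[OF T0(2)], of f] by blast
  have fT: "finite T" using T fT0 finite_subset by blast
  let ?s = "rcard S" and ?t = "rcard T"
  have T0pos: "0 < rcard T0" using T0(2) \<epsilon> I(3)[OF ij(2)]
      by (meson less_le_trans mult_pos_pos of_nat_0_less_iff)
  have Rpos: "0 < ?R" using I by (intro volume_pos) auto
  have "sum f T0 \<le> ?s * (\<delta> / 2 * rcard T0)"
  proof -
    have "sum f T0 = (\<Sum>w\<in>S. rcard {t \<in> T0. G i j w t})" using dc[OF fT0] by simp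
    also have "\<dots> \<le> (\<Sum>w\<in>S. \<delta> / 2 * rcard T0)" using S by (intro sum_mono) auto
    finally show ?thesis by simp
  qed
  then have "sum f T * rcard T0 \<le> ?t * (?s * (\<delta> / 2 * rcard T0))"
    using T by (metis (no_types, lifting) mult_left_mono of_nat_0_le_iff order_trans)
  then have "sum f T * rcard T0 \<le> (\<delta> / 2 * ?s * ?t) * rcard T0" by (simp add: algebra_simps)
  then have fTle: "sum f T \<le> \<delta> / 2 * ?s * ?t" using T0pos by (simp add: mult_le_cancel_right)
  have SZ: "S \<subseteq> Z i" and TZ: "T \<subseteq> Z j" using S T T0 by auto
  let ?n1 = "rcard (Q \<inter> Pi\<^sub>E I (Z(i := S, j := T)))"
  let ?n2 = "rcard (Q \<inter> Pi\<^sub>E I (Z(i := S, j := Z j - T)))"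
  let ?n3 = "rcard (Q \<inter> Pi\<^sub>E I (Z(i := Z i - S)))"
  have n1: "?n1 \<le> (\<delta> / 2 * ?s * ?t) * ?R"
  proof -
    have "?n1 \<le> (\<Sum>w\<in>S. rcard {t \<in> T. G i j w t}) * ?R"
      using I ij fS fT Q by (intro card_cliques_between) auto
    also have "\<dots> \<le> (\<delta> / 2 * ?s * ?t) * ?R" using fTle dc[OF fT] Rpos by (intro mult_right_mono) auto
    finally show ?thesis .
  qed
  have total: "rcard (Q \<inter> Pi\<^sub>E I Z) = ?n1 + ?n2 + ?n3"
  proof -
    have "card (Q \<inter> Pi\<^sub>E I Z) = card (Q \<inter> Pi\<^sub>E I (Z(i := S))) + card (Q \<inter> Pi\<^sub>E I (Z(i := Z i - S)))"
      using I ij SZ by (intro cylinder_split) auto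
    moreover have "card (Q \<inter> Pi\<^sub>E I (Z(i := S))) = card (Q \<inter> Pi\<^sub>E I (Z(i := S, j := T)))
        + card (Q \<inter> Pi\<^sub>E I (Z(i := S, j := (Z(i := S)) j - T)))"
      using I ij SZ TZ fS by (intro cylinder_split) auto
    ultimately show ?thesis using ij by simp
  qed
  have vol2: "volume I (Z(i := A, j := B)) = rcard A * rcard B * ?R" for A B
  proof -
    have "volume I (Z(i := A, j := B)) = rcard B * volume (I - {j}) (Z(i := A))"
      using I ij by (intro volume_upd) auto
    also have "volume (I - {j}) (Z(i := A)) = rcard A * volume (I - {j} - {i}) Z"
      using I ij by (intro volume_upd) auto
    also have "I - {j} - {i} = I - {i} - {j}" by blast
    finally show ?thesis by (simp only: mult_ac)
  qed
  have vol0: "volume I Z = ?x * ?y * ?R" using vol2[of "Z i" "Z j"] by simp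
  have vol3: "volume I (Z(i := A)) = rcard A * ?y * ?R" for A
    using vol2[of A "Z j"] ij by (simp add: fun_upd_idem)
  have cS: "rcard (Z i - S) = ?x - ?s" and cT: "rcard (Z j - T) = ?y - ?t"
    using SZ TZ fS fT I ij by (auto simp: card_Diff_subset of_nat_diff card_mono)
  have "?\<kappa> * D * volume I (Z(i := S, j := Z j - T)) < ?n2 \<or> ?\<kappa> * D * volume I (Z(i := Z i - S))
      < ?n3"
  proof (rule ccontr)
    assume "\<not> ?thesis"
    then have n2: "?n2 \<le> ?\<kappa> * D * (?s * (?y - ?t) * ?R)"
        and n3: "?n3 \<le> ?\<kappa> * D * ((?x - ?s) * ?y * ?R)"
      using vol2[of S "Z j - T"] vol3[of "Z i - S"] cS cT by auto
    have "(\<delta> / 2 * ?s * ?t) * ?R \<le> (D / 2 * ?s * ?t) * ?R" using D Rpos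
        by (intro mult_right_mono) auto
    then have "D * (?x * ?y * ?R) \<le> (D / 2 * ?s * ?t) * ?R + ?\<kappa> * D * (?s * (?y - ?t) * ?R) + ?\<kappa> * D
        * ((?x - ?s) * ?y * ?R)"
      using n1 n2 n3 total D(3)[unfolded vol0] by linarith
    also have "\<dots> = D * ?R * (?s * ?t / 2 + ?\<kappa> * (?x * ?y - ?s * ?t))" by (simp add: algebra_simps)
    also have "\<dots> < D * ?R * (?x * ?y)"
    proof (rule mult_strict_left_mono)
      show "?s * ?t / 2 + ?\<kappa> * (?x * ?y - ?s * ?t) < ?x * ?y"
        using \<epsilon> I ij S T scale_ge[of \<epsilon> "card (Z i)"] scale_ge[of \<epsilon> "card (Z j)"]
            by (intro increment_arith) auto
    qed (use D Rpos in auto)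
    finally show False by (simp add: algebra_simps)
  qed
  then have "\<exists>Z'. (\<forall>l\<in>I. Z' l \<subseteq> Z l \<and> scale \<epsilon> (card (Z l)) \<le> card (Z' l)) \<and>
      ?\<kappa> * D * volume I Z' \<le> rcard (Q \<inter> Pi\<^sub>E I Z')"
  proof
    assume a: "?\<kappa> * D * volume I (Z(i := S, j := Z j - T)) < ?n2"
    \<comment> \<open>The strict excess of cliques shows that the part is nonempty, which is what
      \<open>scale_le_rest\<close> needs in order to provide enough room.\<close>
    have "Z j - T \<noteq> {}"
    proof
      assume "Z j - T = {}"
      then have "Pi\<^sub>E I (Z(i := S, j := Z j - T)) = {}" using ij by (auto simp: PiE_eq_empty_iff)
      then show False using a D vol2[of S "Z j - T"] \<open>Z j - T = {}\<close> by simp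
    qed
    then have "card T < card (Z j)" using TZ I ij by (metis Diff_eq_empty_iff card_seteq not_less)
    then have "scale \<epsilon> (card (Z j)) \<le> card (Z j - T)"
      using scale_le_rest[OF \<epsilon>] T fT TZ by (simp add: card_Diff_subset)
    then show ?thesis using a ij SZ S sc by (intro exI[of _ "Z(i := S, j := Z j - T)"]) auto
  next
    assume a: "?\<kappa> * D * volume I (Z(i := Z i - S)) < ?n3"
    have "Z i - S \<noteq> {}"
    proof
      assume "Z i - S = {}"
      then have "Pi\<^sub>E I (Z(i := Z i - S)) = {}" using ij by (auto simp: PiE_eq_empty_iff)
      then show False using a D vol3[of "Z i - S"] \<open>Z i - S = {}\<close> by simp
    qed
    then have "card S < card (Z i)" using SZ I ij by (metis Diff_eq_empty_iff card_seteq not_less)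
    then have "scale \<epsilon> (card (Z i)) \<le> card (Z i - S)"
      using scale_le_rest[OF \<epsilon>] S fS SZ by (simp add: card_Diff_subset)
    then show ?thesis using a ij sc by (intro exI[of _ "Z(i := Z i - S)"]) auto
  qed
  then obtain Z1 where Z1: "\<forall>l\<in>I. Z1 l \<subseteq> Z l \<and> scale \<epsilon> (card (Z l)) \<le> card (Z1 l)"
      "?\<kappa> * D * volume I Z1 \<le> rcard (Q \<inter> Pi\<^sub>E I Z1)" by blast
  have "\<exists>Z'. (\<forall>i\<in>I. Z' i \<subseteq> Z1 i \<and> card (Z' i) = scale \<epsilon> (card (Z i))) \<and>
      ?\<kappa> * D * volume I Z' \<le> rcard (Q \<inter> Pi\<^sub>E I Z')"
  proof (rule cylinder_shrink)
    show "card (Z1 l) > 0" if "l \<in> I" for l using Z1(1) sc(2)[OF that] that by (meson less_le_trans)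
    show "finite (Z1 l)" if "l \<in> I" for l using Z1(1) I(2)[OF that] that by (meson finite_subset)
  qed (use Z1 I in auto)
  then show ?thesis using Z1 by (metis (no_types, opaque_lifting) subset_trans)
qed

text \<open>The assumption on \<open>t\<close> says that \<open>t\<close> further increments raise
  the density to at least 1. For \<open>t = 0\<close> the density is already 1 and an increment
  would produce more cliques than tuples, so the cylinder is regular. \<open>s\<close> counts the
  increments made.\<close>

lemma exists_regular_cylinder_aux:
  assumes I: "finite I"
    and Q: "\<And>g i j. g \<in> Q \<Longrightarrow> i \<in> I \<Longrightarrow> j \<in> I \<Longrightarrow> i \<noteq> j \<Longrightarrow> G i j (g i) (g j)"
    and \<epsilon>: "0 < \<epsilon>" "\<epsilon> \<le> 1/4" and \<delta>: "0 < \<delta>"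
  shows "\<lbrakk>\<And>i. i \<in> I \<Longrightarrow> finite (B i) \<and> card (B i) > 0; \<delta> \<le> D; 1 \<le> (1 + \<epsilon>\<^sup>2 / 2) ^ t * D;
      D * volume I B \<le> rcard (Q \<inter> Pi\<^sub>E I B)\<rbrakk> \<Longrightarrow>
    \<exists>Z s. s \<le> t \<and> (\<forall>i\<in>I. Z i \<subseteq> B i \<and> card (Z i) = (scale \<epsilon> ^^ s) (card (B i))) \<and>
      regular_cylinder G I Z \<epsilon> (\<delta> / 2) \<and> \<delta> * volume I Z \<le> rcard (Q \<inter> Pi\<^sub>E I Z)"
proof (induction t arbitrary: B D)
  case (0 B D)
  have fin: "finite (B i)" "card (B i) > 0" if "i \<in> I" for i using 0(1)[OF that] by auto
  have "regular_cylinder G I B \<epsilon> (\<delta> / 2)"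
  proof (rule ccontr)
    assume "\<not> ?thesis"
    from density_increment[where G = G and Z = B and D = D and Q = Q, OF I fin Q \<delta> 0(2,4) \<epsilon> this]
    obtain Z' where Z': "\<forall>i\<in>I. Z' i \<subseteq> B i \<and> card (Z' i) = scale \<epsilon> (card (B i))"
      "(1 + \<epsilon>\<^sup>2 / 2) * D * volume I Z' \<le> rcard (Q \<inter> Pi\<^sub>E I Z')" by auto
    have pos: "card (Z' i) > 0" "finite (Z' i)" if "i \<in> I" for i
      using Z' fin[OF that] that \<epsilon> scale_pos[of \<epsilon> "card (B i)"] by (auto intro: finite_subset)
    have "card (Q \<inter> Pi\<^sub>E I Z') \<le> card (Pi\<^sub>E I Z')" using pos I by (intro card_mono finite_PiE) auto
    then have "(1 + \<epsilon>\<^sup>2 / 2) * D * volume I Z' \<le> volume I Z'"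
      using Z'(2) card_cylinder[OF I, of Z'] by linarith
    moreover have "0 < volume I Z'" using pos by (intro volume_pos) auto
    moreover have "1 < (1 + \<epsilon>\<^sup>2 / 2) * D"
    proof -
      have "1 < 1 + \<epsilon>\<^sup>2 / 2" using \<epsilon> by simp
      also have "\<dots> \<le> (1 + \<epsilon>\<^sup>2 / 2) * D" using mult_left_mono[of 1 D "1 + \<epsilon>\<^sup>2 / 2"] 0(3) by simp
      finally show ?thesis .
    qed
    ultimately show False using mult_strict_right_mono[of 1 "(1 + \<epsilon>\<^sup>2 / 2) * D" "volume I Z'"]
        by simp
  qed
  moreover have "\<delta> * volume I B \<le> D * volume I B" using 0
      by (intro mult_right_mono volume_nonneg) auto
  ultimately show ?case using 0 by (intro exI[of _ B] exI[of _ 0]) auto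
next
  case (Suc t B D)
  show ?case
  proof (cases "regular_cylinder G I B \<epsilon> (\<delta> / 2)")
    case True
    have "\<delta> * volume I B \<le> D * volume I B" using Suc by (intro mult_right_mono volume_nonneg) auto
    then show ?thesis using Suc True by (intro exI[of _ B] exI[of _ 0]) auto
  next
    case False
    then obtain Z' where Z': "\<forall>i\<in>I. Z' i \<subseteq> B i \<and> card (Z' i) = scale \<epsilon> (card (B i))"
      "(1 + \<epsilon>\<^sup>2 / 2) * D * volume I Z' \<le> rcard (Q \<inter> Pi\<^sub>E I Z')"
      using density_increment[where G=G and Z=B and D=D and Q=Q, OF I _ _ Q \<delta> _ _ \<epsilon> False] Suc.prems
          by auto
    have pos: "finite (Z' i) \<and> card (Z' i) > 0" if "i \<in> I" for i
      using Z' Suc.prems(1)[OF that] that \<epsilon> scale_pos[of \<epsilon> "card (B i)"]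
          by (auto intro: finite_subset)
    have "1 * D \<le> (1 + \<epsilon>\<^sup>2 / 2) * D" using \<delta> Suc.prems(2) by (intro mult_right_mono) auto
    then have D: "\<delta> \<le> (1 + \<epsilon>\<^sup>2 / 2) * D" using Suc.prems(2) by linarith
    have "1 \<le> (1 + \<epsilon>\<^sup>2 / 2) ^ t * ((1 + \<epsilon>\<^sup>2 / 2) * D)" using Suc.prems(3) by (simp add: mult_ac)
    from Suc.IH[OF pos D this Z'(2)] obtain Z s where Zs: "s \<le> t"
      "\<forall>i\<in>I. Z i \<subseteq> Z' i \<and> card (Z i) = (scale \<epsilon> ^^ s) (card (Z' i))"
      "regular_cylinder G I Z \<epsilon> (\<delta> / 2)" "\<delta> * volume I Z \<le> rcard (Q \<inter> Pi\<^sub>E I Z)" by blast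
    then show ?thesis using Z' by (intro exI[of _ Z] exI[of _ "Suc s"]) (auto simp: funpow_swap1)
  qed
qed

lemma scale_funpow_ge:
  assumes "0 < \<epsilon>" "\<epsilon> \<le> 1" "s \<le> t"
  shows "\<epsilon> ^ t * real n \<le> real ((scale \<epsilon> ^^ s) n)"
proof -
  have "\<epsilon> ^ s * real n \<le> real ((scale \<epsilon> ^^ s) n)"
  proof (induction s)
    case (Suc s)
    have "\<epsilon> ^ Suc s * real n = \<epsilon> * (\<epsilon> ^ s * real n)" by simp
    also have "\<dots> \<le> \<epsilon> * real ((scale \<epsilon> ^^ s) n)" using Suc assms by (intro mult_left_mono) auto
    also have "\<dots> \<le> real (scale \<epsilon> ((scale \<epsilon> ^^ s) n))" by (rule scale_ge)
    finally show ?case by simp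
  qed simp
  moreover have "\<epsilon> ^ t \<le> \<epsilon> ^ s" using assms by (intro power_decreasing) auto
  ultimately show ?thesis using mult_right_mono[of "\<epsilon> ^ t" "\<epsilon> ^ s" "real n"] by linarith
qed

text \<open>Since all sides shrink by the same function of their size, sides of equal size stay
  of equal size.\<close>

lemma exists_regular_cylinder:
  assumes "finite I" "\<And>i. i \<in> I \<Longrightarrow> finite (B i) \<and> card (B i) > 0"
    and "\<And>g i j. g \<in> Q \<Longrightarrow> i \<in> I \<Longrightarrow> j \<in> I \<Longrightarrow> i \<noteq> j \<Longrightarrow> G i j (g i) (g j)"
    and \<epsilon>: "0 < \<epsilon>" "\<epsilon> \<le> 1/4" "\<epsilon> \<le> \<delta>" and t: "2 / \<epsilon> ^ 3 \<le> real t"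
    and "\<delta> * volume I B \<le> rcard (Q \<inter> Pi\<^sub>E I B)"
  shows "\<exists>Z. (\<forall>i\<in>I. Z i \<subseteq> B i \<and> \<epsilon> ^ t * rcard (B i) \<le> rcard (Z i)) \<and>
      (\<forall>i\<in>I. \<forall>j\<in>I. card (B i) = card (B j) \<longrightarrow> card (Z i) = card (Z j)) \<and>
      regular_cylinder G I Z \<epsilon> (\<delta> / 2) \<and> \<delta> * volume I Z \<le> rcard (Q \<inter> Pi\<^sub>E I Z)"
proof -
  \<comment> \<open>By Bernoulli's inequality, \<open>t \<ge> 2 / \<epsilon> ^ 3\<close> increments
    by \<open>1 + \<epsilon> ^ 2 / 2\<close> multiply the density by at least
    \<open>1 / \<epsilon>\<close>, which is at least \<open>1 / \<delta>\<close>.\<close>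
  have "1 \<le> (1 + \<epsilon>\<^sup>2 / 2) ^ t * \<delta>"
  proof -
    have "1 / \<epsilon> = 2 / \<epsilon> ^ 3 * (\<epsilon>\<^sup>2 / 2)" using \<epsilon> by (simp add: power2_eq_square power3_eq_cube)
    also have "\<dots> \<le> real t * (\<epsilon>\<^sup>2 / 2)" using t by (intro mult_right_mono) auto
    also have "\<dots> \<le> 1 + real t * (\<epsilon>\<^sup>2 / 2)" by simp
    also have "\<dots> \<le> (1 + \<epsilon>\<^sup>2 / 2) ^ t" by (rule Bernoulli_inequality) (simp add: order_trans[of _ 0])
    finally have "1 / \<epsilon> * \<epsilon> \<le> (1 + \<epsilon>\<^sup>2 / 2) ^ t * \<delta>" using \<epsilon> by (intro mult_mono) auto
    then show ?thesis using \<epsilon> by simp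
  qed
  moreover have "0 < \<delta>" using \<epsilon> by linarith
  ultimately have "\<exists>Z s. s \<le> t \<and> (\<forall>i\<in>I. Z i \<subseteq> B i \<and> card (Z i) = (scale \<epsilon> ^^ s) (card (B i))) \<and>
      regular_cylinder G I Z \<epsilon> (\<delta> / 2) \<and> \<delta> * volume I Z \<le> rcard (Q \<inter> Pi\<^sub>E I Z)"
    using assms by (intro exists_regular_cylinder_aux[where D = \<delta>]) auto
  then
  obtain Z s where Z: "s \<le> t" "\<forall>i\<in>I. Z i \<subseteq> B i \<and> card (Z i) = (scale \<epsilon> ^^ s) (card (B i))"
      "regular_cylinder G I Z \<epsilon> (\<delta> / 2)" "\<delta> * volume I Z \<le> rcard (Q \<inter> Pi\<^sub>E I Z)" by blast
  then show ?thesis using \<epsilon> scale_funpow_ge[of \<epsilon> s t] by (intro exI[of _ Z]) auto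
qed

section \<open>Embedding and robust matchings\<close>

lemma real_card_Diff: "finite A \<Longrightarrow> B \<subseteq> A \<Longrightarrow> rcard (A - B) = rcard A - rcard B"
  by (simp add: card_Diff_subset card_mono finite_subset of_nat_diff)

lemma regular_cylinderD:
  assumes "regular_cylinder G I Z \<epsilon> d" "i \<in> I" "j \<in> I" "i \<noteq> j" "T \<subseteq> Z j"
    and "\<epsilon> * rcard (Z j) \<le> rcard T"
  shows "rcard {w \<in> Z i. rcard {t \<in> T. G i j w t} < d * rcard T} < \<epsilon> * rcard (Z i)"
  using assms unfolding regular_cylinder_def by blast

text \<open>The last conclusion controls the candidate sets of the vertices that are not yet embedded;
  it is what makes the induction work.\<close>

lemma greedy_embedding:
  fixes G :: "'a \<Rightarrow> 'a \<Rightarrow> bool" and adj :: "'v \<Rightarrow> 'v \<Rightarrow> bool"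
  assumes reg: "regular_cylinder (\<lambda>i j. G) I Z \<epsilon> d" and Z: "\<And>i. i \<in> I \<Longrightarrow> finite (Z i)"
    and symG: "\<And>x y. G x y \<Longrightarrow> G y x"
    and V: "finite V" "\<And>x y. adj x y \<Longrightarrow> adj y x" "\<And>x. x \<in> V \<Longrightarrow> card {y \<in> V. adj x y} \<le> \<Delta>"
    and \<chi>: "\<And>x. x \<in> V \<Longrightarrow> \<chi> x \<in> I" "\<And>x y. x \<in> V \<Longrightarrow> y \<in> V \<Longrightarrow> adj x y \<Longrightarrow> \<chi> x \<noteq> \<chi> y"
    and C: "\<And>x. x \<in> V \<Longrightarrow> C x \<subseteq> Z (\<chi> x)" "\<And>x. x \<in> V \<Longrightarrow> \<alpha> * rcard (Z (\<chi> x)) \<le> rcard (C x)"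
    and d: "0 < d" "d \<le> 1" "0 \<le> \<epsilon>" "0 \<le> \<alpha>" "\<epsilon> \<le> \<alpha> * d ^ \<Delta>"
    and room: "\<And>x. x \<in> V \<Longrightarrow> real \<Delta> * \<epsilon> * rcard (Z (\<chi> x)) + rcard V \<le> \<alpha> * d ^ \<Delta> * rcard (Z (\<chi> x))"
    and Y: "Y \<subseteq> V"
  shows "\<exists>f. inj_on f Y \<and> (\<forall>y\<in>Y. f y \<in> C y) \<and> (\<forall>x\<in>Y. \<forall>y\<in>Y. adj x y \<longrightarrow> G (f x) (f y)) \<and>
    (\<forall>x\<in>V - Y. d ^ card {y \<in> Y. adj x y} * rcard (C x)
        \<le> rcard {w \<in> C x. \<forall>y\<in>Y. adj x y \<longrightarrow> G (f y) w})"
proof -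
  have "finite Y" using Y V finite_subset by blast
  then show ?thesis using Y
  proof (induction Y rule: finite_subset_induct')
    case empty
    then show ?case by auto
  next
    case (insert v Y)
    then obtain f where inj: "inj_on f Y" and fC: "\<forall>y\<in>Y. f y \<in> C y"
      and hom: "\<forall>x\<in>Y. \<forall>y\<in>Y. adj x y \<longrightarrow> G (f x) (f y)"
      and cand: "\<forall>x\<in>V - Y. d ^ card {y \<in> Y. adj x y} * rcard (C x)
        \<le> rcard {w \<in> C x. \<forall>y\<in>Y. adj x y \<longrightarrow> G (f y) w}" by blast
    define C' where "C' x = {w \<in> C x. \<forall>y\<in>Y. adj x y \<longrightarrow> G (f y) w}" for x
    have irr: "\<not> adj x x" if "x \<in> V" for x using \<chi>(2) that by blast
    have big: "\<alpha> * d ^ \<Delta> * rcard (Z (\<chi> x)) \<le> rcard (C' x)" if x: "x \<in> V - Y" for x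
    proof -
      have "card {y \<in> Y. adj x y} \<le> card {y \<in> V. adj x y}" using V(1) insert.hyps
          by (intro card_mono) auto
      then have "card {y \<in> Y. adj x y} \<le> \<Delta>" using V(3)[of x] x by simp
      then have "d ^ \<Delta> \<le> d ^ card {y \<in> Y. adj x y}" using d by (intro power_decreasing) auto
      then have "d ^ \<Delta> * (\<alpha> * rcard (Z (\<chi> x))) \<le> d ^ card {y \<in> Y. adj x y} * rcard (C x)"
        using C(2)[of x] x d by (intro mult_mono) auto
      also have "\<dots> \<le> rcard (C' x)" using cand x by (simp add: C'_def)
      finally show ?thesis by (simp add: mult_ac)
    qed
    define Nb where "Nb = {x \<in> V - insert v Y. adj v x}"
    \<comment> \<open>Only the unembedded neighbours of \<open>v\<close> lose candidates. An image
      of \<open>v\<close> is bad for such an \<open>x\<close> if fewer than a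
      \<open>d\<close>-fraction of the candidates of \<open>x\<close> would survive; by regularity
      this excludes at most an \<open>\<epsilon>\<close>-fraction of the side of
      \<open>v\<close>.\<close>
    define bad where "bad x = {w \<in> Z (\<chi> v). rcard {t \<in> C' x. G w t} < d * rcard (C' x)}" for x
    have vV: "v \<in> V" "v \<notin> Y" using insert by auto
    have cardNb: "card Nb \<le> \<Delta>"
    proof -
      have "card Nb \<le> card {y \<in> V. adj v y}" unfolding Nb_def using V(1) by (intro card_mono) auto
      then show ?thesis using V(3)[OF vV(1)] by simp
    qed
    have fNb: "finite Nb" using V(1) by (simp add: Nb_def)
    have badle: "rcard (bad x) \<le> \<epsilon> * rcard (Z (\<chi> v))" if x: "x \<in> Nb" for x
    proof -
      have xV: "x \<in> V - Y" "adj v x" using x by (auto simp: Nb_def)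
      have "rcard (bad x) < \<epsilon> * rcard (Z (\<chi> v))"
        unfolding bad_def
      proof (rule regular_cylinderD[OF reg])
        show "\<chi> v \<in> I" "\<chi> x \<in> I" "\<chi> v \<noteq> \<chi> x" using \<chi> vV xV by auto
        show "C' x \<subseteq> Z (\<chi> x)" using C(1)[of x] xV by (auto simp: C'_def)
        have "\<epsilon> * rcard (Z (\<chi> x)) \<le> \<alpha> * d ^ \<Delta> * rcard (Z (\<chi> x))"
          using d by (intro mult_right_mono) auto
        then show "\<epsilon> * rcard (Z (\<chi> x)) \<le> rcard (C' x)" using big[OF xV(1)] by linarith
      qed
      then show ?thesis by simp
    qed
    have fZ: "finite (Z (\<chi> v))" using Z \<chi> vV by blast
    have "card (f ` Y \<union> (\<Union>x\<in>Nb. bad x)) \<le> card (f ` Y) + card (\<Union>x\<in>Nb. bad x)" by (rule card_Un_le)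
    also have "\<dots> \<le> card Y + (\<Sum>x\<in>Nb. card (bad x))"
      using insert.hyps fNb by (intro add_mono card_image_le card_UN_le) auto
    finally have "rcard (f ` Y \<union> (\<Union>x\<in>Nb. bad x)) \<le> rcard Y + (\<Sum>x\<in>Nb. rcard (bad x))"
      by (metis of_nat_add of_nat_mono of_nat_sum)
    also have "(\<Sum>x\<in>Nb. rcard (bad x)) \<le> (\<Sum>x\<in>Nb. \<epsilon> * rcard (Z (\<chi> v)))"
      using badle by (intro sum_mono)
    also have "\<dots> = rcard Nb * (\<epsilon> * rcard (Z (\<chi> v)))" by simp
    also have "\<dots> \<le> real \<Delta> * (\<epsilon> * rcard (Z (\<chi> v)))" using cardNb d by (intro mult_right_mono) auto
    \<comment> \<open>Strictness enters here, because \<open>v\<close> is not in \<open>Y\<close>;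
      the bound on the bad vertices is not strict when \<open>Nb\<close> is empty.\<close>
    also have "rcard Y < rcard V"
      using V(1) vV insert.hyps by (simp add: psubset_card_mono psubsetI subset_iff) (metis
          psubset_card_mono psubsetI subsetI)
    finally have "rcard (f ` Y \<union> (\<Union>x\<in>Nb. bad x)) < rcard (C' v)"
      using big[of v] room[OF vV(1)] vV by (simp add: mult_ac)
    moreover have "finite (f ` Y \<union> (\<Union>x\<in>Nb. bad x))"
      using insert.hyps fNb fZ by (auto simp: bad_def)
    ultimately have "\<not> C' v \<subseteq> f ` Y \<union> (\<Union>x\<in>Nb. bad x)"
      by (meson card_mono leD of_nat_less_iff)
    then obtain w where w: "w \<in> C' v" "w \<notin> f ` Y" "\<forall>x\<in>Nb. w \<notin> bad x" by blast
    let ?f = "f(v := w)"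
    have feq: "?f y = f y" if "y \<in> Y" for y using that vV by auto
    show ?case
    proof (intro exI[of _ ?f] conjI)
      show "inj_on ?f (insert v Y)" using inj w vV by (auto simp: inj_on_def)
      show "\<forall>y\<in>insert v Y. ?f y \<in> C y" using fC w feq by (auto simp: C'_def)
      show "\<forall>x\<in>insert v Y. \<forall>y\<in>insert v Y. adj x y \<longrightarrow> G (?f x) (?f y)"
      proof (intro ballI impI)
        fix x y assume xy: "x \<in> insert v Y" "y \<in> insert v Y" "adj x y"
        have w': "G (f y) w" if "y \<in> Y" "adj v y" for y using w(1) that by (simp add: C'_def)
        consider "x = v" "y \<in> Y" | "y = v" "x \<in> Y" | "x \<in> Y" "y \<in> Y"
          using xy irr[OF vV(1)] by blast
        then show "G (?f x) (?f y)"
        proof cases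
          case 1 then show ?thesis using w' symG xy feq by simp
        next
          case 2 then show ?thesis using w' V(2) xy feq by simp
        next
          case 3 then show ?thesis using hom xy feq by simp
        qed
      qed
      show "\<forall>x\<in>V - insert v Y. d ^ card {y \<in> insert v Y. adj x y} * rcard (C x)
          \<le> rcard {u \<in> C x. \<forall>y\<in>insert v Y. adj x y \<longrightarrow> G (?f y) u}"
      proof
        fix x assume x: "x \<in> V - insert v Y"
        have x': "x \<in> V - Y" using x by blast
        show "d ^ card {y \<in> insert v Y. adj x y} * rcard (C x)
          \<le> rcard {u \<in> C x. \<forall>y\<in>insert v Y. adj x y \<longrightarrow> G (?f y) u}"
        proof (cases "adj x v")
          case False
          then have "{y \<in> insert v Y. adj x y} = {y \<in> Y. adj x y}" by auto
          moreover have "{u \<in> C x. \<forall>y\<in>insert v Y. adj x y \<longrightarrow> G (?f y) u} = C' x"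
            using False feq by (auto simp: C'_def)
          ultimately show ?thesis using cand x' by (simp add: C'_def)
        next
          case True
          then have xN: "x \<in> Nb" using x V(2) by (auto simp: Nb_def)
          have "{y \<in> insert v Y. adj x y} = insert v {y \<in> Y. adj x y}" using True by auto
          then have c: "card {y \<in> insert v Y. adj x y} = Suc (card {y \<in> Y. adj x y})"
            using vV insert.hyps by simp
          have "{u \<in> C x. \<forall>y\<in>insert v Y. adj x y \<longrightarrow> G (?f y) u} = {t \<in> C' x. G w t}"
            using True feq by (auto simp: C'_def)
          moreover have "d * rcard (C' x) \<le> rcard {t \<in> C' x. G w t}"
            using w(1,3) xN C(1)[OF vV(1)] by (auto simp: bad_def C'_def)
          moreover have "d * (d ^ card {y \<in> Y. adj x y} * rcard (C x)) \<le> d * rcard (C' x)"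
            using cand x' d by (intro mult_left_mono) (auto simp: C'_def)
          ultimately show ?thesis using c by simp
        qed
      qed
    qed
  qed
qed

text \<open>Hall's condition, where at most \<open>5 * (\<epsilon> * s)\<close> vertices are missing
  from either side. A set \<open>S\<close> below \<open>\<epsilon> * s\<close> is handled by the
  degree of one of its elements. For a larger \<open>S\<close>, regularity leaves fewer than
  \<open>\<epsilon> * s\<close> vertices of \<open>P\<close> outside the neighbourhood
  \<open>?N\<close>. If such a vertex \<open>p\<close> exists, all its neighbours avoid
  \<open>S\<close>; its degree of at least \<open>7 * (\<epsilon> * s)\<close> makes
  \<open>S\<close> smaller than \<open>X\<close> by at least \<open>2 * (\<epsilon> * s)\<close>,
  hence smaller than \<open>?N\<close>.\<close>

lemma regular_pair_perfect_matching:
  fixes H :: "'a \<Rightarrow> 'a \<Rightarrow> bool"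
  assumes fin: "finite X1" "finite P1" and card: "card X1 = s" "card P1 = s"
    and \<epsilon>: "0 < \<epsilon>" "7 * \<epsilon> \<le> d" "1 \<le> \<epsilon> * real s"
    and noholes: "\<And>T. T \<subseteq> P1 \<Longrightarrow> \<epsilon> * real s \<le> rcard T \<Longrightarrow>
        rcard {x \<in> X1. rcard {t \<in> T. H x t} < d * rcard T} < \<epsilon> * real s"
    and degX: "\<And>x. x \<in> X \<Longrightarrow> d * real s \<le> rcard {p \<in> P1. H x p}"
    and degP: "\<And>p. p \<in> P \<Longrightarrow> d * real s \<le> rcard {x \<in> X1. H x p}"
    and sub: "X \<subseteq> X1" "P \<subseteq> P1" "card X = card P"
    and large: "real s - 5 * (\<epsilon> * real s) \<le> rcard P"
  shows "\<exists>f. bij_betw f X P \<and> (\<forall>x\<in>X. H x (f x))"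
proof -
  have fX: "finite X" "finite P" using fin sub finite_subset by auto
  have es: "0 < \<epsilon> * real s" using \<epsilon> by linarith
  have ds: "7 * (\<epsilon> * real s) \<le> d * real s" using \<epsilon>(2) mult_right_mono[of "7 * \<epsilon>" d "real s"] by simp
  have miss: "rcard (P1 - P) \<le> 5 * (\<epsilon> * real s)" "rcard (X1 - X) \<le> 5 * (\<epsilon> * real s)"
  proof -
    have "card P \<le> s" using sub(2) fin(2) card(2) by (metis card_mono)
    then show "rcard (P1 - P) \<le> 5 * (\<epsilon> * real s)" "rcard (X1 - X) \<le> 5 * (\<epsilon> * real s)"
      using large sub card fX by (auto simp: card_Diff_subset of_nat_diff)
  qed
  have "\<exists>f. inj_on f X \<and> (\<forall>x\<in>X. f x \<in> {p \<in> P. H x p})"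
  proof (rule Hall_marriage)
    show "finite X" by (rule fX)
    show "finite {p \<in> P. H x p}" for x using fX by simp
    fix S assume S: "S \<subseteq> X"
    let ?N = "\<Union>x\<in>S. {p \<in> P. H x p}"
    let ?T = "P - ?N"
    have fS: "finite S" using S fX finite_subset by blast
    have NP: "?N \<subseteq> P" by blast
    have fN: "finite ?N" using NP fX finite_subset by blast
    have TN: "rcard ?T = rcard P - rcard ?N"
      using NP fN fX by (simp add: card_Diff_subset of_nat_diff card_mono)
    show "card S \<le> card ?N"
    proof (cases "S = {}")
      case False
      then obtain x where x: "x \<in> S" by blast
      show ?thesis
      proof (cases "rcard S < \<epsilon> * real s")
        case True
        have "{p \<in> P1. H x p} \<subseteq> ?N \<union> (P1 - P)" using x by blast
        then have "card {p \<in> P1. H x p} \<le> card (?N \<union> (P1 - P))" using fN fin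
            by (intro card_mono) auto
        also have "\<dots> \<le> card ?N + card (P1 - P)" by (rule card_Un_le)
        finally have "rcard {p \<in> P1. H x p} \<le> rcard ?N + rcard (P1 - P)" by linarith
        then have "rcard S \<le> rcard ?N" using degX[of x] x S miss(1) ds True es by fastforce
        then show ?thesis by simp
      next
        case False
        have Tsmall: "rcard ?T < \<epsilon> * real s"
        proof (rule ccontr)
          assume "\<not> ?thesis"
          then have T: "\<epsilon> * real s \<le> rcard ?T" by simp
          have "S \<subseteq> {x \<in> X1. rcard {t \<in> ?T. H x t} < d * rcard ?T}"
          proof
            fix y assume y: "y \<in> S"
            have "{t \<in> ?T. H y t} = {}" using y by blast
            moreover have "0 < d * rcard ?T" using T es \<epsilon> by (intro mult_pos_pos) auto
            ultimately have "rcard {t \<in> ?T. H y t} < d * rcard ?T"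
                by (simp only: card.empty of_nat_0)
            then show "y \<in> {x \<in> X1. rcard {t \<in> ?T. H x t} < d * rcard ?T}"
              using y S sub by blast
          qed
          then have "card S \<le> card {x \<in> X1. rcard {t \<in> ?T. H x t} < d * rcard ?T}"
            using fin by (intro card_mono) auto
          moreover have "rcard {x \<in> X1. rcard {t \<in> ?T. H x t} < d * rcard ?T} < \<epsilon> * real s"
            using sub T by (intro noholes) auto
          ultimately show False using False by linarith
        qed
        show ?thesis
        proof (cases "?T = {}")
          case True
          then have "?N = P" using NP by blast
          then show ?thesis using S fX sub by (metis card_mono)
        next
          case False
          then obtain p where p: "p \<in> ?T" by blast
          have "{x \<in> X1. H x p} \<subseteq> (X - S) \<union> (X1 - X)" using p by blast
          then have "card {x \<in> X1. H x p} \<le> card ((X - S) \<union> (X1 - X))" using fX fin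
              by (intro card_mono) auto
          also have "\<dots> \<le> card (X - S) + card (X1 - X)" by (rule card_Un_le)
          finally have "rcard {x \<in> X1. H x p} \<le> rcard (X - S) + rcard (X1 - X)" by linarith
          moreover have "rcard (X - S) = rcard X - rcard S"
            using S fS fX by (simp add: card_Diff_subset of_nat_diff card_mono)
          ultimately have "rcard S \<le> rcard ?N"
            using degP[of p] p miss(2) ds es TN Tsmall sub(3) by auto
          then show ?thesis by simp
        qed
      qed
    qed simp
  qed
  then obtain f where f: "inj_on f X" "\<forall>x\<in>X. f x \<in> P \<and> H x (f x)" by auto
  have "f ` X = P" using f fX sub by (intro card_subset_eq) (auto simp: card_image)
  then show ?thesis using f by (auto simp: bij_betw_def)
qed

text \<open>Regularise the bipartite graph, discard the vertices of low degree on both sides, and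
  make \<open>X'\<close> slightly smaller than \<open>B\<close>. Any \<open>B'\<close> of the size
  of \<open>X'\<close> still is almost a whole side of the regular pair, so the perfect matching
  lemma applies to it.\<close>

lemma robust_matching:
  fixes H :: "'a \<Rightarrow> 'a \<Rightarrow> bool"
  assumes fin: "finite X" "finite P" "card X = M" "card P = M" "0 < M"
    and dens: "\<delta> * (real M * real M) \<le> (\<Sum>x\<in>X. rcard {p \<in> P. H x p})"
    and \<epsilon>: "0 < \<epsilon>" "14 * \<epsilon> \<le> \<delta>" "\<epsilon> \<le> 1/20" and t: "2 / \<epsilon> ^ 3 \<le> real t"
        and M: "1 \<le> \<epsilon> * (\<epsilon> ^ t * real M)"
  shows "\<exists>X' B. X' \<subseteq> X \<and> B \<subseteq> P \<and> card X' \<le> card B \<and> \<epsilon> ^ t * real M / 2 \<le> rcard B \<and>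
    rcard B \<le> 2 * rcard X' \<and> \<epsilon> * rcard B \<le> rcard B - rcard X' \<and>
    (\<forall>B'\<subseteq>B. card B' = card X' \<longrightarrow> (\<exists>f. bij_betw f X' B' \<and> (\<forall>x\<in>X'. H x (f x))))"
proof -
  \<comment> \<open>The bipartite graph is viewed as a cylinder with two sides, where a clique is an
    edge; \<open>G\<close> reads \<open>H\<close> in the direction given by its first index.\<close>
  define I where "I = {0::nat, 1}"
  define W where "W i = (if i = (0::nat) then X else P)" for i
  define G where "G i j x y = (if i = (0::nat) then H x y else H y x)" for i j :: nat and x y
  define Q where "Q = {g \<in> Pi\<^sub>E I W. H (g 0) (g 1)}"
  have I: "finite I" by (simp add: I_def)
  have volI: "volume I Z = rcard (Z 0) * rcard (Z 1)" for Z :: "nat \<Rightarrow> 'a set"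
    by (simp add: volume_def I_def)
  have "(\<Sum>x\<in>X. rcard {p \<in> P. H x p}) = rcard (SIGMA x:X. {p \<in> P. H x p})"
    using fin by simp
  also have "card (SIGMA x:X. {p \<in> P. H x p}) \<le> card Q"
  proof (rule card_inj_on_le)
    let ?\<phi> = "\<lambda>(x, p). restrict (\<lambda>i. if i = (0::nat) then x else p) I"
    show "inj_on ?\<phi> (SIGMA x:X. {p \<in> P. H x p})"
    proof (rule inj_onI, clarify)
      fix x p x' p' assume eq: "(\<lambda>i\<in>I. if i = (0::nat) then x else p) = (\<lambda>i\<in>I. if i
          = 0 then x' else p')"
      from fun_cong[OF eq, of 0] fun_cong[OF eq, of 1] show "x = x' \<and> p = p'" by (simp add: I_def)
    qed
    show "?\<phi> ` (SIGMA x:X. {p \<in> P. H x p}) \<subseteq> Q"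
      by (auto simp: Q_def W_def I_def PiE_iff)
    show "finite Q" unfolding Q_def using I fin
        by (auto intro!: finite_subset[OF _ finite_PiE[of I W]] simp: W_def)
  qed
  finally have "\<delta> * (real M * real M) \<le> rcard Q" using dens by linarith
  moreover have "volume I W = real M * real M" using volI fin by (simp add: W_def)
  moreover have "Q \<inter> Pi\<^sub>E I W = Q" by (auto simp: Q_def)
  ultimately have densQ: "\<delta> * volume I W \<le> rcard (Q \<inter> Pi\<^sub>E I W)" by simp
  have "\<exists>Z. (\<forall>i\<in>I. Z i \<subseteq> W i \<and> \<epsilon> ^ t * rcard (W i) \<le> rcard (Z i)) \<and>
      (\<forall>i\<in>I. \<forall>j\<in>I. card (W i) = card (W j) \<longrightarrow> card (Z i) = card (Z j)) \<and>
      regular_cylinder G I Z \<epsilon> (\<delta> / 2) \<and> \<delta> * volume I Z \<le> rcard (Q \<inter> Pi\<^sub>E I Z)"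
  proof (rule exists_regular_cylinder[OF I _ _ _ _ _ t densQ])
    show "finite (W i) \<and> 0 < card (W i)" for i using fin by (simp add: W_def)
    show "G i j (g i) (g j)" if "g \<in> Q" "i \<in> I" "j \<in> I" "i \<noteq> j" for g i j
      using that by (auto simp: G_def Q_def I_def)
  qed (use \<epsilon> in auto)
  then obtain Z where Z: "\<forall>i\<in>I. Z i \<subseteq> W i \<and> \<epsilon> ^ t * rcard (W i) \<le> rcard (Z i)"
      "\<forall>i\<in>I. \<forall>j\<in>I. card (W i) = card (W j) \<longrightarrow> card (Z i) = card (Z j)"
      "regular_cylinder G I Z \<epsilon> (\<delta> / 2)" by blast
  define X1 where "X1 = Z 0"
  define P1 where "P1 = Z 1"
  define s where "s = card X1"
  let ?d = "\<delta> / 2"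
  have sub: "X1 \<subseteq> X" "P1 \<subseteq> P" using Z(1) by (auto simp: I_def W_def X1_def P1_def)
  have fin1: "finite X1" "finite P1" using sub fin finite_subset by auto
  have "card (W 1) = card (W 0)" using fin by (simp add: W_def)
  then have "card (Z 1) = card (Z 0)" using Z(2) unfolding I_def by blast
  then have cP1: "card P1 = s" by (simp only: s_def X1_def P1_def)
  have sM: "\<epsilon> ^ t * real M \<le> real s" using Z(1) fin by (simp add: I_def W_def s_def X1_def)
  have "\<epsilon> * (\<epsilon> ^ t * real M) \<le> \<epsilon> * real s" using sM \<epsilon> by (intro mult_left_mono) auto
  then have es: "1 \<le> \<epsilon> * real s" using M by linarith
  have es20: "\<epsilon> * real s \<le> real s / 20" using \<epsilon> mult_right_mono[of \<epsilon> "1/20" "real s"] by simp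
  have cZ: "card (Z 0) = s" "card (Z 1) = s" using cP1 by (simp_all add: s_def X1_def P1_def)
  have holesX: "rcard {x \<in> X1. rcard {t \<in> T. H x t} < ?d * rcard T} < \<epsilon> * real s"
    if "T \<subseteq> P1" "\<epsilon> * real s \<le> rcard T" for T
    using regular_cylinderD[OF Z(3), of 0 1 T] that cZ by (simp add: I_def X1_def P1_def G_def)
  have holesP: "rcard {p \<in> P1. rcard {x \<in> T. H x p} < ?d * rcard T} < \<epsilon> * real s"
    if "T \<subseteq> X1" "\<epsilon> * real s \<le> rcard T" for T
    using regular_cylinderD[OF Z(3), of 1 0 T] that cZ by (simp add: I_def X1_def P1_def G_def)
  define X2 where "X2 = {x \<in> X1. ?d * real s \<le> rcard {p \<in> P1. H x p}}"
  define B where "B = {p \<in> P1. ?d * real s \<le> rcard {x \<in> X1. H x p}}"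
  let ?badX = "{x \<in> X1. rcard {t \<in> P1. H x t} < ?d * rcard P1}"
  let ?badP = "{p \<in> P1. rcard {x \<in> X1. H x p} < ?d * rcard X1}"
  have "X2 = X1 - ?badX" unfolding X2_def cP1 by auto
  then have "rcard X2 = rcard X1 - rcard ?badX"
    using fin1 by (simp only:) (rule real_card_Diff, auto)
  moreover have "rcard ?badX < \<epsilon> * real s" using cP1 es20 by (intro holesX) auto
  ultimately have cX2: "real s - \<epsilon> * real s \<le> rcard X2" unfolding s_def by linarith
  have "B = P1 - ?badP" unfolding B_def s_def by auto
  then have "rcard B = rcard P1 - rcard ?badP"
    using fin1 by (simp only:) (rule real_card_Diff, auto)
  moreover have "rcard ?badP < \<epsilon> * real s" using es20 by (intro holesP) (auto simp flip: s_def)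
  ultimately have cB: "real s - \<epsilon> * real s \<le> rcard B" unfolding cP1 by linarith
  have Bs: "rcard B \<le> real s" using cP1 fin1 by (metis (no_types, lifting) B_def card_mono
      mem_Collect_eq of_nat_mono subsetI)
  \<comment> \<open>Rounding costs at most one vertex, which \<open>\<epsilon> * s \<ge> 1\<close>
    pays for, so \<open>q\<close> lies between \<open>card B - 3 * (\<epsilon> * s)\<close> and
    \<open>card B - 2 * (\<epsilon> * s)\<close>. The upper end makes \<open>X'\<close> fit into
    \<open>X2\<close>; the lower end keeps \<open>B'\<close> within
    \<open>4 * (\<epsilon> * s)\<close> of a full side.\<close>
  define q where "q = card B - nat \<lceil>2 * (\<epsilon> * real s)\<rceil>"
  have q: "real q \<le> rcard B - 2 * (\<epsilon> * real s)" "rcard B - 3 * (\<epsilon> * real s) \<le> real q"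
    using cB es es20 unfolding q_def by linarith+
  have "real q \<le> rcard X2" using q(1) Bs cX2 es by linarith
  then obtain X' where X': "X' \<subseteq> X2" "card X' = q"
      by (meson obtain_subset_with_card_n of_nat_le_iff)
  have match: "\<exists>f. bij_betw f X' B' \<and> (\<forall>x\<in>X'. H x (f x))" if B': "B' \<subseteq> B" "card B' = card X'" for B'
  proof (rule regular_pair_perfect_matching[where d = ?d and \<epsilon> = \<epsilon> and s = s and ?X1.0 = X1 and
      ?P1.0 = P1])
    show "real s - 5 * (\<epsilon> * real s) \<le> rcard B'" using B' X' q(2) cB es by linarith
    show "?d * real s \<le> rcard {p \<in> P1. H x p}" if "x \<in> X'" for x using that X'
        by (auto simp: X2_def)
    show "?d * real s \<le> rcard {x \<in> X1. H x p}" if "p \<in> B'" for p using that B' by (auto simp: B_def)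
    show "X' \<subseteq> X1" "B' \<subseteq> P1" using X' B' by (auto simp: X2_def B_def)
  qed (use fin1 cP1 s_def \<epsilon> es holesX B' in auto)
  show ?thesis
  proof (rule exI[of _ X'], rule exI[of _ B], intro conjI allI impI)
    show "X' \<subseteq> X" using X' sub by (auto simp: X2_def)
    show "B \<subseteq> P" using sub by (auto simp: B_def)
    show "card X' \<le> card B" using X' by (simp add: q_def)
    show "\<epsilon> ^ t * real M / 2 \<le> rcard B" using cB es20 sM by linarith
    show "rcard B \<le> 2 * rcard X'" using q(2) cB es20 X' by linarith
    have "\<epsilon> * rcard B \<le> \<epsilon> * real s" using Bs \<epsilon> by (intro mult_left_mono) auto
    then show "\<epsilon> * rcard B \<le> rcard B - rcard X'" using q(1) X' es by linarith
  qed (use match in blast)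
qed

section \<open>Tiles and monochromatic cliques\<close>

text \<open>A tile is recorded only through its vertex set, which is all that disjointness and
  covering need; the subgraph is recovered from \<open>f\<close> at the end. For a sequence of
  graphs the index \<open>i\<close> can only be \<open>card S\<close>.\<close>

definition mono_tile :: "(nat \<Rightarrow> 'b ugraph) \<Rightarrow> ('a set \<Rightarrow> nat) \<Rightarrow> 'a set \<Rightarrow> bool" where
  "mono_tile F c S \<longleftrightarrow> (\<exists>i\<ge>1. \<exists>f k. bij_betw f (verts (F i)) S \<and> (\<forall>e\<in>edges (F i). c (f ` e) = k))"

definition tileable :: "(nat \<Rightarrow> 'b ugraph) \<Rightarrow> ('a set \<Rightarrow> nat) \<Rightarrow> nat \<Rightarrow> 'a set \<Rightarrow> bool" where
  "tileable F c m S \<longleftrightarrow> (\<exists>P. finite P \<and> card P \<le> m \<and> disjoint P \<and> \<Union>P = S \<and> (\<forall>A\<in>P. mono_tile F c A))"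

lemma tileable_empty: "tileable F c 0 {}"
  unfolding tileable_def by (intro exI[of _ "{}"]) auto

lemma tileable_single: "mono_tile F c S \<Longrightarrow> tileable F c 1 S"
  unfolding tileable_def by (intro exI[of _ "{S}"]) auto

lemma tileable_mono: "tileable F c m S \<Longrightarrow> m \<le> m' \<Longrightarrow> tileable F c m' S"
  unfolding tileable_def using le_trans by blast

lemma tileable_Un:
  assumes "tileable F c m S" "tileable F c m' S'" "S \<inter> S' = {}"
  shows "tileable F c (m + m') (S \<union> S')"
proof -
  obtain P where P: "finite P" "card P \<le> m" "disjoint P" "\<Union>P = S" "\<forall>A\<in>P. mono_tile F c A"
    using assms(1) unfolding tileable_def by blast
  obtain P' where P': "finite P'" "card P' \<le> m'" "disjoint P'" "\<Union>P' = S'" "\<forall>A\<in>P'. mono_tile F c A"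
    using assms(2) unfolding tileable_def by blast
  have "card (P \<union> P') \<le> m + m'" using P P' card_Un_le[of P P'] by linarith
  moreover have "disjoint (P \<union> P')" using P P' assms(3) by (intro disjoint_union) auto
  ultimately show ?thesis unfolding tileable_def using P P'
    by (intro exI[of _ "P \<union> P'"]) auto
qed

section \<open>The standing parameters\<close>

text \<open>\<open>N\<close> is the Ramsey bound for \<open>r\<close> targets
  \<open>\<Delta> + 2\<close>. \<open>\<delta>\<close> comes from a pigeonhole over at most
  \<open>2 ^ N * r\<close> pairs of an index set and a colour. \<open>\<epsilon>\<close> is small
  against the proportion \<open>\<delta> ^ 2 / 8\<close> of initial candidates times the loss
  \<open>(\<delta> / 4) ^ \<Delta>\<close> caused by up to \<open>\<Delta>\<close> embedded
  neighbours. \<open>t\<close> bounds the number of density increments. The colours are below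
  \<open>r\<close> on all sets and not only on edges; a given colouring is adapted to this at the
  end.\<close>

locale tiling_setup =
  fixes r \<Delta> :: nat and F :: "nat \<Rightarrow> nat ugraph" and c :: "nat set \<Rightarrow> nat"
      and N t :: nat and \<delta> \<epsilon> :: real
  assumes r: "2 \<le> r" and \<Delta>: "1 \<le> \<Delta>"
    and F: "graph_sequence F" "\<And>i. 1 \<le> i \<Longrightarrow> max_degree (F i) \<le> \<Delta>"
    and c: "\<And>e. c e < r"
    and N: "r ^ (r * (\<Delta> + 2)) \<le> N"
    and \<delta>: "0 < \<delta>" "real r * 2 ^ N * \<delta> \<le> 1"
    and \<epsilon>: "0 < \<epsilon>" "14 * (real \<Delta> + 1) * \<epsilon> \<le> \<delta>\<^sup>2 / 8 * (\<delta> / 4) ^ \<Delta>"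
    and t: "2 / \<epsilon> ^ 3 \<le> real t"
begin

abbreviation adj :: "nat \<Rightarrow> nat \<Rightarrow> nat \<Rightarrow> bool" where
  "adj i x y \<equiv> {x, y} \<in> edges (F i)"

abbreviation V :: "nat \<Rightarrow> nat set" where
  "V i \<equiv> verts (F i)"

text \<open>\<open>\<mu>\<close> is the proportion of a side that regularisation keeps,
  \<open>\<rho>\<close> the proportion of a vertex set that one tile can be made to occupy,
  \<open>\<beta>\<close> the proportion occupied by the pool of an absorber, and \<open>M0\<close>
  the size from which absorbers exist.\<close>

definition \<mu> :: real where "\<mu> = \<epsilon> ^ t"
definition \<rho> :: real where "\<rho> = \<epsilon> * \<mu> / (2 * real N)"
definition \<beta> :: real where "\<beta> = \<mu> * \<rho> / (4 * (real \<Delta> + 2))"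
definition M0 :: real where "M0 = 2 * (real \<Delta> + 2) / (\<epsilon> * \<mu> * \<rho>)"

lemma Npos: "1 \<le> N"
  using N r one_le_power[of r "r * (\<Delta> + 2)"] by linarith

lemma \<delta>_le: "\<delta> \<le> 1 / 4"
proof -
  have "2 ^ 1 \<le> (2::real) ^ N" using Npos by (intro power_increasing) auto
  then have "2 * 2 * \<delta> \<le> real r * 2 ^ N * \<delta>" using r \<delta>(1) by (intro mult_right_mono mult_mono) auto
  then show ?thesis using \<delta>(2) by linarith
qed

lemma d_power_le_1: "(\<delta> / 4) ^ \<Delta> \<le> 1" "0 < (\<delta> / 4) ^ \<Delta>"
  using \<delta>_le \<delta> by (auto intro!: power_le_one)

lemma \<epsilon>_le_d_power: "14 * (real \<Delta> + 1) * \<epsilon> \<le> (\<delta> / 4) ^ \<Delta>"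
proof -
  have "\<delta>\<^sup>2 \<le> 1" using \<delta>_le \<delta> by (intro power_le_one) auto
  then have "\<delta>\<^sup>2 / 8 * (\<delta> / 4) ^ \<Delta> \<le> 1 * (\<delta> / 4) ^ \<Delta>" using d_power_le_1
      by (intro mult_right_mono) auto
  then show ?thesis using \<epsilon>(2) by linarith
qed

lemma \<epsilon>_le_\<delta>2: "28 * \<epsilon> \<le> \<delta>\<^sup>2 / 8"
proof -
  have "14 * 2 * \<epsilon> \<le> 14 * (real \<Delta> + 1) * \<epsilon>" using \<Delta> \<epsilon> by (intro mult_right_mono) auto
  moreover have "\<delta>\<^sup>2 / 8 * (\<delta> / 4) ^ \<Delta> \<le> \<delta>\<^sup>2 / 8 * 1" using d_power_le_1
      by (intro mult_left_mono) auto
  ultimately show ?thesis using \<epsilon>(2) by linarith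
qed

lemma \<epsilon>_le: "\<epsilon> \<le> 1 / 20" "14 * \<epsilon> \<le> (\<delta> / 4) ^ \<Delta>" "\<epsilon> \<le> \<delta> / 2"
proof -
  have "14 * 1 * \<epsilon> \<le> 14 * (real \<Delta> + 1) * \<epsilon>" using \<epsilon> by (intro mult_right_mono) auto
  then show *: "14 * \<epsilon> \<le> (\<delta> / 4) ^ \<Delta>" using \<epsilon>_le_d_power by linarith
  have "(\<delta> / 4) ^ \<Delta> \<le> (\<delta> / 4) ^ 1" using \<Delta> \<delta> \<delta>_le by (intro power_decreasing) auto
  then show "\<epsilon> \<le> \<delta> / 2" "\<epsilon> \<le> 1 / 20" using * \<delta> \<delta>_le by (simp_all)
qed

lemma pos: "0 < \<mu>" "0 < \<rho>" "0 < \<beta>" "0 < M0" "\<mu> \<le> 1"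
  using \<epsilon> \<epsilon>_le Npos by (auto simp: \<mu>_def \<rho>_def \<beta>_def M0_def intro!: power_le_one)

lemma \<rho>_le: "\<rho> \<le> 1 / (2 * real N)"
proof -
  have "\<epsilon> * \<mu> \<le> 1 * 1" using pos \<epsilon> \<epsilon>_le by (intro mult_mono) auto
  then show ?thesis unfolding \<rho>_def by (intro divide_right_mono) auto
qed

lemma finite_V: "1 \<le> i \<Longrightarrow> finite (V i)" and card_V: "1 \<le> i \<Longrightarrow> card (V i) = i"
  and edges_V: "1 \<le> i \<Longrightarrow> edges (F i) \<subseteq> [V i]\<^bsup>2\<^esup>"
  using F(1) by (auto simp: graph_sequence_def ugraph_def)

lemma edgeE:
  assumes "1 \<le> i" "e \<in> edges (F i)"
  obtains x y where "e = {x, y}" "x \<in> V i" "y \<in> V i" "x \<noteq> y"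
  using edges_V[OF assms(1)] assms(2) unfolding nsets_def by (auto simp: card_2_iff)

lemma adj_sym: "adj i x y \<Longrightarrow> adj i y x"
  by (simp add: insert_commute)

lemma adj_V: "1 \<le> i \<Longrightarrow> adj i x y \<Longrightarrow> x \<in> V i \<and> y \<in> V i \<and> x \<noteq> y"
  by (erule (1) edgeE) (auto simp: doubleton_eq_iff)

lemma adj_degree:
  assumes "1 \<le> i" "x \<in> V i"
  shows "card {y \<in> V i. adj i x y} \<le> \<Delta>"
proof -
  have fE: "finite (edges (F i))"
    using edges_V[OF assms(1)] finite_V[OF assms(1)]
        by (meson finite_imp_finite_nsets finite_subset)
  have "card {y \<in> V i. adj i x y} \<le> card {e \<in> edges (F i). x \<in> e}"
    using fE adj_V[OF assms(1)] by (intro card_inj_on_le[of "\<lambda>y. {x, y}"]) (auto simp: inj_on_def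
        doubleton_eq_iff)
  also have "\<dots> = degree (F i) x" by (simp add: degree_def)
  also have "\<dots> \<le> max_degree (F i)" unfolding max_degree_def using assms finite_V
      by (intro Max_ge) auto
  also have "\<dots> \<le> \<Delta>" using F(2) assms by blast
  finally show ?thesis .
qed

lemma mono_tileI:
  assumes "1 \<le> i" "inj_on f (V i)" "\<And>x y. adj i x y \<Longrightarrow> c {f x, f y} = k" "S = f ` V i"
  shows "mono_tile F c S"
proof -
  have "c (f ` e) = k" if e: "e \<in> edges (F i)" for e
  proof -
    obtain x y where xy: "e = {x, y}" by (rule edgeE[OF assms(1) e])
    then show ?thesis using assms(3)[of x y] e by simp
  qed
  then show ?thesis unfolding mono_tile_def using assms
    by (intro exI[of _ i] exI[of _ f] exI[of _ k] conjI) (auto simp: bij_betw_def)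
qed

lemma singleton_tile: "mono_tile F c {x}"
proof -
  obtain v where v: "V 1 = {v}" using card_V[of 1] by (auto simp: card_1_singleton_iff)
  \<comment> \<open>For constant \<open>f\<close> the image of a pair is \<open>{x}\<close>, so the
    colour \<open>c {x}\<close> settles the condition on edges at once.\<close>
  show ?thesis by (rule mono_tileI[where i = 1 and f = "\<lambda>_. x" and k = "c {x}"]) (use v in auto)
qed

lemma tileable_singletons: "finite S \<Longrightarrow> tileable F c (card S) S"
  unfolding tileable_def
  by (intro exI[of _ "(\<lambda>x. {x}) ` S"]) (auto simp: card_image_le singleton_tile disjoint_def)

lemma proper_colouring:
  assumes i: "1 \<le> i" and I: "finite I" "\<Delta> + 1 \<le> card I"
  shows "\<exists>\<chi>. (\<forall>x\<in>V i. \<chi> x \<in> I) \<and> (\<forall>x y. adj i x y \<longrightarrow> \<chi> x \<noteq> \<chi> y)"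
proof -
  have "\<exists>\<chi>::nat \<Rightarrow> nat. (\<forall>v\<in>V i. \<chi> v \<le> \<Delta>) \<and> (\<forall>v\<in>V i. \<forall>w\<in>V i. adj i v w \<longrightarrow> \<chi> v \<noteq> \<chi> w)"
  proof (rule greedy_colouring[OF finite_V[OF i]])
    show "\<not> adj i x x" for x using adj_V[OF i, of x x] by blast
  qed (simp_all add: adj_degree[OF i] insert_commute)
  then obtain \<chi> :: "nat \<Rightarrow> nat" where \<chi>: "\<forall>v\<in>V i. \<chi> v \<le> \<Delta>" "\<forall>v\<in>V i. \<forall>w\<in>V i. adj i v w \<longrightarrow> \<chi> v \<noteq> \<chi> w"
      by blast
  obtain h where h: "bij_betw h {0..<card I} I" using ex_bij_betw_nat_finite[OF I(1)] by blast
  have in_range: "\<chi> v \<in> {0..<card I}" if "v \<in> V i" for v using \<chi> that I(2) by fastforce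
  have "h (\<chi> x) \<noteq> h (\<chi> y)" if "adj i x y" for x y
  proof -
    have "x \<in> V i" "y \<in> V i" using adj_V[OF i that] by auto
    moreover from this have "\<chi> x \<noteq> \<chi> y" using \<chi>(2) that by blast
    ultimately show ?thesis using in_range h unfolding bij_betw_def inj_on_def by metis
  qed
  moreover have "\<forall>x\<in>V i. h (\<chi> x) \<in> I" using in_range h by (meson bij_betwE)
  ultimately show ?thesis by (intro exI[of _ "\<lambda>x. h (\<chi> x)"]) simp
qed

definition cliques :: "nat \<Rightarrow> nat set \<Rightarrow> (nat \<Rightarrow> nat set) \<Rightarrow> (nat \<Rightarrow> nat) set" where
  "cliques k I B = {g \<in> Pi\<^sub>E I B. \<forall>i\<in>I. \<forall>j\<in>I. i \<noteq> j \<longrightarrow> c {g i, g j} = k}"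

lemma finite_cliques: "finite I \<Longrightarrow> (\<And>i. i \<in> I \<Longrightarrow> finite (B i)) \<Longrightarrow> finite (cliques k I B)"
  unfolding cliques_def by (rule finite_subset[OF _ finite_PiE[of I B]]) auto

lemma card_cliques_le:
  assumes "finite I" "\<And>i. i \<in> I \<Longrightarrow> finite (B i)"
  shows "rcard (cliques k I B) \<le> volume I B"
proof -
  have "card (cliques k I B) \<le> card (Pi\<^sub>E I B)"
    using assms by (intro card_mono finite_PiE) (auto simp: cliques_def)
  then show ?thesis using card_cylinder[OF assms(1), of B] by linarith
qed

text \<open>By Ramsey's theorem every transversal of the \<open>N\<close> sets contains a
  monochromatic clique on some \<open>\<Delta> + 2\<close> of the indices. There are at most
  \<open>2 ^ N * r\<close> choices of an index set and a colour, so one choice occurs in a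
  proportion \<open>\<delta>\<close> of the transversals.\<close>

lemma dense_cliques:
  assumes B: "\<And>i. i < N \<Longrightarrow> finite (B i) \<and> card (B i) > 0"
    and disj: "\<And>i j. i < N \<Longrightarrow> j < N \<Longrightarrow> i \<noteq> j \<Longrightarrow> B i \<inter> B j = {}"
  shows "\<exists>J k. J \<subseteq> {..<N} \<and> card J = \<Delta> + 2 \<and> k < r \<and> \<delta> * volume J B \<le> rcard (cliques k J B)"
proof (rule ccontr)
  assume contr: "\<not> ?thesis"
  define \<J> where "\<J> = {J. J \<subseteq> {..<N} \<and> card J = \<Delta> + 2} \<times> {..<r}"
  define U where "U = (\<lambda>(J, k). {g \<in> Pi\<^sub>E {..<N} B. restrict g J \<in> cliques k J B})"
  let ?vol = "volume {..<N} B"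
  have f\<J>: "finite \<J>" unfolding \<J>_def by auto
  have volpos: "0 < ?vol" using B by (intro volume_pos) auto
  have ex: "\<exists>p\<in>\<J>. g \<in> U p" if g: "g \<in> Pi\<^sub>E {..<N} B" for g
  proof -
    have inj: "inj_on g {..<N}"
    proof (rule inj_onI)
      fix x y assume xy: "x \<in> {..<N}" "y \<in> {..<N}" "g x = g y"
      have "g x \<in> B x" "g y \<in> B y" using PiE_mem[OF g] xy(1,2) by blast+
      then show "x = y" using disj[of x y] xy by auto
    qed
    \<comment> \<open>Ramsey's theorem is applied to the indices, a pair of them being coloured
      through its image under \<open>g\<close>. All \<open>r\<close> targets are
      \<open>\<Delta> + 2\<close>, which explains the exponent in the bound for
      \<open>N\<close>.\<close>
    have "\<exists>k<r. \<exists>S\<subseteq>{..<N}. card S = \<Delta> + 2 \<and> (\<forall>x\<in>S. \<forall>y\<in>S. x \<noteq> y \<longrightarrow> c (g ` {x, y}) = k)"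
      using N c r by (intro multicolour_Ramsey[where q = "\<lambda>_. \<Delta> + 2"]) auto
    then obtain k S where kS: "k < r" "S \<subseteq> {..<N}" "card S = \<Delta> + 2"
      "\<forall>x\<in>S. \<forall>y\<in>S. x \<noteq> y \<longrightarrow> c (g ` {x, y}) = k" by blast
    then have "restrict g S \<in> cliques k S B" using g by (auto simp: cliques_def PiE_iff)
    then have "g \<in> U (S, k)" using g by (simp add: U_def)
    moreover have "(S, k) \<in> \<J>" using kS by (simp add: \<J>_def)
    ultimately show ?thesis by blast
  qed
  have fP: "finite (Pi\<^sub>E {..<N} B)" using B by (intro finite_PiE) auto
  have fU: "finite (U p)" for p using fP by (cases p) (auto simp: U_def)
  have cU: "rcard (U p) < \<delta> * ?vol" if p: "p \<in> \<J>" for p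
  proof -
    obtain J k where Jk: "p = (J, k)" "J \<subseteq> {..<N}" "card J = \<Delta> + 2" "k < r" using p
        by (auto simp: \<J>_def)
    let ?K = "{..<N} - J"
    have fJ: "finite J" "finite ?K" using Jk finite_subset by auto
    have BJ: "finite (B i)" "card (B i) > 0" if "i \<in> J \<or> i \<in> ?K" for i using B Jk that by auto
    have "card (U p) \<le> card (cliques k J B \<times> Pi\<^sub>E ?K B)"
    proof (rule card_inj_on_le)
      let ?\<phi> = "\<lambda>g. (restrict g J, restrict g ?K)"
      show "inj_on ?\<phi> (U p)"
      proof (rule inj_onI)
        fix g h assume gh: "g \<in> U p" "h \<in> U p" "?\<phi> g = ?\<phi> h"
        show "g = h"
        proof
          fix l
          have e1: "restrict g J = restrict h J" and e2: "restrict g ?K = restrict h ?K" using gh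
              by auto
          consider "l \<in> J" | "l \<in> ?K" | "l \<notin> {..<N}" using Jk by blast
          then show "g l = h l"
          proof cases
            case 1 then show ?thesis using fun_cong[OF e1, of l] by simp
          next
            case 2 then show ?thesis using fun_cong[OF e2, of l] by simp
          next
            case 3 then show ?thesis using gh by (auto simp: U_def Jk PiE_iff extensional_def)
          qed
        qed
      qed
      show "?\<phi> ` U p \<subseteq> cliques k J B \<times> Pi\<^sub>E ?K B"
      proof (rule image_subsetI)
        fix g assume "g \<in> U p"
        then have g: "g \<in> Pi\<^sub>E {..<N} B" "restrict g J \<in> cliques k J B" by (auto simp: U_def Jk)
        have "restrict g ?K \<in> Pi\<^sub>E ?K B" using g(1) by (intro restrict_PiE_iff[THEN iffD2]) auto
        then show "?\<phi> g \<in> cliques k J B \<times> Pi\<^sub>E ?K B" using g(2) by blast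
      qed
      show "finite (cliques k J B \<times> Pi\<^sub>E ?K B)" using fJ BJ
          by (intro finite_cartesian_product finite_cliques finite_PiE) auto
    qed
    then have "rcard (U p) \<le> rcard (cliques k J B) * rcard (Pi\<^sub>E ?K B)"
      by (metis card_cartesian_product of_nat_mono of_nat_mult)
    also have "rcard (Pi\<^sub>E ?K B) = volume ?K B" using fJ by (intro card_cylinder)
    also have "rcard (cliques k J B) * volume ?K B < \<delta> * volume J B * volume ?K B"
    proof (rule mult_strict_right_mono)
      show "rcard (cliques k J B) < \<delta> * volume J B" using contr Jk by (meson not_less)
      show "0 < volume ?K B" using BJ by (intro volume_pos) auto
    qed
    also have "\<dots> = \<delta> * ?vol"
      using prod.subset_diff[OF Jk(2), of "\<lambda>i. rcard (B i)"] by (simp add: volume_def mult_ac)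
    finally show ?thesis .
  qed
  have "Pi\<^sub>E {..<N} B \<noteq> {}" using B by (fastforce simp: PiE_eq_empty_iff)
  then have ne: "\<J> \<noteq> {}" using ex by blast
  have "Pi\<^sub>E {..<N} B \<subseteq> (\<Union>p\<in>\<J>. U p)" using ex by blast
  then have "card (Pi\<^sub>E {..<N} B) \<le> card (\<Union>p\<in>\<J>. U p)" using f\<J> fU by (intro card_mono) auto
  also have "\<dots> \<le> (\<Sum>p\<in>\<J>. card (U p))" using f\<J> by (rule card_UN_le)
  finally have "?vol \<le> (\<Sum>p\<in>\<J>. rcard (U p))"
    by (metis card_cylinder finite_lessThan of_nat_mono of_nat_sum)
  also have "\<dots> < (\<Sum>p\<in>\<J>. \<delta> * ?vol)" using f\<J> ne cU by (intro sum_strict_mono) auto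
  also have "\<dots> = rcard \<J> * (\<delta> * ?vol)" by simp
  also have "\<dots> \<le> (2 ^ N * real r) * (\<delta> * ?vol)"
  proof (rule mult_right_mono)
    have "card {J. J \<subseteq> {..<N} \<and> card J = \<Delta> + 2} \<le> card (Pow {..<N})" by (intro card_mono) auto
    then have "card {J. J \<subseteq> {..<N} \<and> card J = \<Delta> + 2} \<le> 2 ^ N" by (simp add: card_Pow)
    then have "card \<J> \<le> 2 ^ N * r" unfolding \<J>_def card_cartesian_product by simp
    then have "rcard \<J> \<le> real (2 ^ N * r)" by (rule of_nat_mono)
    then show "rcard \<J> \<le> 2 ^ N * real r" by simp
  qed (use \<delta> volpos in auto)
  also have "\<dots> = (real r * 2 ^ N * \<delta>) * ?vol" by simp
  also have "\<dots> \<le> 1 * ?vol" using \<delta> volpos by (intro mult_right_mono) auto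
  finally show False by simp
qed

text \<open>The density \<open>\<delta> / 4\<close> arises because regularisation is run on families
  of density \<open>\<delta> / 2\<close> and guarantees half of that.\<close>

definition subcylinder :: "nat \<Rightarrow> nat set \<Rightarrow> (nat \<Rightarrow> nat set) \<Rightarrow> (nat \<Rightarrow> nat set) \<Rightarrow> bool" where
  "subcylinder k I B Z \<longleftrightarrow> (\<forall>i\<in>I. Z i \<subseteq> B i \<and> \<mu> * rcard (B i) \<le> rcard (Z i)) \<and>
     regular_cylinder (\<lambda>i j u w. c {u, w} = k) I Z \<epsilon> (\<delta> / 4)"

lemma exists_subcylinder:
  assumes I: "finite I" and B: "\<And>i. i \<in> I \<Longrightarrow> finite (B i) \<and> card (B i) > 0"
    and Q: "Q \<subseteq> cliques k I B" "\<delta> / 2 * volume I B \<le> rcard Q"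
  shows "\<exists>Z. subcylinder k I B Z \<and> \<delta> / 2 * volume I Z \<le> rcard (Q \<inter> Pi\<^sub>E I Z)"
proof -
  have "Q \<inter> Pi\<^sub>E I B = Q" using Q(1) by (auto simp: cliques_def)
  then have dens: "\<delta> / 2 * volume I B \<le> rcard (Q \<inter> Pi\<^sub>E I B)" using Q(2) by simp
  have "\<exists>Z. (\<forall>i\<in>I. Z i \<subseteq> B i \<and> \<epsilon> ^ t * rcard (B i) \<le> rcard (Z i)) \<and>
      (\<forall>i\<in>I. \<forall>j\<in>I. card (B i) = card (B j) \<longrightarrow> card (Z i) = card (Z j)) \<and>
      regular_cylinder (\<lambda>i j u w. c {u, w} = k) I Z \<epsilon> (\<delta> / 2 / 2) \<and>
      \<delta> / 2 * volume I Z \<le> rcard (Q \<inter> Pi\<^sub>E I Z)"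
  proof (rule exists_regular_cylinder[OF I B _ _ _ _ t dens])
    show "c {g i, g j} = k" if "g \<in> Q" "i \<in> I" "j \<in> I" "i \<noteq> j" for g i j
      using that Q(1) by (auto simp: cliques_def)
  qed (use \<epsilon> \<epsilon>_le in auto)
  then show ?thesis by (auto simp: subcylinder_def \<mu>_def)
qed

text \<open>\<open>W\<close> is cut into \<open>N\<close> blocks of equal size, and a dense family
  of cliques across \<open>\<Delta> + 2\<close> of them is regularised. The 2 in
  \<open>2 * real N\<close> pays for the rounding in \<open>card W div N\<close>.\<close>

lemma exists_cylinder:
  assumes W: "finite W" "N \<le> card W"
  shows "\<exists>(J::nat set) k Z. finite J \<and> card J = \<Delta> + 2 \<and> (\<forall>i\<in>J. Z i \<subseteq> W \<and>
      \<mu> * rcard W / (2 * real N) \<le> rcard (Z i)) \<and>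
    (\<forall>i\<in>J. \<forall>j\<in>J. i \<noteq> j \<longrightarrow> Z i \<inter> Z j = {}) \<and> regular_cylinder (\<lambda>i j u w. c {u, w} = k) J Z \<epsilon> (\<delta> / 4)"
proof -
  define b where "b = card W div N"
  have b: "1 \<le> b" unfolding b_def using W Npos by (simp add: Suc_leI div_greater_zero_iff)
  obtain h where h: "bij_betw h {0..<card W} W" using ex_bij_betw_nat_finite[OF W(1)] by blast
  define B where "B i = h ` {i * b..<i * b + b}" for i
  have sub: "{i * b..<i * b + b} \<subseteq> {0..<card W}" if "i < N" for i
  proof -
    have "i * b + b = Suc i * b" by simp
    also have "\<dots> \<le> N * b" using that by (intro mult_right_mono) auto
    also have "\<dots> \<le> card W" unfolding b_def by simp
    finally show ?thesis by auto
  qed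
  have injh: "inj_on h {0..<card W}" using h by (simp add: bij_betw_def)
  have cB: "card (B i) = b" if "i < N" for i
    unfolding B_def using inj_on_subset[OF injh sub[OF that]] by (simp add: card_image)
  have BW: "B i \<subseteq> W" if "i < N" for i using sub[OF that] h unfolding B_def bij_betw_def by blast
  have disjint: "{i * b..<i * b + b} \<inter> {j * b..<j * b + b} = {}" if "i < j" for i j
  proof -
    have "i * b + b = Suc i * b" by simp
    also have "\<dots> \<le> j * b" using that by (intro mult_right_mono) auto
    finally show ?thesis by auto
  qed
  have disjB: "B i \<inter> B j = {}" if "i < N" "j < N" "i \<noteq> j" for i j
  proof -
    have "{i * b..<i * b + b} \<inter> {j * b..<j * b + b} = {}"
      using disjint[of i j] disjint[of j i] that by (metis inf_commute linorder_neqE_nat)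
    then show ?thesis unfolding B_def using injh sub that by (metis image_empty inj_on_image_Int)
  qed
  obtain J k where J: "J \<subseteq> {..<N}" "card J = \<Delta> + 2" "\<delta> * volume J B \<le> rcard (cliques k J B)"
    using dense_cliques[of B] cB b disjB BW W(1) finite_subset
        by (metis less_le_trans less_numeral_extra(1))
  have fJ: "finite J" using J(1) finite_subset by blast
  have JN: "i < N" if "i \<in> J" for i using J(1) that by auto
  have "\<delta> / 2 * volume J B \<le> \<delta> * volume J B" using \<delta> by (intro mult_right_mono volume_nonneg) auto
  then have dens: "\<delta> / 2 * volume J B \<le> rcard (cliques k J B)" using J(3) by linarith
  have "finite (B i) \<and> 0 < card (B i)" if "i \<in> J" for i
    using cB JN[OF that] b BW W(1) finite_subset by (metis less_le_trans less_numeral_extra(1))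
  from exists_subcylinder[OF fJ this order_refl dens]
  obtain Z where Z: "\<forall>i\<in>J. Z i \<subseteq> B i \<and> \<mu> * rcard (B i) \<le> rcard (Z i)"
      "regular_cylinder (\<lambda>i j u w. c {u, w} = k) J Z \<epsilon> (\<delta> / 4)" by (auto simp: subcylinder_def)
  have "card W < (b + 1) * N" unfolding b_def using Npos
    by (metis Suc_eq_plus1 add.commute add_0 dividend_less_times_div less_eq_Suc_le mult.commute
        mult_Suc plus_1_eq_Suc)
  also have "\<dots> \<le> (2 * b) * N" using b by (intro mult_right_mono) auto
  finally have "rcard W \<le> real (2 * b * N)" by (intro of_nat_mono) simp
  then have "rcard W / (2 * real N) \<le> real b" using Npos by (simp add: field_simps)
  then have "\<mu> * (rcard W / (2 * real N)) \<le> \<mu> * real b" using pos by (intro mult_left_mono) auto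
  then have "\<mu> * rcard W / (2 * real N) \<le> rcard (Z i)" if "i \<in> J" for i
    using Z(1) that cB[OF JN[OF that]] by fastforce
  moreover have "Z i \<subseteq> W" if "i \<in> J" for i using Z(1) BW JN that by blast
  moreover have "Z i \<inter> Z j = {}" if "i \<in> J" "j \<in> J" "i \<noteq> j" for i j
    using Z(1) disjB[of i j] JN that by blast
  ultimately show ?thesis using J(2) fJ Z(2)
    by (intro exI[of _ J] exI[of _ k] exI[of _ Z] conjI) blast+
qed

end

section \<open>Linear Ramsey numbers and greedy tilings\<close>

lemma large_colour_class:
  assumes "finite V" "finite J" "J \<noteq> {}" "\<And>x. x \<in> V \<Longrightarrow> \<chi> x \<in> J"
  shows "\<exists>j\<in>J. card V \<le> card J * card {x \<in> V. \<chi> x = j}"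
proof (rule ccontr)
  assume contr: "\<not> ?thesis"
  have "V = (\<Union>j\<in>J. {x \<in> V. \<chi> x = j})" using assms(4) by blast
  then have "card V \<le> (\<Sum>j\<in>J. card {x \<in> V. \<chi> x = j})" using card_UN_le[OF assms(2)] by metis
  then have "card J * card V \<le> card J * (\<Sum>j\<in>J. card {x \<in> V. \<chi> x = j})" by (rule mult_left_mono) simp
  also have "\<dots> = (\<Sum>j\<in>J. card J * card {x \<in> V. \<chi> x = j})" by (rule sum_distrib_left)
  also have "\<dots> < (\<Sum>j\<in>J. card V)" using assms contr by (intro sum_strict_mono) (auto simp: not_le)
  finally show False by simp
qed

context tiling_setup
begin

text \<open>The embedding lemma with \<open>d = \<delta> / 4\<close> and
  \<open>\<alpha> = \<delta> ^ 2 / 8\<close>. The candidate sets \<open>C\<close> may be proper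
  subsets of the sides since some vertices are prescribed in advance. With \<open>Y\<close> smaller
  than \<open>V i\<close>, the last clause says how many common neighbours remain for the vertices
  that are placed later.\<close>

lemma embedding_in_cylinder:
  assumes i: "1 \<le> i" and reg: "regular_cylinder (\<lambda>_ _ u w. c {u, w} = k) I Z \<epsilon> (\<delta> / 4)"
    and Z: "\<And>j. j \<in> I \<Longrightarrow> finite (Z j)" "\<And>j. j \<in> I \<Longrightarrow> real i \<le> \<epsilon> * rcard (Z j)"
    and \<chi>: "\<And>x. x \<in> V i \<Longrightarrow> \<chi> x \<in> I" "\<And>x y. adj i x y \<Longrightarrow> \<chi> x \<noteq> \<chi> y"
    and C: "\<And>x. x \<in> V i \<Longrightarrow> C x \<subseteq> Z (\<chi> x)" "\<And>x. x \<in> V i \<Longrightarrow> \<delta>\<^sup>2 / 8 * rcard (Z (\<chi> x)) \<le> rcard (C x)"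
    and Y: "Y \<subseteq> V i"
  shows "\<exists>f. inj_on f Y \<and> (\<forall>y\<in>Y. f y \<in> C y) \<and> (\<forall>x\<in>Y. \<forall>y\<in>Y. adj i x y \<longrightarrow> c {f x, f y} = k) \<and>
    (\<forall>x\<in>V i - Y. (\<delta> / 4) ^ \<Delta> * rcard (C x) \<le> rcard {w \<in> C x. \<forall>y\<in>Y. adj i x y \<longrightarrow> c {f y, w} = k})"
proof -
  have e: "(real \<Delta> + 1) * \<epsilon> \<le> \<delta>\<^sup>2 / 8 * (\<delta> / 4) ^ \<Delta>"
  proof -
    have "0 \<le> (real \<Delta> + 1) * \<epsilon>" using \<epsilon> by simp
    then show ?thesis using \<epsilon>(2) by linarith
  qed
  have "\<exists>f. inj_on f Y \<and> (\<forall>y\<in>Y. f y \<in> C y) \<and> (\<forall>x\<in>Y. \<forall>y\<in>Y. adj i x y \<longrightarrow> c {f x, f y} = k) \<and>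
    (\<forall>x\<in>V i - Y. (\<delta> / 4) ^ card {y \<in> Y. adj i x y} * rcard (C x)
        \<le> rcard {w \<in> C x. \<forall>y\<in>Y. adj i x y \<longrightarrow> c {f y, w} = k})"
  proof (rule greedy_embedding[where G = "\<lambda>u w. c {u, w} = k" and adj = "adj i" and \<alpha> = "\<delta>\<^sup>2 / 8"
      and \<Delta> = \<Delta>,
        OF reg Z(1) _ finite_V[OF i] _ adj_degree[OF i] \<chi>(1) _ C])
    show "\<epsilon> \<le> \<delta>\<^sup>2 / 8 * (\<delta> / 4) ^ \<Delta>"
    proof -
      have "1 * \<epsilon> \<le> (real \<Delta> + 1) * \<epsilon>" using \<epsilon> by (intro mult_right_mono) auto
      then show ?thesis using e by linarith
    qed
    show "real \<Delta> * \<epsilon> * rcard (Z (\<chi> x)) + rcard (V i) \<le> \<delta>\<^sup>2 / 8 * (\<delta> / 4) ^ \<Delta> * rcard (Z (\<chi> x))"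
      if "x \<in> V i" for x
    proof -
      have "rcard (V i) \<le> \<epsilon> * rcard (Z (\<chi> x))" using Z(2)[OF \<chi>(1)[OF that]] card_V[OF i] by simp
      then have "real \<Delta> * \<epsilon> * rcard (Z (\<chi> x)) + rcard (V i) \<le> ((real \<Delta> + 1) * \<epsilon>) * rcard (Z (\<chi> x))"
        by (simp add: algebra_simps)
      also have "\<dots> \<le> (\<delta>\<^sup>2 / 8 * (\<delta> / 4) ^ \<Delta>) * rcard (Z (\<chi> x))" using e
          by (intro mult_right_mono) auto
      finally show ?thesis .
    qed
  qed (use \<chi>(2) \<delta> \<delta>_le \<epsilon> Y in \<open>auto simp: insert_commute\<close>)
  then obtain f where f: "inj_on f Y" "\<forall>y\<in>Y. f y \<in> C y" "\<forall>x\<in>Y. \<forall>y\<in>Y. adj i x y \<longrightarrow> c {f x, f y} = k"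
    "\<forall>x\<in>V i - Y. (\<delta> / 4) ^ card {y \<in> Y. adj i x y} * rcard (C x)
        \<le> rcard {w \<in> C x. \<forall>y\<in>Y. adj i x y \<longrightarrow> c {f y, w} = k}" by blast
  have "(\<delta> / 4) ^ \<Delta> * rcard (C x) \<le> (\<delta> / 4) ^ card {y \<in> Y. adj i x y} * rcard (C x)" if "x \<in> V i"
      for x
  proof -
    have "card {y \<in> Y. adj i x y} \<le> card {y \<in> V i. adj i x y}" using finite_V[OF i] Y
        by (intro card_mono) auto
    then have "card {y \<in> Y. adj i x y} \<le> \<Delta>" using adj_degree[OF i that] by linarith
    then have "(\<delta> / 4) ^ \<Delta> \<le> (\<delta> / 4) ^ card {y \<in> Y. adj i x y}" using \<delta> \<delta>_le
        by (intro power_decreasing) auto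
    then show ?thesis by (intro mult_right_mono) auto
  qed
  note le = this
  show ?thesis
  proof (intro exI[of _ f] conjI f(1-3) ballI)
    fix x assume x: "x \<in> V i - Y"
    show "(\<delta> / 4) ^ \<Delta> * rcard (C x) \<le> rcard {w \<in> C x. \<forall>y\<in>Y. adj i x y \<longrightarrow> c {f y, w} = k}"
      using order_trans[OF le f(4)[rule_format, OF x]] x by simp
  qed
qed

text \<open>Ramsey numbers of graphs of bounded degree are linear in the number of vertices:
  \<open>F s\<close> embeds into a regular cylinder inside \<open>W\<close>, whose sides have at
  least \<open>s / \<epsilon>\<close> vertices because \<open>\<rho>\<close> is
  \<open>\<epsilon>\<close> times the proportion that they occupy.\<close>

lemma linear_ramsey:
  assumes W: "finite W" and s: "1 \<le> s" "real s \<le> \<rho> * rcard W"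
  shows "\<exists>S\<subseteq>W. card S = s \<and> mono_tile F c S"
proof -
  have "\<rho> * rcard W \<le> 1 / (2 * real N) * rcard W" using \<rho>_le by (intro mult_right_mono) auto
  then have "1 \<le> rcard W / (2 * real N)" using s by simp
  then have "N \<le> card W" using Npos by (simp add: field_simps)
  then obtain J :: "nat set" and k Z where J: "finite J" "card J = \<Delta> + 2"
    and Z: "\<forall>i\<in>J. Z i \<subseteq> W \<and> \<mu> * rcard W / (2 * real N) \<le> rcard (Z i)"
    and reg: "regular_cylinder (\<lambda>i j u w. c {u, w} = k) J Z \<epsilon> (\<delta> / 4)"
    using exists_cylinder[OF W] by blast
  obtain \<chi> where \<chi>: "\<forall>x\<in>V s. \<chi> x \<in> J" "\<forall>x y. adj s x y \<longrightarrow> \<chi> x \<noteq> \<chi> y"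
    using proper_colouring[OF s(1) J(1)] J(2) by auto
  have "\<exists>f. inj_on f (V s) \<and> (\<forall>y\<in>V s. f y \<in> Z (\<chi> y)) \<and> (\<forall>x\<in>V s. \<forall>y\<in>V s. adj s x y \<longrightarrow>
      c {f x, f y} = k) \<and>
    (\<forall>x\<in>V s - V s. (\<delta> / 4) ^ \<Delta> * rcard (Z (\<chi> x)) \<le> rcard {w \<in> Z (\<chi> x). \<forall>y\<in>V s. adj s x y \<longrightarrow> c {f y,
        w} = k})"
  proof (rule embedding_in_cylinder[OF s(1) reg])
    show "real s \<le> \<epsilon> * rcard (Z j)" if "j \<in> J" for j
    proof -
      have "\<rho> * rcard W = \<epsilon> * (\<mu> * rcard W / (2 * real N))" by (simp add: \<rho>_def)
      also have "\<dots> \<le> \<epsilon> * rcard (Z j)" using Z that \<epsilon> by (intro mult_left_mono) auto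
      finally show ?thesis using s by linarith
    qed
    show "\<delta>\<^sup>2 / 8 * rcard (Z (\<chi> x)) \<le> rcard (Z (\<chi> x))" for x
    proof -
      have "\<delta>\<^sup>2 \<le> 1" using \<delta>_le \<delta> by (intro power_le_one) auto
      then have "\<delta>\<^sup>2 / 8 * rcard (Z (\<chi> x)) \<le> 1 * rcard (Z (\<chi> x))" by (intro mult_right_mono) auto
      then show ?thesis by simp
    qed
    show "finite (Z j)" if "j \<in> J" for j using Z W that finite_subset by blast
  qed (use \<chi> in auto)
  then obtain f where f: "inj_on f (V s)" "\<forall>y\<in>V s. f y \<in> Z (\<chi> y)" "\<forall>x\<in>V s. \<forall>y\<in>V s. adj s x y \<longrightarrow>
      c {f x, f y} = k"
    by blast
  have "mono_tile F c (f ` V s)"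
    using f adj_V[OF s(1)] by (intro mono_tileI[OF s(1) f(1), where k = k]) auto
  moreover have "f ` V s \<subseteq> W" using f(2) \<chi>(1) Z by blast
  moreover have "card (f ` V s) = s" using card_image[OF f(1)] card_V[OF s(1)] by simp
  ultimately show ?thesis by blast
qed

text \<open>As long as more than \<open>q\<close> vertices are left, each tile removes about a
  proportion \<open>\<rho>\<close> of them, hence at least \<open>\<rho> * q / 2\<close>. Only the
  last tile may be smaller, as it is cut to leave exactly \<open>q\<close>; it accounts for the 1 in
  the bound.\<close>

lemma greedy_tiling:
  assumes "finite W" "1 \<le> q" "q \<le> card W"
  shows "\<exists>W0 n. W0 \<subseteq> W \<and> card W0 = q \<and> tileable F c n (W - W0) \<and>
    real n \<le> 2 * (rcard W - real q) / (\<rho> * real q) + 1"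
  using assms(1,3)
proof (induction "card W" arbitrary: W rule: less_induct)
  case less
  have \<rho>q: "0 < \<rho> * real q" using pos assms(2) by simp
  show ?case
  proof (cases "card W = q")
    case True
    then show ?thesis by (intro exI[of _ W] exI[of _ 0]) (simp add: tileable_empty)
  next
    case False
    \<comment> \<open>The maximum with 1 lets a single vertex be removed when
      \<open>\<rho> * card W\<close> is below 1; the minimum prevents going below
      \<open>q\<close>.\<close>
    define s where "s = min (card W - q) (max 1 (nat \<lfloor>\<rho> * rcard W\<rfloor>))"
    have s: "1 \<le> s" "s \<le> card W - q" using False less.prems by (auto simp: s_def)
    have "\<exists>S\<subseteq>W. card S = s \<and> mono_tile F c S"
    proof (cases "s = 1")
      case True
      have "W \<noteq> {}" using s less.prems assms(2) by auto
      then obtain x where "x \<in> W" by blast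
      then show ?thesis using True by (intro exI[of _ "{x}"]) (auto simp: singleton_tile)
    next
      case False
      then have "s \<le> nat \<lfloor>\<rho> * rcard W\<rfloor>" using s(1) unfolding s_def by linarith
      moreover have "0 \<le> \<rho> * rcard W" using pos by simp
      ultimately have "real s \<le> \<rho> * rcard W" by linarith
      then show ?thesis using linear_ramsey[OF less.prems(1) s(1)] by blast
    qed
    then obtain S where S: "S \<subseteq> W" "card S = s" "mono_tile F c S" by blast
    have cW: "card (W - S) = card W - s" using S less.prems(1)
        by (simp add: card_Diff_subset finite_subset)
    show ?thesis
    proof (cases "s = card W - q")
      case True
      have "card (W - S) = q" using cW True less.prems by simp
      moreover have "W - (W - S) = S" using S by blast
      ultimately show ?thesis using tileable_single[OF S(3)] less.prems(2) \<rho>q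
        by (intro exI[of _ "W - S"] exI[of _ 1]) auto
    next
      case False
      have "\<exists>W0 n. W0 \<subseteq> W - S \<and> card W0 = q \<and> tileable F c n (W - S - W0) \<and>
        real n \<le> 2 * (rcard (W - S) - real q) / (\<rho> * real q) + 1"
        using s cW less.prems assms(2) by (intro less.hyps) auto
      then obtain W0 n where W0: "W0 \<subseteq> W - S" "card W0 = q" "tileable F c n (W - S - W0)"
        "real n \<le> 2 * (rcard (W - S) - real q) / (\<rho> * real q) + 1" by blast
      have "tileable F c (n + 1) ((W - S - W0) \<union> S)"
        using W0 tileable_single[OF S(3)] by (intro tileable_Un) auto
      moreover have "(W - S - W0) \<union> S = W - W0" using S W0 by blast
      moreover have "real (n + 1) \<le> 2 * (rcard W - real q) / (\<rho> * real q) + 1"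
      proof -
        have seq: "s = max 1 (nat \<lfloor>\<rho> * rcard W\<rfloor>)" using False unfolding s_def by linarith
        have "\<rho> * real q \<le> \<rho> * rcard W" using pos less.prems(2) by (intro mult_left_mono) auto
        moreover have "\<rho> * rcard W \<le> 2 * real s" unfolding seq by linarith
        ultimately have "1 \<le> 2 * real s / (\<rho> * real q)" using \<rho>q by (simp add: field_simps)
        moreover have "rcard (W - S) = rcard W - real s" using cW s by (simp add: of_nat_diff)
        moreover have "2 * (x - y - z) / w = 2 * (x - z) / w - 2 * y / w" for x y z w :: real
          by (simp add: diff_divide_distrib)
        ultimately show ?thesis using W0(4) by simp
      qed
      ultimately show ?thesis using W0 by (intro exI[of _ W0] exI[of _ "n + 1"]) auto
    qed
  qed
qed

section \<open>Absorbers\<close>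


text \<open>The skeleton \<open>A\<close> is an embedding of most of a single graph \<open>F m\<close>; the remaining
  independent set of \<open>F m\<close> can be matched to any subset of \<open>B\<close> of size \<open>q\<close>.\<close>

lemma absorber:
  assumes W: "finite W" "M0 \<le> rcard W"
  shows "\<exists>A B q. A \<subseteq> W \<and> B \<subseteq> W \<and> A \<inter> B = {} \<and> \<beta> * rcard W \<le> rcard B \<and>
    rcard B \<le> 2 * real q \<and> \<epsilon> * rcard B \<le> rcard B - real q \<and>
    (\<forall>B'\<subseteq>B. card B' = q \<longrightarrow> mono_tile F c (A \<union> B'))"
proof -
  let ?w = "rcard W" and ?d = "(\<delta> / 4) ^ \<Delta>"
  have big: "2 * (real \<Delta> + 2) \<le> \<epsilon> * \<mu> * (\<rho> * ?w)"
  proof -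
    have "0 < \<epsilon> * \<mu> * \<rho>" using pos \<epsilon> by simp
    then show ?thesis using W(2) unfolding M0_def by (simp add: field_simps)
  qed
  have "\<epsilon> * \<mu> \<le> 1 * 1" using pos \<epsilon> \<epsilon>_le by (intro mult_mono) auto
  then have "\<epsilon> * \<mu> * (\<rho> * ?w) \<le> 1 * (\<rho> * ?w)" using pos by (intro mult_right_mono) auto
  then have "\<epsilon> * \<mu> * (\<rho> * ?w) \<le> \<rho> * ?w" by (simp only: mult_1)
  then have "2 * (real \<Delta> + 2) \<le> \<rho> * ?w" by (rule order_trans[OF big])
  moreover have "(2::real) \<le> 2 * (real \<Delta> + 2)" by simp
  ultimately have \<rho>w: "2 \<le> \<rho> * ?w" by (rule order_trans[rotated])
  have "\<rho> * ?w \<le> 1 / (2 * real N) * ?w" using \<rho>_le by (intro mult_right_mono) auto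
  then have "1 \<le> ?w / (2 * real N)" using \<rho>w by simp
  then have "N \<le> card W" using Npos by (simp add: field_simps)
  then obtain J :: "nat set" and k Z where J: "finite J" "card J = \<Delta> + 2"
    and Z: "\<forall>i\<in>J. Z i \<subseteq> W \<and> \<mu> * ?w / (2 * real N) \<le> rcard (Z i)"
    and disjZ: "\<forall>i\<in>J. \<forall>j\<in>J. i \<noteq> j \<longrightarrow> Z i \<inter> Z j = {}"
    and reg: "regular_cylinder (\<lambda>i j u w. c {u, w} = k) J Z \<epsilon> (\<delta> / 4)"
    using exists_cylinder[OF W(1)] by blast
  define m where "m = nat \<lfloor>\<rho> * ?w\<rfloor>"
  have m: "1 \<le> m" "real m \<le> \<rho> * ?w" "\<rho> * ?w \<le> 2 * real m" using \<rho>w unfolding m_def by linarith+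
  have mZ: "real m \<le> \<epsilon> * rcard (Z j)" if "j \<in> J" for j
  proof -
    have "\<rho> * ?w = \<epsilon> * (\<mu> * ?w / (2 * real N))" by (simp add: \<rho>_def)
    also have "\<dots> \<le> \<epsilon> * rcard (Z j)" using Z that \<epsilon> by (intro mult_left_mono) auto
    finally show ?thesis using m by linarith
  qed
  have fZ: "finite (Z j)" if "j \<in> J" for j using Z W(1) that finite_subset by blast
  obtain \<chi> where \<chi>: "\<forall>x\<in>V m. \<chi> x \<in> J" "\<forall>x y. adj m x y \<longrightarrow> \<chi> x \<noteq> \<chi> y"
    using proper_colouring[OF m(1) J(1)] J(2) by auto
  have fV: "finite (V m)" by (rule finite_V[OF m(1)])
  \<comment> \<open>A colour class is independent, and the largest one contains at least a
    proportion \<open>1 / (\<Delta> + 2)\<close> of \<open>F m\<close>. It is the part of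
    \<open>F m\<close> left open at first.\<close>
  obtain j0 where j0: "j0 \<in> J" "card (V m) \<le> card J * card {x \<in> V m. \<chi> x = j0}"
    using large_colour_class[OF fV J(1), of \<chi>] J(2) \<chi>(1) by fastforce
  define X where "X = {x \<in> V m. \<chi> x = j0}"
  define Y where "Y = V m - X"
  define M where "M = card X"
  have fX: "finite X" using fV by (simp add: X_def)
  have M: "m \<le> (\<Delta> + 2) * M" "M \<le> m" "0 < M"
  proof -
    show "m \<le> (\<Delta> + 2) * M" using j0(2) J(2) card_V[OF m(1)] by (simp add: M_def X_def)
    then show "0 < M" using m(1) by (cases "M = 0") auto
    have "card X \<le> card (V m)" using fV by (intro card_mono) (auto simp: X_def)
    then show "M \<le> m" using card_V[OF m(1)] by (simp add: M_def)
  qed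
  have "\<exists>f. inj_on f Y \<and> (\<forall>y\<in>Y. f y \<in> Z (\<chi> y)) \<and> (\<forall>x\<in>Y. \<forall>y\<in>Y. adj m x y \<longrightarrow> c {f x, f y} = k) \<and>
    (\<forall>x\<in>V m - Y. ?d * rcard (Z (\<chi> x)) \<le> rcard {w \<in> Z (\<chi> x). \<forall>y\<in>Y. adj m x y \<longrightarrow> c {f y, w} = k})"
  proof (rule embedding_in_cylinder[OF m(1) reg])
    show "\<delta>\<^sup>2 / 8 * rcard (Z (\<chi> x)) \<le> rcard (Z (\<chi> x))" for x
    proof -
      have "\<delta>\<^sup>2 \<le> 1" using \<delta>_le \<delta> by (intro power_le_one) auto
      then have "\<delta>\<^sup>2 / 8 * rcard (Z (\<chi> x)) \<le> 1 * rcard (Z (\<chi> x))" by (intro mult_right_mono) auto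
      then show ?thesis by simp
    qed
  qed (use mZ fZ \<chi> in \<open>auto simp: Y_def\<close>)
  then obtain f where f: "inj_on f Y" "\<forall>y\<in>Y. f y \<in> Z (\<chi> y)"
      "\<forall>x\<in>Y. \<forall>y\<in>Y. adj m x y \<longrightarrow> c {f x, f y} = k"
    and fcand: "\<forall>x\<in>V m - Y. ?d * rcard (Z (\<chi> x)) \<le> rcard {w \<in> Z (\<chi> x). \<forall>y\<in>Y. adj m x y \<longrightarrow>
        c {f y, w} = k}"
    by blast
  let ?Z0 = "Z j0" and ?z = "rcard (Z j0)"
  \<comment> \<open>\<open>H x w\<close> says that \<open>w\<close> may serve as the image of
    \<open>x\<close>, all neighbours of \<open>x\<close> being embedded already.\<close>
  define H where "H x w \<longleftrightarrow> (\<forall>y\<in>Y. adj m x y \<longrightarrow> c {f y, w} = k)" for x w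
  have Hcard: "?d * ?z \<le> rcard {w \<in> ?Z0. H x w}" if "x \<in> X" for x
  proof -
    have x: "x \<in> V m - Y" "\<chi> x = j0" using that by (auto simp: X_def Y_def)
    show ?thesis using fcand[rule_format, OF x(1)] unfolding x(2) H_def .
  qed
  have fZ0: "finite ?Z0" using fZ j0 by blast
  have mz: "real m \<le> \<epsilon> * ?z" using mZ j0 by blast
  have zpos: "0 < ?z"
  proof (rule ccontr)
    assume "\<not> ?thesis" then show False using mz m(1) by simp
  qed
  have "\<epsilon> * ?z \<le> 1 * ?z" using \<epsilon>_le by (intro mult_right_mono) auto
  then have "M \<le> card ?Z0" using mz M(2) by linarith
  \<comment> \<open>The matching lemma wants sides of equal size, so \<open>?Z0\<close> is cut down
    to the \<open>M\<close> vertices of heaviest degree into \<open>X\<close>, which preserves the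
    density \<open>?d\<close>.\<close>
  then obtain P where P: "P \<subseteq> ?Z0" "card P = M"
    "real M * (\<Sum>p\<in>?Z0. rcard {x \<in> X. H x p}) \<le> (\<Sum>p\<in>P. rcard {x \<in> X. H x p}) * ?z"
    using exists_heavy_subset[OF fZ0, of M "\<lambda>p. rcard {x \<in> X. H x p}"] by blast
  have fP: "finite P" using P fZ0 finite_subset by blast
  have dens: "?d * (real M * real M) \<le> (\<Sum>x\<in>X. rcard {p \<in> P. H x p})"
  proof -
    have "real M * (?d * ?z) = (\<Sum>x\<in>X. ?d * ?z)" by (simp add: M_def)
    also have "\<dots> \<le> (\<Sum>x\<in>X. rcard {w \<in> ?Z0. H x w})" using Hcard by (intro sum_mono) auto
    also have "\<dots> = (\<Sum>p\<in>?Z0. rcard {x \<in> X. H x p})" by (rule double_counting[OF fX fZ0])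
    finally have "real M * (real M * (?d * ?z)) \<le> real M * (\<Sum>p\<in>?Z0. rcard {x \<in> X. H x p})"
      by (intro mult_left_mono) auto
    also have "\<dots> \<le> (\<Sum>p\<in>P. rcard {x \<in> X. H x p}) * ?z" by (rule P(3))
    finally have "(?d * (real M * real M)) * ?z \<le> (\<Sum>p\<in>P. rcard {x \<in> X. H x p}) * ?z"
        by (simp add: mult_ac)
    then have "?d * (real M * real M) \<le> (\<Sum>p\<in>P. rcard {x \<in> X. H x p})" using zpos
        by (simp add: mult_le_cancel_right)
    then show ?thesis using double_counting[OF fX fP, of H] by simp
  qed
  have M': "real m \<le> (real \<Delta> + 2) * real M" using of_nat_mono[OF M(1), where ?'a = real]
      by (simp add: algebra_simps)
  have \<mu>M: "\<mu> * (\<rho> * ?w) / (2 * (real \<Delta> + 2)) \<le> \<mu> * real M"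
  proof -
    have "\<rho> * ?w \<le> 2 * (real \<Delta> + 2) * real M" using m(3) M' by linarith
    then have "\<rho> * ?w / (2 * (real \<Delta> + 2)) \<le> real M" by (simp add: divide_le_eq mult_ac)
    then have "\<mu> * (\<rho> * ?w / (2 * (real \<Delta> + 2))) \<le> \<mu> * real M" using pos
        by (intro mult_left_mono) auto
    then show ?thesis by simp
  qed
  have Mbig: "1 \<le> \<epsilon> * (\<epsilon> ^ t * real M)"
  proof -
    have "\<epsilon> * (\<mu> * (\<rho> * ?w) / (2 * (real \<Delta> + 2))) \<le> \<epsilon> * (\<mu> * real M)" using \<mu>M \<epsilon>
        by (intro mult_left_mono) auto
    moreover have "1 \<le> \<epsilon> * (\<mu> * (\<rho> * ?w) / (2 * (real \<Delta> + 2)))" using big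
        by (simp add: le_divide_eq mult_ac)
    ultimately show ?thesis unfolding \<mu>_def by (rule order_trans[rotated])
  qed
  obtain X' B where X': "X' \<subseteq> X" and B: "B \<subseteq> P" "card X' \<le> card B" "\<epsilon> ^ t * real M / 2 \<le> rcard B"
      "rcard B \<le> 2 * rcard X'" "\<epsilon> * rcard B \<le> rcard B - rcard X'"
    and match: "\<forall>B'\<subseteq>B. card B' = card X' \<longrightarrow> (\<exists>h. bij_betw h X' B' \<and> (\<forall>x\<in>X'. H x (h x)))"
    using robust_matching[OF fX fP M_def[symmetric] P(2) M(3) dens \<epsilon>(1) \<epsilon>_le(2,1) t Mbig] by blast
  have "\<exists>g. inj_on g (X - X') \<and> (\<forall>x\<in>X - X'. g x \<in> {w \<in> ?Z0 - P. H x w})"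
  proof (rule Hall_marriage)
    show "finite (X - X')" using fX by simp
    show "finite {w \<in> ?Z0 - P. H x w}" for x using fZ0 by simp
    fix S assume S: "S \<subseteq> X - X'"
    show "card S \<le> card (\<Union>x\<in>S. {w \<in> ?Z0 - P. H x w})"
    proof (cases "S = {}")
      case False
      then obtain x where x: "x \<in> S" "x \<in> X" using S by blast
      have "card {w \<in> ?Z0. H x w} \<le> card ({w \<in> ?Z0 - P. H x w} \<union> P)" using fZ0 fP
          by (intro card_mono) auto
      also have "\<dots> \<le> card {w \<in> ?Z0 - P. H x w} + M" using card_Un_le P(2) by metis
      finally have 1: "rcard {w \<in> ?Z0. H x w} \<le> rcard {w \<in> ?Z0 - P. H x w} + real M" by linarith
      have "14 * (\<epsilon> * ?z) \<le> ?d * ?z" using mult_right_mono[OF \<epsilon>_le(2), of ?z]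
          by (simp only: mult.assoc)
      then have "14 * (\<epsilon> * ?z) \<le> rcard {w \<in> ?Z0. H x w}" using Hcard[OF x(2)] by linarith
      then have "M \<le> card {w \<in> ?Z0 - P. H x w}" using 1 mz M(2) by linarith
      moreover have "card S \<le> M" unfolding M_def using S fX by (intro card_mono) auto
      moreover have "card {w \<in> ?Z0 - P. H x w} \<le> card (\<Union>x\<in>S. {w \<in> ?Z0 - P. H x w})"
        using x fZ0 S fX by (intro card_mono) (auto intro: finite_subset)
      ultimately show ?thesis by linarith
    qed simp
  qed
  then obtain g where g: "inj_on g (X - X')" "\<forall>x\<in>X - X'. g x \<in> ?Z0 - P \<and> H x (g x)" by auto
  define A where "A = f ` Y \<union> g ` (X - X')"
  have fY: "f y \<in> W - ?Z0" if "y \<in> Y" for y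
  proof -
    have "\<chi> y \<in> J" "\<chi> y \<noteq> j0" using that \<chi>(1) by (auto simp: Y_def X_def)
    then show ?thesis using f(2) that disjZ j0 Z by blast
  qed
  have tile: "mono_tile F c (A \<union> B')" if B': "B' \<subseteq> B" "card B' = card X'" for B'
  proof -
    obtain h where h: "bij_betw h X' B'" "\<forall>x\<in>X'. H x (h x)" using match B' by blast
    have "h ` X' = B'" using h(1) by (simp add: bij_betw_def)
    then have hP: "h x \<in> P" "h x \<in> ?Z0" if "x \<in> X'" for x using that B' B(1) P(1) by blast+
    define \<phi> where "\<phi> x = (if x \<in> Y then f x else if x \<in> X' then h x else g x)" for x
    have \<phi>Y: "\<phi> x = f x" if "x \<in> Y" for x using that by (simp add: \<phi>_def)
    have \<phi>X': "\<phi> x = h x" if "x \<in> X'" for x using that X' by (auto simp: \<phi>_def Y_def)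
    have \<phi>X: "\<phi> x = g x" if "x \<in> X - X'" for x using that by (auto simp: \<phi>_def Y_def)
    have Vm: "V m = Y \<union> X' \<union> (X - X')" using X' by (auto simp: Y_def X_def)
    have i1: "inj_on \<phi> Y" using f(1) \<phi>Y by (simp add: inj_on_def)
    have i2: "inj_on \<phi> X'" using h(1) \<phi>X' by (simp add: inj_on_def bij_betw_def)
    have i3: "inj_on \<phi> (X - X')" using g(1) \<phi>X by (simp add: inj_on_def)
    have d1: "\<phi> ` Y \<inter> \<phi> ` X' = {}" using \<phi>Y \<phi>X' fY hP by fastforce
    have d2: "\<phi> ` Y \<inter> \<phi> ` (X - X') = {}" using \<phi>Y \<phi>X fY g(2) by fastforce
    have d3: "\<phi> ` X' \<inter> \<phi> ` (X - X') = {}" using \<phi>X' \<phi>X hP g(2) by fastforce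
    have "inj_on \<phi> (Y \<union> X')" using i1 i2 d1 unfolding inj_on_Un by blast
    then have inj: "inj_on \<phi> (V m)" unfolding Vm using i3 d2 d3 unfolding inj_on_Un by blast
    have Hx: "H x (\<phi> x)" if "x \<in> X" for x
      using that h(2) g(2) \<phi>X' \<phi>X by (cases "x \<in> X'") auto
    have hom: "c {\<phi> x, \<phi> y} = k" if xy: "adj m x y" for x y
    proof -
      have V: "x \<in> V m" "y \<in> V m" "\<chi> x \<noteq> \<chi> y" using adj_V[OF m(1) xy] \<chi>(2) xy by auto
      consider "x \<in> Y" "y \<in> Y" | "x \<in> X" "y \<in> Y" | "x \<in> Y" "y \<in> X"
        using V by (auto simp: Y_def X_def)
      then show ?thesis
      proof cases
        case 1 then show ?thesis using f(3) \<phi>Y xy by simp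
      next
        case 2 then show ?thesis using Hx[of x] \<phi>Y xy unfolding H_def by (simp add: insert_commute)
      next
        case 3 then show ?thesis using Hx[of y] \<phi>Y adj_sym[OF xy] unfolding H_def by simp
      qed
    qed
    have img: "A \<union> B' = \<phi> ` V m"
    proof -
      have "\<phi> ` Y = f ` Y" using \<phi>Y by (intro image_cong) auto
      moreover have "\<phi> ` X' = B'" using \<phi>X' h(1) by (auto simp: bij_betw_def)
      moreover have "\<phi> ` (X - X') = g ` (X - X')" using \<phi>X by (intro image_cong) auto
      ultimately show ?thesis unfolding Vm A_def image_Un by blast
    qed
    show ?thesis by (rule mono_tileI[OF m(1) inj hom img])
  qed
  have "A \<subseteq> W" using fY g(2) Z j0 unfolding A_def by blast
  moreover have "B \<subseteq> W" using B(1) P(1) Z j0 by blast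
  moreover have "A \<inter> B = {}" using fY g(2) B(1) P(1) unfolding A_def by blast
  moreover have "\<beta> * ?w \<le> rcard B"
  proof -
    have "\<beta> * ?w = \<mu> * (\<rho> * ?w) / (2 * (real \<Delta> + 2)) / 2" by (simp add: \<beta>_def)
    also have "\<dots> \<le> \<mu> * real M / 2" using \<mu>M by (rule divide_right_mono) simp
    also have "\<dots> \<le> rcard B" using B(3) by (simp only: \<mu>_def)
    finally show ?thesis .
  qed
  ultimately show ?thesis using B(4,5) tile
    by - (rule exI[of _ A], rule exI[of _ B], rule exI[of _ "card X'"], simp)
qed

section \<open>Covering vertices by earlier pools\<close>


text \<open>A bound on the number of vertices at distance one or two from a given vertex. It also is
  the number of pool vertices spent per covered vertex.\<close>

definition D2 :: nat where "D2 = \<Delta> * \<Delta> + \<Delta>"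

text \<open>A largest class in a colouring of the square of \<open>F i\<close> with
  \<open>D2 + 1\<close> colours. The last clause, that no vertex has two neighbours in
  \<open>X\<close>, is what the covering argument uses.\<close>

lemma two_independent_set:
  assumes i: "1 \<le> i" and q: "(D2 + 1) * q \<le> i"
  shows "\<exists>X\<subseteq>V i. card X = q \<and> (\<forall>x\<in>X. \<forall>y\<in>X. \<not> adj i x y) \<and>
    (\<forall>x\<in>X. \<forall>y\<in>X. \<forall>z. adj i x z \<longrightarrow> adj i y z \<longrightarrow> x = y)"
proof -
  define R where "R x y \<longleftrightarrow> x \<noteq> y \<and> (adj i x y \<or> (\<exists>z. adj i x z \<and> adj i y z))" for x y
  define Nb where "Nb x = {y \<in> V i. adj i x y}" for x
  have fV: "finite (V i)" by (rule finite_V[OF i])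
  have fNb: "finite (Nb x)" for x using fV by (simp add: Nb_def)
  have cNb: "card (Nb x) \<le> \<Delta>" if "x \<in> V i" for x using adj_degree[OF i that] by (simp add: Nb_def)
  have "\<exists>\<chi>::nat \<Rightarrow> nat. (\<forall>v\<in>V i. \<chi> v \<le> D2) \<and> (\<forall>v\<in>V i. \<forall>w\<in>V i. R v w \<longrightarrow> \<chi> v \<noteq> \<chi> w)"
  proof (rule greedy_colouring[OF fV])
    show "R y x" if "R x y" for x y using that adj_sym unfolding R_def by blast
    show "\<not> R x x" for x by (simp add: R_def)
    show "card {w \<in> V i. R v w} \<le> D2" if v: "v \<in> V i" for v
    proof -
      have "{w \<in> V i. R v w} \<subseteq> Nb v \<union> (\<Union>z\<in>Nb v. Nb z)"
      proof
        fix w assume "w \<in> {w \<in> V i. R v w}"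
        then consider "w \<in> V i" "adj i v w" | z where "w \<in> V i" "adj i v z" "adj i w z"
            unfolding R_def by blast
        then show "w \<in> Nb v \<union> (\<Union>z\<in>Nb v. Nb z)"
        proof cases
          case 1 then show ?thesis by (simp add: Nb_def)
        next
          case 2
          then have "z \<in> Nb v" "w \<in> Nb z" using adj_V[OF i, of v z] adj_sym[OF 2(3)]
              by (auto simp: Nb_def)
          then show ?thesis by blast
        qed
      qed
      then have "card {w \<in> V i. R v w} \<le> card (Nb v \<union> (\<Union>z\<in>Nb v. Nb z))" using fNb
          by (intro card_mono) auto
      also have "\<dots> \<le> card (Nb v) + card (\<Union>z\<in>Nb v. Nb z)" by (rule card_Un_le)
      also have "\<dots> \<le> card (Nb v) + (\<Sum>z\<in>Nb v. card (Nb z))" using card_UN_le[OF fNb] by simp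
      also have "(\<Sum>z\<in>Nb v. card (Nb z)) \<le> (\<Sum>z\<in>Nb v. \<Delta>)" using cNb
          by (intro sum_mono) (auto simp: Nb_def)
      also have "(\<Sum>z\<in>Nb v. \<Delta>) = card (Nb v) * \<Delta>" by simp
      also have "\<dots> \<le> \<Delta> * \<Delta>" using cNb[OF v] by simp
      also have "card (Nb v) \<le> \<Delta>" by (rule cNb[OF v])
      finally show ?thesis by (simp add: D2_def)
    qed
  qed
  then obtain \<chi> :: "nat \<Rightarrow> nat" where \<chi>: "\<forall>v\<in>V i. \<chi> v \<le> D2" "\<forall>v\<in>V i. \<forall>w\<in>V i. R v w \<longrightarrow> \<chi> v \<noteq> \<chi> w"
      by blast
  obtain j where j: "card (V i) \<le> card {..D2} * card {x \<in> V i. \<chi> x = j}"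
    using large_colour_class[OF fV, of "{..D2}" \<chi>] \<chi>(1) by auto
  have "(D2 + 1) * q \<le> (D2 + 1) * card {x \<in> V i. \<chi> x = j}" using j q card_V[OF i] by simp
  then have "q \<le> card {x \<in> V i. \<chi> x = j}" by (simp only: mult_le_cancel1)
  then obtain X where X: "X \<subseteq> {x \<in> V i. \<chi> x = j}" "card X = q" by (meson obtain_subset_with_card_n)
  have noR: "\<not> R x y" if "x \<in> X" "y \<in> X" for x y
  proof
    assume "R x y"
    moreover have "x \<in> V i" "y \<in> V i" "\<chi> x = \<chi> y" using X(1) that by auto
    ultimately show False using \<chi>(2) by blast
  qed
  have irr: "\<not> adj i x x" for x using adj_V[OF i, of x x] by blast
  show ?thesis
  proof (intro exI[of _ X] conjI ballI allI impI)
    show "X \<subseteq> V i" "card X = q" using X by auto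
    show "\<not> adj i x y" if "x \<in> X" "y \<in> X" for x y
      using noR[OF that] irr unfolding R_def by (cases "x = y") auto
    show "x = y" if "x \<in> X" "y \<in> X" "adj i x z" "adj i y z" for x y z
      using noR[OF that(1,2)] that(3,4) unfolding R_def by blast
  qed
qed

text \<open>\<open>R\<close> is placed on a set \<open>X\<close> of vertices of \<open>F m\<close>
  at pairwise distance at least three. Every other vertex \<open>y\<close> then has at most one
  neighbour in \<open>X\<close>, so its candidates are restricted by a single vertex of
  \<open>R\<close>, for which \<open>deg\<close> gives a bound. Nothing is known about common
  neighbourhoods of several vertices of \<open>R\<close>. The choice of \<open>m\<close> leaves
  \<open>D2 * card R\<close> vertices for the pools.\<close>

lemma cover_class:
  assumes R: "finite R" "R \<noteq> {}" and I: "finite I" "card I = \<Delta> + 1"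
    and reg: "regular_cylinder (\<lambda>i j u w. c {u, w} = k) I Z \<epsilon> (\<delta> / 4)"
    and Z: "\<And>i. i \<in> I \<Longrightarrow> finite (Z i)" "\<And>i. i \<in> I \<Longrightarrow> Z i \<inter> R = {}"
    and deg: "\<And>v i. v \<in> R \<Longrightarrow> i \<in> I \<Longrightarrow> \<delta>\<^sup>2 / 8 * rcard (Z i) \<le> rcard {w \<in> Z i - Y. c {v, w} = k}"
    and size: "\<And>i. i \<in> I \<Longrightarrow> real ((D2 + 1) * card R) \<le> \<epsilon> * rcard (Z i)"
  shows "\<exists>U\<subseteq>(\<Union>i\<in>I. Z i) - Y. card U \<le> D2 * card R \<and> mono_tile F c (R \<union> U)"
proof -
  define m where "m = (D2 + 1) * card R"
  have cR: "1 \<le> card R" using R by (simp add: Suc_leI card_gt_0_iff)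
  then have m: "1 \<le> m" unfolding m_def by simp
  obtain X where X: "X \<subseteq> V m" "card X = card R" and indep: "\<forall>x\<in>X. \<forall>y\<in>X. \<not> adj m x y"
    and uniq: "\<forall>x\<in>X. \<forall>y\<in>X. \<forall>z. adj m x z \<longrightarrow> adj m y z \<longrightarrow> x = y"
    using two_independent_set[OF m, of "card R"] m_def by auto
  have fX: "finite X" using X finite_V[OF m] finite_subset by blast
  obtain g where g: "bij_betw g X R" using finite_same_card_bij[OF fX R(1) X(2)] by blast
  have gR: "g x \<in> R" if "x \<in> X" for x using g that by (auto simp: bij_betw_def)
  obtain \<chi> where \<chi>: "\<forall>x\<in>V m. \<chi> x \<in> I" "\<forall>x y. adj m x y \<longrightarrow> \<chi> x \<noteq> \<chi> y"
    using proper_colouring[OF m I(1)] I(2) by auto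
  define C where "C y = {w \<in> Z (\<chi> y) - Y. \<forall>x\<in>X. adj m x y \<longrightarrow> c {g x, w} = k}" for y
  obtain v0 where v0: "v0 \<in> R" using R by blast
  have "\<exists>f. inj_on f (V m - X) \<and> (\<forall>y\<in>V m - X. f y \<in> C y) \<and>
    (\<forall>x\<in>V m - X. \<forall>y\<in>V m - X. adj m x y \<longrightarrow> c {f x, f y} = k) \<and>
    (\<forall>x\<in>V m - (V m - X). (\<delta> / 4) ^ \<Delta> * rcard (C x) \<le> rcard {w \<in> C x. \<forall>y\<in>V m - X. adj m x y \<longrightarrow> c {f y,
        w} = k})"
  proof (rule embedding_in_cylinder[OF m reg Z(1)])
    show "real m \<le> \<epsilon> * rcard (Z j)" if "j \<in> I" for j using size[OF that] by (simp only: m_def)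
    show "C x \<subseteq> Z (\<chi> x)" for x by (auto simp: C_def)
    show "\<delta>\<^sup>2 / 8 * rcard (Z (\<chi> y)) \<le> rcard (C y)" if y: "y \<in> V m" for y
    proof -
      have yI: "\<chi> y \<in> I" using \<chi>(1) y by blast
      \<comment> \<open>If \<open>y\<close> has no neighbour in \<open>X\<close>, its candidates are
        all of \<open>Z (\<chi> y) - Y\<close>, and any vertex \<open>v0\<close> of \<open>R\<close>
        gives the lower bound.\<close>
      obtain v where v: "v \<in> R" "{w \<in> Z (\<chi> y) - Y. c {v, w} = k} \<subseteq> C y"
      proof (cases "\<exists>x\<in>X. adj m x y")
        case True
        then obtain x where x: "x \<in> X" "adj m x y" by blast
        then have "x' = x" if "x' \<in> X" "adj m x' y" for x' using uniq that by blast
        then have "{w \<in> Z (\<chi> y) - Y. c {g x, w} = k} \<subseteq> C y" by (auto simp: C_def)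
        then show ?thesis using that gR x by blast
      next
        case False
        then have "{w \<in> Z (\<chi> y) - Y. c {v0, w} = k} \<subseteq> C y" by (auto simp: C_def)
        then show ?thesis using that v0 by blast
      qed
      have "finite (C y)" using Z(1)[OF yI] by (simp add: C_def)
      then have "card {w \<in> Z (\<chi> y) - Y. c {v, w} = k} \<le> card (C y)" using v(2) by (rule card_mono)
      then show ?thesis using deg[OF v(1) yI] by linarith
    qed
  qed (use \<chi> in auto)
  then obtain f where f: "inj_on f (V m - X)" "\<forall>y\<in>V m - X. f y \<in> C y"
    "\<forall>x\<in>V m - X. \<forall>y\<in>V m - X. adj m x y \<longrightarrow> c {f x, f y} = k" by blast
  define U where "U = f ` (V m - X)"
  define \<phi> where "\<phi> x = (if x \<in> X then g x else f x)" for x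
  have UZ: "U \<subseteq> (\<Union>i\<in>I. Z i) - Y" using f(2) \<chi>(1) unfolding U_def C_def by blast
  have UR: "U \<inter> R = {}" using UZ Z(2) by blast
  have "card U = card (V m - X)" unfolding U_def by (rule card_image[OF f(1)])
  also have "\<dots> = D2 * card R" using X fX card_V[OF m] by (simp add: card_Diff_subset m_def)
  finally have "card U \<le> D2 * card R" by simp
  moreover have "mono_tile F c (R \<union> U)"
  proof (rule mono_tileI[OF m])
    have img: "\<phi> ` X = R" "\<phi> ` (V m - X) = U"
      using g by (auto simp: \<phi>_def U_def bij_betw_def)
    have Vm: "V m = X \<union> (V m - X)" using X by blast
    then show "R \<union> U = \<phi> ` V m" using img by (metis image_Un)
    have "inj_on \<phi> X" using g by (simp add: \<phi>_def bij_betw_def inj_on_def)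
    moreover have "inj_on \<phi> (V m - X)" using f(1) by (simp add: \<phi>_def inj_on_def)
    ultimately have "inj_on \<phi> (X \<union> (V m - X))" unfolding inj_on_Un using img UR by blast
    then show "inj_on \<phi> (V m)" using Vm by simp
    fix x y assume xy: "adj m x y"
    have V: "x \<in> V m" "y \<in> V m" using adj_V[OF m xy] by auto
    have gc: "c {g x, f y} = k" if "x \<in> X" "y \<in> V m - X" "adj m x y" for x y
      using f(2) that unfolding C_def by blast
    consider "x \<in> X" "y \<in> V m - X" | "x \<in> V m - X" "y \<in> X" | "x \<in> V m - X" "y \<in> V m - X"
      using indep xy V by blast
    then show "c {\<phi> x, \<phi> y} = k"
    proof cases
      case 1 then show ?thesis using gc xy by (simp add: \<phi>_def)
    next
      case 2 then show ?thesis using gc[of y x] adj_sym[OF xy] by (simp add: \<phi>_def insert_commute)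
    next
      case 3 then show ?thesis using f(3) xy by (simp add: \<phi>_def)
    qed
  qed
  ultimately show ?thesis using UZ by blast
qed

section \<open>Vertices joined to many earlier cliques\<close>

text \<open>While more than \<open>\<delta> / 2 * volume I B\<close> cliques are left, a regular
  subcylinder rich in the remaining cliques is chosen and its cliques are removed. The removed
  families are disjoint, so their sizes add up to at most \<open>card Q\<close>; this bounds both
  the number of the cylinders and the sum of their volumes.\<close>

lemma covering_cylinders:
  assumes I: "finite I" and B: "\<And>i. i \<in> I \<Longrightarrow> finite (B i) \<and> card (B i) > 0"
  shows "Q \<subseteq> cliques k I B \<Longrightarrow> \<exists>zs. (\<forall>Z\<in>set zs. subcylinder k I B Z) \<and>
    real (length zs) * (\<delta> / 2 * (\<mu> ^ card I * volume I B)) \<le> rcard Q \<and>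
    \<delta> / 2 * (\<Sum>Z\<leftarrow>zs. volume I Z) \<le> rcard Q \<and>
    rcard (Q - (\<Union>Z\<in>set zs. Pi\<^sub>E I Z)) \<le> \<delta> / 2 * volume I B"
proof (induction "card Q" arbitrary: Q rule: less_induct)
  case less
  have volpos: "0 < volume I B" using B by (intro volume_pos) auto
  have fQ: "finite Q" using less.prems finite_cliques[OF I, of B k] B finite_subset by blast
  show ?case
  proof (cases "rcard Q \<le> \<delta> / 2 * volume I B")
    case True
    then show ?thesis by (intro exI[of _ "[]"]) auto
  next
    case False
    then obtain Z where Z: "subcylinder k I B Z" "\<delta> / 2 * volume I Z \<le> rcard (Q \<inter> Pi\<^sub>E I Z)"
      using exists_subcylinder[where B = B and Q = Q and k = k, OF I B less.prems] by auto
    have volZ: "\<mu> ^ card I * volume I B \<le> volume I Z"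
    proof -
      have "\<mu> ^ card I * volume I B = (\<Prod>i\<in>I. \<mu> * rcard (B i))"
        by (simp add: volume_def prod.distrib)
      also have "\<dots> \<le> volume I Z" unfolding volume_def using Z(1) pos
        by (intro prod_mono) (auto simp: subcylinder_def)
      finally show ?thesis .
    qed
    define Q' where "Q' = Q - Pi\<^sub>E I Z"
    have cQ: "rcard Q = rcard Q' + rcard (Q \<inter> Pi\<^sub>E I Z)"
    proof -
      have "Q - Q' = Q \<inter> Pi\<^sub>E I Z" by (auto simp: Q'_def)
      then show ?thesis using real_card_Diff[OF fQ, of Q'] by (simp add: Q'_def)
    qed
    have a: "\<delta> / 2 * (\<mu> ^ card I * volume I B) \<le> \<delta> / 2 * volume I Z" using volZ \<delta>
        by (intro mult_left_mono) auto
    have apos: "0 < \<delta> / 2 * (\<mu> ^ card I * volume I B)" using \<delta> pos volpos by simp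
    have "card Q' < card Q" using cQ Z(2) a apos by linarith
    moreover have "Q' \<subseteq> cliques k I B" using less.prems by (auto simp: Q'_def)
    ultimately obtain zs where zs: "\<forall>Z\<in>set zs. subcylinder k I B Z"
      "real (length zs) * (\<delta> / 2 * (\<mu> ^ card I * volume I B)) \<le> rcard Q'"
      "\<delta> / 2 * (\<Sum>Z\<leftarrow>zs. volume I Z) \<le> rcard Q'"
      "rcard (Q' - (\<Union>Z\<in>set zs. Pi\<^sub>E I Z)) \<le> \<delta> / 2 * volume I B"
      using less.hyps[of Q'] by blast
    show ?thesis
    proof (intro exI[of _ "Z # zs"] conjI)
      show "\<forall>Z\<in>set (Z # zs). subcylinder k I B Z" using zs(1) Z(1) by simp
      have "real (length (Z # zs)) * (\<delta> / 2 * (\<mu> ^ card I * volume I B)) =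
          real (length zs) * (\<delta> / 2 * (\<mu> ^ card I * volume I B)) + \<delta> / 2 * (\<mu> ^ card I * volume I
              B)"
        by (simp add: algebra_simps)
      then show "real (length (Z # zs)) * (\<delta> / 2 * (\<mu> ^ card I * volume I B)) \<le> rcard Q"
        using zs(2) cQ Z(2) a by linarith
      have "\<delta> / 2 * (\<Sum>Z\<leftarrow>Z # zs. volume I Z) = \<delta> / 2 * volume I Z + \<delta> / 2 * (\<Sum>Z\<leftarrow>zs. volume I Z)"
        by (simp add: algebra_simps)
      then show "\<delta> / 2 * (\<Sum>Z\<leftarrow>Z # zs. volume I Z) \<le> rcard Q" using zs(3) cQ Z(2) by linarith
      have "Q - (\<Union>Z\<in>set (Z # zs). Pi\<^sub>E I Z) = Q' - (\<Union>Z\<in>set zs. Pi\<^sub>E I Z)" by (auto simp: Q'_def)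
      then show "rcard (Q - (\<Union>Z\<in>set (Z # zs). Pi\<^sub>E I Z)) \<le> \<delta> / 2 * volume I B" using zs(4) by simp
    qed
  qed
qed

definition links :: "nat \<Rightarrow> nat set \<Rightarrow> (nat \<Rightarrow> nat set) \<Rightarrow> nat \<Rightarrow> (nat \<Rightarrow> nat) set" where
  "links k I B v = {g \<in> cliques k I B. \<forall>i\<in>I. c {v, g i} = k}"

text \<open>The threshold equals the density in \<open>dense_cliques\<close>, so that
  \<open>N\<close> pools without good vertices contradict that lemma.\<close>

definition good :: "nat \<Rightarrow> nat set \<Rightarrow> (nat \<Rightarrow> nat set) \<Rightarrow> nat \<Rightarrow> bool" where
  "good k I B v \<longleftrightarrow> \<delta> * volume I B \<le> rcard (links k I B v)"

text \<open>The cylinders found greedily may overlap, but their volumes add up to at most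
  \<open>2/\<delta>\<close> times the total volume; averaging over them therefore costs only a factor of order \<open>\<delta>\<close>.\<close>

lemma good_vertex_cylinders:
  assumes I: "finite I" and B: "\<And>i. i \<in> I \<Longrightarrow> finite (B i) \<and> card (B i) > 0"
  shows "\<exists>zs. (\<forall>Z\<in>set zs. subcylinder k I B Z) \<and>
    real (length zs) \<le> 2 / (\<delta> * \<mu> ^ card I) \<and>
    (\<forall>v. good k I B v \<longrightarrow> (\<exists>Z\<in>set zs. \<forall>i\<in>I. \<delta>\<^sup>2 / 4 * rcard (Z i) \<le> rcard {w \<in> Z i. c {v, w} = k}))"
proof -
  let ?Q = "cliques k I B"
  have volpos: "0 < volume I B" using B by (intro volume_pos) auto
  have cQ: "rcard ?Q \<le> volume I B" using B by (intro card_cliques_le[OF I]) auto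
  have fQ: "finite ?Q" using finite_cliques[OF I] B by blast
  obtain zs where zs: "\<forall>Z\<in>set zs. subcylinder k I B Z"
      "real (length zs) * (\<delta> / 2 * (\<mu> ^ card I * volume I B)) \<le> rcard ?Q"
      "\<delta> / 2 * (\<Sum>Z\<leftarrow>zs. volume I Z) \<le> rcard ?Q"
      "rcard (?Q - (\<Union>Z\<in>set zs. Pi\<^sub>E I Z)) \<le> \<delta> / 2 * volume I B"
    using covering_cylinders[where B = B and Q = ?Q and k = k, OF I B] by blast
  have "real (length zs) * (\<delta> / 2 * \<mu> ^ card I) * volume I B \<le> 1 * volume I B"
    using zs(2) cQ by (simp add: mult_ac)
  then have "real (length zs) * (\<delta> / 2 * \<mu> ^ card I) \<le> 1" using volpos
      by (simp only: mult_le_cancel_right)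
  then have len: "real (length zs) \<le> 2 / (\<delta> * \<mu> ^ card I)" using \<delta> pos by (simp add: field_simps)
  have "\<exists>Z\<in>set zs. \<forall>i\<in>I. \<delta>\<^sup>2 / 4 * rcard (Z i) \<le> rcard {w \<in> Z i. c {v, w} = k}"
    if v: "good k I B v" for v
  proof (rule ccontr)
    assume contr: "\<not> ?thesis"
    let ?L = "links k I B v"
    have LQ: "?L \<subseteq> ?Q" by (auto simp: links_def)
    have fL: "finite ?L" using LQ fQ finite_subset by blast
    \<comment> \<open>If \<open>v\<close> has few neighbours on a single side of \<open>Z\<close>,
      that side alone makes the links of \<open>v\<close> inside \<open>Z\<close> rare.\<close>
    have small: "rcard (?L \<inter> Pi\<^sub>E I Z) \<le> \<delta>\<^sup>2 / 4 * volume I Z \<and> (0 < volume I Z \<longrightarrow>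
        rcard (?L \<inter> Pi\<^sub>E I Z) < \<delta>\<^sup>2 / 4 * volume I Z)"
      if Zs: "Z \<in> set zs" for Z
    proof -
      have fZ: "finite (Z i)" if "i \<in> I" for i
      proof -
        have "Z i \<subseteq> B i" using zs(1) Zs that by (simp add: subcylinder_def)
        then show ?thesis using B[OF that] finite_subset by blast
      qed
      obtain i where i: "i \<in> I" "rcard {w \<in> Z i. c {v, w} = k} < \<delta>\<^sup>2 / 4 * rcard (Z i)"
        using contr Zs by (meson not_le)
      have "?L \<inter> Pi\<^sub>E I Z \<subseteq> Pi\<^sub>E I (Z(i := {w \<in> Z i. c {v, w} = k}))"
      proof
        fix g assume "g \<in> ?L \<inter> Pi\<^sub>E I Z"
        then have "g \<in> Pi\<^sub>E I Z" "c {v, g i} = k" using i by (auto simp: links_def)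
        then show "g \<in> Pi\<^sub>E I (Z(i := {w \<in> Z i. c {v, w} = k}))" using i by (auto simp: PiE_iff)
      qed
      then have "card (?L \<inter> Pi\<^sub>E I Z) \<le> card (Pi\<^sub>E I (Z(i := {w \<in> Z i. c {v, w} = k})))"
        using fZ I i by (intro card_mono finite_PiE) auto
      then have le: "rcard (?L \<inter> Pi\<^sub>E I Z) \<le> rcard {w \<in> Z i. c {v, w} = k} * volume (I - {i}) Z"
        using card_cylinder[OF I, of "Z(i := {w \<in> Z i. c {v, w} = k})"] volume_upd[OF I i(1), of Z]
            by simp
      have vol: "volume I Z = rcard (Z i) * volume (I - {i}) Z"
          using volume_upd[OF I i(1), of Z "Z i"] by simp
      have "rcard {w \<in> Z i. c {v, w} = k} * volume (I - {i}) Z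
          \<le> \<delta>\<^sup>2 / 4 * rcard (Z i) * volume (I - {i}) Z"
        using i by (intro mult_right_mono volume_nonneg) auto
      moreover have "rcard {w \<in> Z i. c {v, w} = k} * volume (I - {i}) Z
          < \<delta>\<^sup>2 / 4 * rcard (Z i) * volume (I - {i}) Z"
        if "0 < volume I Z"
        using i that vol volume_nonneg[of "I - {i}" Z]
            by (intro mult_strict_right_mono) (auto simp: zero_less_mult_iff)
      moreover have "\<delta>\<^sup>2 / 4 * rcard (Z i) * volume (I - {i}) Z = \<delta>\<^sup>2 / 4 * volume I Z"
          by (simp add: vol)
      ultimately show ?thesis using le by linarith
    qed
    have volZ: "0 < volume I Z" if "Z \<in> set zs" for Z
    proof (rule volume_pos)
      fix i assume i: "i \<in> I"
      have "0 < \<mu> * rcard (B i)" using pos B[OF i] by simp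
      then show "0 < card (Z i)" using zs(1) that i unfolding subcylinder_def
          by (metis less_le_trans of_nat_0_less_iff)
    qed
    have "?L \<subseteq> (?Q - (\<Union>Z\<in>set zs. Pi\<^sub>E I Z)) \<union> (\<Union>Z\<in>set zs. ?L \<inter> Pi\<^sub>E I Z)" using LQ by blast
    then have "card ?L \<le> card ((?Q - (\<Union>Z\<in>set zs. Pi\<^sub>E I Z)) \<union> (\<Union>Z\<in>set zs. ?L \<inter> Pi\<^sub>E I Z))"
      using fQ fL by (intro card_mono) auto
    also have "\<dots> \<le> card (?Q - (\<Union>Z\<in>set zs. Pi\<^sub>E I Z)) + card (\<Union>Z\<in>set zs. ?L \<inter> Pi\<^sub>E I Z)"
        by (rule card_Un_le)
    finally have 1: "rcard ?L \<le> rcard (?Q - (\<Union>Z\<in>set zs. Pi\<^sub>E I Z)) + rcard (\<Union>Z\<in>set zs. ?L \<inter> Pi\<^sub>E I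
        Z)"
      by linarith
    \<comment> \<open>A good vertex has \<open>\<delta> * volume I B\<close> links and at most half
      of these escape the chosen cylinders. If \<open>v\<close> were sparse to all the cylinders,
      the bound on their total volume would leave less than this half.\<close>
    have half: "\<delta> / 2 * volume I B \<le> rcard (\<Union>Z\<in>set zs. ?L \<inter> Pi\<^sub>E I Z)"
      using 1 zs(4) v unfolding good_def by (simp add: field_simps)
    have un: "rcard (\<Union>Z\<in>set ys. ?L \<inter> Pi\<^sub>E I Z) \<le> (\<Sum>Z\<leftarrow>ys. rcard (?L \<inter> Pi\<^sub>E I Z))" for ys
    proof (induction ys)
      case (Cons Z ys)
      have "card (\<Union>Z\<in>set (Z # ys). ?L \<inter> Pi\<^sub>E I Z)
          \<le> card (?L \<inter> Pi\<^sub>E I Z) + card (\<Union>Z\<in>set ys. ?L \<inter> Pi\<^sub>E I Z)"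
        using card_Un_le[of "?L \<inter> Pi\<^sub>E I Z" "\<Union>Z\<in>set ys. ?L \<inter> Pi\<^sub>E I Z"] by simp
      then show ?case using Cons by simp
    qed simp
    have ne: "zs \<noteq> []"
    proof
      assume "zs = []"
      then show False using half \<delta> volpos by (simp add: mult_le_0_iff)
    qed
    have "(\<Sum>Z\<leftarrow>zs. rcard (?L \<inter> Pi\<^sub>E I Z)) < (\<Sum>Z\<leftarrow>zs. \<delta>\<^sup>2 / 4 * volume I Z)"
      using ne small volZ by (intro sum_list_strict_mono) auto
    also have "\<dots> = \<delta> / 2 * (\<delta> / 2 * (\<Sum>Z\<leftarrow>zs. volume I Z))"
      unfolding sum_list_const_mult by (simp add: power2_eq_square)
    also have "\<dots> \<le> \<delta> / 2 * volume I B" using zs(3) cQ \<delta> by (intro mult_left_mono) auto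
    finally show False using half un[of zs] by linarith
  qed
  then show ?thesis using zs(1) len by (intro exI[of _ zs] conjI allI impI) auto
qed


text \<open>The fraction of each pool that may be used up. A side of a cylinder contains a
  proportion \<open>\<mu>\<close> of its pool, so the used vertices make up at most
  \<open>\<epsilon> / 4\<close> of the side.\<close>

definition \<tau> :: real where "\<tau> = \<epsilon> * \<mu> / 4"

lemma \<tau>_pos: "0 < \<tau>" using \<epsilon> pos by (simp add: \<tau>_def)

lemma \<tau>_le: "\<tau> \<le> \<epsilon>"
  using \<epsilon> pos mult_left_mono[of \<mu> 1 \<epsilon>] by (simp add: \<tau>_def)

lemma D2_pos: "1 \<le> D2"
  using \<Delta> by (simp add: D2_def)

definition covers :: "nat set \<times> nat \<times> (nat \<Rightarrow> nat set) \<Rightarrow> nat \<Rightarrow> bool" where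
  "covers = (\<lambda>(I, k, Z) v. \<forall>i\<in>I. \<delta>\<^sup>2 / 4 * rcard (Z i) \<le> rcard {w \<in> Z i. c {v, w} = k})"

definition usable :: "nat \<Rightarrow> (nat \<Rightarrow> nat set) \<Rightarrow> nat set \<times> nat \<times> (nat \<Rightarrow> nat set) \<Rightarrow> bool" where
  "usable j B = (\<lambda>(I, k, Z). I \<subseteq> {..<j} \<and> card I = \<Delta> + 1 \<and>
     subcylinder k I B Z)"

text \<open>The used vertices \<open>Y\<close> occupy at most \<open>\<epsilon> / 4\<close> of a
  side, which is below \<open>\<delta> ^ 2 / 8\<close>. A vertex joined to
  \<open>\<delta> ^ 2 / 4\<close> of the side therefore keeps the \<open>\<delta> ^ 2 / 8\<close>
  required by the embedding.\<close>

lemma cover_by_cylinder: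
  assumes B: "\<And>i. i < j \<Longrightarrow> finite (B i)"
    and us: "usable j B (I, k, Z)" and W: "finite W" "\<And>i. i < j \<Longrightarrow> W \<inter> B i = {}"
    and Y: "\<And>i. i < j \<Longrightarrow> rcard (Y \<inter> B i) + real D2 * rcard W \<le> \<tau> * rcard (B i)"
    and R: "R \<subseteq> W" "R \<noteq> {}" "\<And>v. v \<in> R \<Longrightarrow> covers (I, k, Z) v"
  shows "\<exists>U\<subseteq>(\<Union>i<j. B i) - Y. card U \<le> D2 * card R \<and> mono_tile F c (R \<union> U)"
proof -
  have I: "I \<subseteq> {..<j}" "card I = \<Delta> + 1" "finite I"
    and Z: "\<And>i. i \<in> I \<Longrightarrow> Z i \<subseteq> B i" "\<And>i. i \<in> I \<Longrightarrow> \<mu> * rcard (B i) \<le> rcard (Z i)"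
    and reg: "regular_cylinder (\<lambda>i j u w. c {u, w} = k) I Z \<epsilon> (\<delta> / 4)"
    using us by (auto simp: usable_def subcylinder_def finite_subset)
  have Ij: "i < j" if "i \<in> I" for i using I(1) that by auto
  have \<tau>B: "\<tau> * rcard (B i) \<le> \<epsilon> / 4 * rcard (Z i)" if "i \<in> I" for i
  proof -
    have "\<tau> * rcard (B i) = \<epsilon> / 4 * (\<mu> * rcard (B i))" by (simp add: \<tau>_def)
    also have "\<dots> \<le> \<epsilon> / 4 * rcard (Z i)" using Z(2)[OF that] \<epsilon> by (intro mult_left_mono) auto
    finally show ?thesis .
  qed
  have cR: "card R \<le> card W" using R(1) W(1) by (intro card_mono)
  have "\<exists>U\<subseteq>(\<Union>i\<in>I. Z i) - Y. card U \<le> D2 * card R \<and> mono_tile F c (R \<union> U)"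
  proof (rule cover_class[OF _ R(2) I(3,2) reg])
    show "finite R" using R(1) W(1) finite_subset by blast
    show fZ: "finite (Z i)" if "i \<in> I" for i using Z(1)[OF that] B[OF Ij[OF that]] finite_subset
        by blast
    show "Z i \<inter> R = {}" if "i \<in> I" for i using Z(1)[OF that] W(2)[OF Ij[OF that]] R(1) by blast
    show "real ((D2 + 1) * card R) \<le> \<epsilon> * rcard (Z i)" if "i \<in> I" for i
    proof -
      have "(D2 + 1) * card R \<le> 2 * (D2 * card W)"
      proof -
        have "(D2 + 1) * card R \<le> (2 * D2) * card W" using cR D2_pos by (intro mult_mono) auto
        then show ?thesis by simp
      qed
      then have "real ((D2 + 1) * card R) \<le> real (2 * (D2 * card W))" by (rule of_nat_mono)
      then have "real ((D2 + 1) * card R) \<le> 2 * (real D2 * rcard W)" by simp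
      also have "\<dots> \<le> 2 * (\<epsilon> / 4 * rcard (Z i))"
          using Y[OF Ij[OF that]] \<tau>B[OF that] of_nat_0_le_iff[of "card (Y \<inter> B i)", where ?'a = real]
          by linarith
      also have "\<dots> \<le> \<epsilon> * rcard (Z i)" using \<epsilon> by simp
      finally show ?thesis .
    qed
    show "\<delta>\<^sup>2 / 8 * rcard (Z i) \<le> rcard {w \<in> Z i - Y. c {v, w} = k}" if v: "v \<in> R" and i: "i \<in> I"
        for v i
    proof -
      have "{w \<in> Z i. c {v, w} = k} \<subseteq> {w \<in> Z i - Y. c {v, w} = k} \<union> (Y \<inter> B i)" using Z(1)[OF i]
          by blast
      then have "card {w \<in> Z i. c {v, w} = k} \<le> card ({w \<in> Z i - Y. c {v, w} = k} \<union> (Y \<inter> B i))"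
        using fZ[OF i] B[OF Ij[OF i]] by (intro card_mono) auto
      also have "\<dots> \<le> card {w \<in> Z i - Y. c {v, w} = k} + card (Y \<inter> B i)" by (rule card_Un_le)
      finally have 1: "rcard {w \<in> Z i. c {v, w} = k} \<le> rcard {w \<in> Z i - Y. c {v, w}
          = k} + rcard (Y \<inter> B i)"
        by linarith
      have 2: "\<delta>\<^sup>2 / 4 * rcard (Z i) \<le> rcard {w \<in> Z i. c {v, w} = k}"
        using R(3)[OF v] i by (simp add: covers_def)
      have "0 \<le> real D2 * rcard W" by simp
      then have 3: "rcard (Y \<inter> B i) \<le> \<epsilon> / 4 * rcard (Z i)" using Y[OF Ij[OF i]] \<tau>B[OF i] by linarith
      have "\<epsilon> / 4 \<le> \<delta>\<^sup>2 / 8" using \<epsilon>_le_\<delta>2 \<epsilon> by linarith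
      then have "\<epsilon> / 4 * rcard (Z i) \<le> \<delta>\<^sup>2 / 8 * rcard (Z i)" by (intro mult_right_mono) auto
      moreover have "\<delta>\<^sup>2 / 4 * rcard (Z i) = \<delta>\<^sup>2 / 8 * rcard (Z i) + \<delta>\<^sup>2 / 8 * rcard (Z i)"
        by (simp add: field_simps)
      ultimately show ?thesis using 1 2 3 by linarith
    qed
  qed
  then obtain U where U: "U \<subseteq> (\<Union>i\<in>I. Z i) - Y" "card U \<le> D2 * card R" "mono_tile F c (R \<union> U)"
      by blast
  have "Z i \<subseteq> (\<Union>i<j. B i)" if "i \<in> I" for i using Z(1)[OF that] Ij[OF that] by blast
  then have "(\<Union>i\<in>I. Z i) \<subseteq> (\<Union>i<j. B i)" by (rule UN_least)
  then have "U \<subseteq> (\<Union>i<j. B i) - Y" by (rule order_trans[OF U(1) Diff_mono[OF _ order_refl]])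
  then show ?thesis using U(2,3) by (intro exI[of _ U]) simp
qed

text \<open>One tile per cylinder, taking all vertices it covers that are still uncovered.
  \<open>W\<close> and \<open>Y\<close> vary in the induction: the covered set \<open>R\<close>
  leaves \<open>W\<close>, at most \<open>D2 * card R\<close> vertices join \<open>Y\<close>, and
  the budget is unchanged.\<close>

lemma cover_by_cylinders:
  assumes B: "\<And>i. i < j \<Longrightarrow> finite (B i)"
  shows "\<lbrakk>\<forall>z\<in>set L. usable j B z; finite W; \<And>i. i < j \<Longrightarrow> W \<inter> B i = {};
    \<And>i. i < j \<Longrightarrow> rcard (Y \<inter> B i) + real D2 * rcard W \<le> \<tau> * rcard (B i)\<rbrakk> \<Longrightarrow>
    \<exists>U\<subseteq>(\<Union>i<j. B i) - Y. card U \<le> D2 * card {v \<in> W. \<exists>z\<in>set L. covers z v} \<and>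
      tileable F c (length L) ({v \<in> W. \<exists>z\<in>set L. covers z v} \<union> U)"
proof (induction L arbitrary: W Y)
  case Nil
  then show ?case using tileable_empty by (intro exI[of _ "{}"]) auto
next
  case (Cons z L)
  obtain I k Z where z: "z = (I, k, Z)" by (cases z)
  define R where "R = {v \<in> W. covers z v}"
  define G where "G = {v \<in> W - R. \<exists>z\<in>set L. covers z v}"
  have G: "{v \<in> W. \<exists>z\<in>set (z # L). covers z v} = R \<union> G" by (auto simp: R_def G_def)
  have RW: "R \<subseteq> W" by (auto simp: R_def)
  have fR: "finite R" using RW Cons.prems(2) finite_subset by blast
  have "\<exists>U\<subseteq>(\<Union>i<j. B i) - Y. card U \<le> D2 * card R \<and> tileable F c 1 (R \<union> U)"
  proof (cases "R = {}")
    case True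
    then show ?thesis using tileable_mono[OF tileable_empty] by (intro exI[of _ "{}"]) auto
  next
    case False
    have "\<exists>U\<subseteq>(\<Union>i<j. B i) - Y. card U \<le> D2 * card R \<and> mono_tile F c (R \<union> U)"
      using Cons.prems False RW z by (intro cover_by_cylinder[where W = W and k = k and I = I and Z
          = Z] B) (auto simp: R_def)
    then show ?thesis using tileable_single by blast
  qed
  then obtain U1 where U1: "U1 \<subseteq> (\<Union>i<j. B i) - Y" "card U1 \<le> D2 * card R" "tileable F c 1 (R \<union> U1)"
      by blast
  have fU1: "finite U1" using U1(1) B by (meson Diff_subset finite_UN_I finite_lessThan
      finite_subset lessThan_iff)
  have "\<exists>U\<subseteq>(\<Union>i<j. B i) - (Y \<union> U1). card U \<le> D2 * card G \<and> tileable F c (length L) (G \<union> U)"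
    unfolding G_def
  proof (rule Cons.IH)
    show "\<forall>z\<in>set L. usable j B z" "finite (W - R)" using Cons.prems by auto
    show "(W - R) \<inter> B i = {}" if "i < j" for i using Cons.prems(3)[OF that] by blast
    show "rcard ((Y \<union> U1) \<inter> B i) + real D2 * rcard (W - R) \<le> \<tau> * rcard (B i)" if i: "i < j" for i
    proof -
      have "card ((Y \<union> U1) \<inter> B i) \<le> card ((Y \<inter> B i) \<union> U1)" using B[OF i] fU1
          by (intro card_mono) auto
      also have "\<dots> \<le> card (Y \<inter> B i) + card U1" by (rule card_Un_le)
      also have "\<dots> \<le> card (Y \<inter> B i) + D2 * card R" using U1(2) by simp
      finally have "rcard ((Y \<union> U1) \<inter> B i) \<le> real (card (Y \<inter> B i) + D2 * card R)"
          by (rule of_nat_mono)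
      moreover have "rcard (W - R) = rcard W - rcard R" using real_card_Diff[OF Cons.prems(2) RW] .
      then have "real D2 * rcard (W - R) = real D2 * rcard W - real (D2 * card R)"
        by (simp add: right_diff_distrib)
      ultimately show ?thesis using Cons.prems(4)[OF i] by linarith
    qed
  qed
  then obtain U2 where U2: "U2 \<subseteq> (\<Union>i<j. B i) - (Y \<union> U1)" "card U2 \<le> D2 * card G"
      "tileable F c (length L) (G \<union> U2)" by blast
  have disjW: "W \<inter> (\<Union>i<j. B i) = {}" using Cons.prems(3) by blast
  have RG: "R \<inter> G = {}" "G \<subseteq> W" by (auto simp: G_def)
  have "tileable F c (1 + length L) ((R \<union> U1) \<union> (G \<union> U2))"
    using RG RW U1(1) U2(1) disjW by (intro tileable_Un U1(3) U2(3)) blast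
  moreover have "(R \<union> U1) \<union> (G \<union> U2) = (R \<union> G) \<union> (U1 \<union> U2)" by blast
  moreover have "card (U1 \<union> U2) \<le> D2 * card (R \<union> G)"
  proof -
    have "finite G" using RG(2) Cons.prems(2) finite_subset by blast
    then have "card (R \<union> G) = card R + card G" using fR RG by (intro card_Un_disjoint)
    then show ?thesis using card_Un_le[of U1 U2] U1(2) U2(2) by (simp add: algebra_simps)
  qed
  ultimately show ?case unfolding G using U1(1) U2(1) by (intro exI[of _ "U1 \<union> U2"]) auto
qed

section \<open>Bad vertices\<close>

definition bad :: "nat \<Rightarrow> (nat \<Rightarrow> nat set) \<Rightarrow> nat \<Rightarrow> bool" where
  "bad j B v \<longleftrightarrow> (\<forall>I k. I \<subseteq> {..<j} \<longrightarrow> card I = \<Delta> + 1 \<longrightarrow> k < r \<longrightarrow> \<not> good k I B v)"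

text \<open>The number of pairs of an index set and a colour, times the number of cylinders needed
  for each pair.\<close>

definition K1 :: real where "K1 = 2 ^ N * real r * (2 / (\<delta> * \<mu> ^ (\<Delta> + 1)))"

text \<open>The cylinders depend on the pools and the colouring only, not on \<open>W\<close>. This
  is why the number of tiles is bounded independently of how many good vertices there are.\<close>

lemma cover_good_vertices:
  assumes B: "\<And>i. i < j \<Longrightarrow> finite (B i) \<and> card (B i) > 0" and j: "j \<le> N"
    and W: "finite W" "\<And>i. i < j \<Longrightarrow> W \<inter> B i = {}"
    and Y: "\<And>i. i < j \<Longrightarrow> rcard (Y \<inter> B i) + real D2 * rcard W \<le> \<tau> * rcard (B i)"
  shows "\<exists>G U n. G \<subseteq> W \<and> (\<forall>v\<in>W - G. bad j B v) \<and> U \<subseteq> (\<Union>i<j. B i) - Y \<and> card U \<le> D2 * card G \<and>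
    tileable F c n (G \<union> U) \<and> real n \<le> K1"
proof -
  define S where "S = {I. I \<subseteq> {..<j} \<and> card I = \<Delta> + 1} \<times> {..<r}"
  have fS: "finite S" by (simp add: S_def)
  define Pz where "Pz p zs \<longleftrightarrow> (\<forall>Z\<in>set zs. subcylinder (snd p) (fst p) B Z) \<and>
    real (length zs) \<le> 2 / (\<delta> * \<mu> ^ card (fst p)) \<and>
    (\<forall>v. good (snd p) (fst p) B v \<longrightarrow> (\<exists>Z\<in>set zs. \<forall>i\<in>fst p. \<delta>\<^sup>2 / 4 * rcard (Z i) \<le> rcard {w \<in> Z i. c
        {v, w} = snd p}))"
    for p zs
  have "\<forall>p\<in>S. \<exists>zs. Pz p zs"
  proof
    fix p assume p: "p \<in> S"
    have "fst p \<subseteq> {..<j}" using p by (auto simp: S_def)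
    then have "finite (fst p)" "\<And>i. i \<in> fst p \<Longrightarrow> finite (B i) \<and> 0 < card (B i)" using B finite_subset
        by auto
    then show "\<exists>zs. Pz p zs" unfolding Pz_def by (rule good_vertex_cylinders)
  qed
  then obtain zs where "\<forall>p\<in>S. Pz p (zs p)" by (rule bchoice[THEN exE])
  note zs = this[rule_format, unfolded Pz_def]
  obtain ps where ps: "set ps = S" "distinct ps" using finite_distinct_list[OF fS] by blast
  define L where "L = concat (map (\<lambda>p. map (\<lambda>Z. (fst p, snd p, Z)) (zs p)) ps)"
  have us: "\<forall>z\<in>set L. usable j B z"
  proof
    fix z assume "z \<in> set L"
    then obtain p Z where p: "p \<in> S" "Z \<in> set (zs p)" "z = (fst p, snd p, Z)"
        by (auto simp: L_def ps(1))
    then show "usable j B z" using zs[OF p(1)] by (auto simp: usable_def S_def)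
  qed
  define G where "G = {v \<in> W. \<exists>z\<in>set L. covers z v}"
  have "\<exists>U\<subseteq>(\<Union>i<j. B i) - Y. card U \<le> D2 * card G \<and> tileable F c (length L) (G \<union> U)"
    unfolding G_def using B us W Y by (intro cover_by_cylinders) auto
  then obtain U where U: "U \<subseteq> (\<Union>i<j. B i) - Y" "card U \<le> D2 * card G"
      "tileable F c (length L) (G \<union> U)" by blast
  have "bad j B v" if v: "v \<in> W - G" for v
    unfolding bad_def
  proof (intro allI impI notI)
    fix I k assume Ik: "I \<subseteq> {..<j}" "card I = \<Delta> + 1" "k < r" "good k I B v"
    then have p: "(I, k) \<in> S" by (simp add: S_def)
    then obtain Z where Z: "Z \<in> set (zs (I, k))"
        "\<forall>i\<in>I. \<delta>\<^sup>2 / 4 * rcard (Z i) \<le> rcard {w \<in> Z i. c {v, w} = k}"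
      using zs[OF p] Ik(4) by auto
    then have "covers (I, k, Z) v" by (simp add: covers_def)
    moreover have "(I, k, Z) \<in> set L" using p Z(1) ps(1) by (force simp: L_def)
    ultimately show False using v by (auto simp: G_def)
  qed
  moreover have "real (length L) \<le> K1"
  proof -
    have "real (length L) = (\<Sum>p\<leftarrow>ps. real (length (zs p)))"
      unfolding L_def by (simp add: length_concat comp_def) (induction ps; simp)
    also have "\<dots> = (\<Sum>p\<in>S. real (length (zs p)))" using ps
        by (simp add: sum_list_distinct_conv_sum_set)
    also have "\<dots> \<le> (\<Sum>p\<in>S. 2 / (\<delta> * \<mu> ^ (\<Delta> + 1)))"
    proof (rule sum_mono)
      fix p assume p: "p \<in> S"
      then have "card (fst p) = \<Delta> + 1" by (auto simp: S_def)
      then show "real (length (zs p)) \<le> 2 / (\<delta> * \<mu> ^ (\<Delta> + 1))" using zs[OF p] by metis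
    qed
    also have "\<dots> = rcard S * (2 / (\<delta> * \<mu> ^ (\<Delta> + 1)))" by simp
    also have "\<dots> \<le> (2 ^ N * real r) * (2 / (\<delta> * \<mu> ^ (\<Delta> + 1)))"
    proof (rule mult_right_mono)
      have "card {I. I \<subseteq> {..<j} \<and> card I = \<Delta> + 1} \<le> card (Pow {..<N})" using j
          by (intro card_mono) auto
      then have "card {I. I \<subseteq> {..<j} \<and> card I = \<Delta> + 1} \<le> 2 ^ N" by (simp add: card_Pow)
      then have "card S \<le> 2 ^ N * r" unfolding S_def card_cartesian_product by simp
      then have "rcard S \<le> real (2 ^ N * r)" by (rule of_nat_mono)
      then show "rcard S \<le> 2 ^ N * real r" by simp
    qed (use \<delta> pos in auto)
    finally show ?thesis by (simp add: K1_def)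
  qed
  moreover have "G \<subseteq> W" by (auto simp: G_def)
  ultimately show ?thesis using U by blast
qed

text \<open>Badness at level \<open>j\<close> refers only to pools of smaller index, so adding pool
  \<open>j\<close> leaves it intact for this and all earlier levels.\<close>

lemma bad_upd: "bad j (B(j := A)) v \<longleftrightarrow> bad j B v" and bad_upd_less: "i < j \<Longrightarrow> bad i (B(j := A)) v \<longleftrightarrow>
    bad i B v"
proof -
  have "links k I (B(j := A)) v = links k I B v" "volume I (B(j := A)) = volume I B" if "j \<notin> I"
      for k I
  proof -
    have "Pi\<^sub>E I (B(j := A)) = Pi\<^sub>E I B" using that by (intro PiE_cong) auto
    then show "links k I (B(j := A)) v = links k I B v" by (simp add: links_def cliques_def)
    show "volume I (B(j := A)) = volume I B" unfolding volume_def using that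
        by (intro prod.cong) auto
  qed
  then have *: "good k I (B(j := A)) v = good k I B v" if "j \<notin> I" for k I using that
      by (simp add: good_def)
  then show "bad j (B(j := A)) v \<longleftrightarrow> bad j B v" unfolding bad_def by blast
  show "bad i (B(j := A)) v \<longleftrightarrow> bad i B v" if "i < j"
  proof -
    have "j \<notin> I" if "I \<subseteq> {..<i}" for I using that \<open>i < j\<close> by auto
    then show ?thesis unfolding bad_def using * by blast
  qed
qed

text \<open>In a dense family of cliques on \<open>\<Delta> + 2\<close> pools, the vertex in the
  pool of largest index \<open>m\<close> is split off. Averaging over \<open>B m\<close> gives a
  vertex with \<open>\<delta> * volume I B\<close> links into the other \<open>\<Delta> + 1\<close>
  pools, which all precede \<open>m\<close>; that vertex is good.\<close>

lemma not_all_bad: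
  assumes B: "\<And>i. i < N \<Longrightarrow> finite (B i) \<and> card (B i) > 0"
    and disj: "\<And>i j. i < N \<Longrightarrow> j < N \<Longrightarrow> i \<noteq> j \<Longrightarrow> B i \<inter> B j = {}"
    and bad: "\<And>i v. i < N \<Longrightarrow> v \<in> B i \<Longrightarrow> bad i B v"
  shows False
proof -
  obtain J k where J: "J \<subseteq> {..<N}" "card J = \<Delta> + 2" "k < r" "\<delta> * volume J B \<le> rcard (cliques k J B)"
    using dense_cliques[of B] B disj by blast
  have fJ: "finite J" "J \<noteq> {}" using J finite_subset by auto
  define m where "m = Max J"
  define I where "I = J - {m}"
  have mJ: "m \<in> J" "m < N" using fJ J(1) by (auto simp: m_def)
  have I: "I \<subseteq> {..<m}" "card I = \<Delta> + 1" "finite I"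
  proof -
    show "I \<subseteq> {..<m}" using Max_ge[OF fJ(1)] by (force simp: I_def m_def)
    show "card I = \<Delta> + 1" "finite I" using mJ J(2) fJ by (simp_all add: I_def)
  qed
  have BI: "finite (B i) \<and> card (B i) > 0" if "i \<in> I" for i using B I(1) mJ(2) that by fastforce
  have flinks: "finite (links k I B v)" for v
    using finite_cliques[OF I(3), of B k] BI by (auto simp: links_def)
  have "card (cliques k J B) \<le> card (SIGMA v:B m. links k I B v)"
  proof (rule card_inj_on_le)
    let ?\<phi> = "\<lambda>g. (g m, restrict g I)"
    show "inj_on ?\<phi> (cliques k J B)"
    proof (rule inj_onI)
      fix g h assume gh: "g \<in> cliques k J B" "h \<in> cliques k J B" "?\<phi> g = ?\<phi> h"
      show "g = h"
      proof
        fix l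
        have e: "g m = h m" "restrict g I = restrict h I" using gh by auto
        consider "l = m" | "l \<in> I" | "l \<notin> J" by (auto simp: I_def)
        then show "g l = h l"
        proof cases
          case 2 then show ?thesis using fun_cong[OF e(2), of l] by simp
        next
          case 3 then show ?thesis using gh by (auto simp: cliques_def PiE_iff extensional_def)
        qed (use e in simp)
      qed
    qed
    show "?\<phi> ` cliques k J B \<subseteq> (SIGMA v:B m. links k I B v)"
    proof (rule image_subsetI)
      fix g assume g: "g \<in> cliques k J B"
      then have gP: "g \<in> Pi\<^sub>E J B" and gc: "\<And>i j. i \<in> J \<Longrightarrow> j \<in> J \<Longrightarrow> i \<noteq> j \<Longrightarrow> c {g i, g j} = k"
          by (auto simp: cliques_def)
      have "restrict g I \<in> Pi\<^sub>E I B" using gP by (intro restrict_PiE_iff[THEN iffD2]) (auto simp: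
          I_def)
      moreover have "c {g m, g i} = k" if "i \<in> I" for i using gc[of m i] that mJ
          by (auto simp: I_def)
      moreover have "c {g i, g j} = k" if "i \<in> I" "j \<in> I" "i \<noteq> j" for i j using gc[of i j] that
          by (auto simp: I_def)
      ultimately have "restrict g I \<in> links k I B (g m)" by (simp add: links_def cliques_def)
      moreover have "g m \<in> B m" using PiE_mem[OF gP mJ(1)] .
      ultimately show "?\<phi> g \<in> (SIGMA v:B m. links k I B v)" by simp
    qed
    show "finite (SIGMA v:B m. links k I B v)" using B[OF mJ(2)] flinks
        by (intro finite_SigmaI) auto
  qed
  also have "card (SIGMA v:B m. links k I B v) = (\<Sum>v\<in>B m. card (links k I B v))"
    using B[OF mJ(2)] flinks by (intro card_SigmaI) auto
  finally have "rcard (cliques k J B) \<le> real (\<Sum>v\<in>B m. card (links k I B v))" by (rule of_nat_mono)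
  also have "\<dots> = (\<Sum>v\<in>B m. rcard (links k I B v))" by simp
  also have "\<dots> < (\<Sum>v\<in>B m. \<delta> * volume I B)"
  proof (rule sum_strict_mono)
    show "finite (B m)" "B m \<noteq> {}" using B[OF mJ(2)] by auto
    fix v assume "v \<in> B m"
    then have "\<not> good k I B v" using bad[OF mJ(2)] I J(3) by (auto simp: bad_def)
    then show "rcard (links k I B v) < \<delta> * volume I B" by (simp add: good_def)
  qed
  also have "\<dots> = \<delta> * (rcard (B m) * volume I B)" by simp
  also have "rcard (B m) * volume I B = volume J B"
    unfolding volume_def I_def using fJ mJ(1) by (simp add: prod.remove)
  finally show False using J(4) by simp
qed

section \<open>The recursion\<close>


text \<open>A remainder of size \<open>M1\<close> is large enough for an absorber and makes the
  target size in \<open>reduce_remainder\<close> at least 1. \<open>K2\<close> counts the tiles of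
  one level: \<open>K1\<close> for good vertices, \<open>M1\<close> for singletons when little is
  left, the two fractions with 1 each for the two greedy tilings, and 1 for the absorber.\<close>

definition M1 :: real where "M1 = M0 + 2 * real D2 / (\<tau> * \<beta>)"
definition K2 :: real where "K2 = K1 + M1 + 4 * real D2 / (\<rho> * \<tau> * \<beta>) + 2 / \<rho> + 3"

lemma K_pos: "0 \<le> K1" "0 \<le> M1" "0 \<le> 4 * real D2 / (\<rho> * \<tau> * \<beta>)" "0 \<le> 2 / \<rho>" "0 \<le> K2"
proof -
  show *: "0 \<le> K1" "0 \<le> M1" "0 \<le> 4 * real D2 / (\<rho> * \<tau> * \<beta>)" "0 \<le> 2 / \<rho>"
    using pos \<tau>_pos \<delta> by (auto simp: K1_def M1_def)
  then show "0 \<le> K2" by (simp add: K2_def)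
qed

text \<open>The pool contains a proportion \<open>\<beta>\<close> of \<open>W\<close>, so the
  admissible remainder \<open>\<theta>\<close> is a fixed proportion of \<open>W\<close> and the
  greedy tiling needs a bounded number of tiles.\<close>

lemma reduce_remainder:
  assumes W: "finite W'" "M1 \<le> rcard W" "W' \<subseteq> W" "finite W" and B: "\<beta> * rcard W \<le> rcard B"
  shows "\<exists>W'' n. W'' \<subseteq> W' \<and> real D2 * rcard W'' \<le> \<tau> * rcard B \<and>
    tileable F c n (W' - W'') \<and> real n \<le> 4 * real D2 / (\<rho> * \<tau> * \<beta>) + 1"
proof -
  let ?w = "rcard W"
  define \<theta> where "\<theta> = nat \<lfloor>\<tau> * rcard B / real D2\<rfloor>"
  have D2: "0 < real D2" using D2_pos by simp
  have \<tau>\<beta>: "0 < \<tau> * \<beta>" using \<tau>_pos pos by simp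
  have "0 \<le> \<tau> * rcard B / real D2" using \<tau>_pos by simp
  then have \<theta>le: "real \<theta> \<le> \<tau> * rcard B / real D2" unfolding \<theta>_def by linarith
  then have \<theta>: "real D2 * real \<theta> \<le> \<tau> * rcard B" using D2 by (simp add: field_simps)
  have "2 * real D2 / (\<tau> * \<beta>) \<le> ?w" using W(2) pos by (simp add: M1_def)
  then have 1: "2 * real D2 \<le> \<tau> * \<beta> * ?w" using \<tau>\<beta> by (simp add: field_simps)
  have "\<tau> * (\<beta> * ?w) \<le> \<tau> * rcard B" using B \<tau>_pos by (intro mult_left_mono) auto
  then have 2: "\<tau> * \<beta> * ?w / real D2 \<le> \<tau> * rcard B / real D2" by (intro divide_right_mono) auto
  have 3: "2 \<le> \<tau> * \<beta> * ?w / real D2" using 1 D2 by (simp add: le_divide_eq)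
  have \<theta>ge: "\<tau> * \<beta> * ?w / real D2 \<le> 2 * real \<theta>" "1 \<le> \<theta>" unfolding \<theta>_def using 2 3 by linarith+
  show ?thesis
  proof (cases "card W' \<le> \<theta>")
    case True
    have "real D2 * rcard W' \<le> real D2 * real \<theta>" using True by (intro mult_left_mono) auto
    then have "real D2 * rcard W' \<le> \<tau> * rcard B" using \<theta> by linarith
    then show ?thesis using tileable_empty K_pos(3) by (intro exI[of _ W'] exI[of _ 0]) auto
  next
    case False
    then obtain W'' n where W'': "W'' \<subseteq> W'" "card W'' = \<theta>" "tileable F c n (W' - W'')"
      "real n \<le> 2 * (rcard W' - real \<theta>) / (\<rho> * real \<theta>) + 1"
      using greedy_tiling[OF W(1) \<theta>ge(2)] by auto
    have "2 * (rcard W' - real \<theta>) / (\<rho> * real \<theta>) \<le> 4 * real D2 / (\<rho> * \<tau> * \<beta>)"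
    proof -
      have "rcard W' \<le> ?w" using W by (simp add: card_mono)
      then have a: "2 * (rcard W' - real \<theta>) \<le> 2 * ?w" by simp
      have b: "\<rho> * (\<tau> * \<beta> * ?w / real D2 / 2) \<le> \<rho> * real \<theta>" using \<theta>ge pos
          by (intro mult_left_mono) auto
      have wpos: "0 < ?w" using 1 D2 \<tau>\<beta> by (metis less_le_trans mult_pos_pos of_nat_0_less_iff
          zero_less_numeral zero_less_mult_pos)
      have "0 < \<rho> * (\<tau> * \<beta> * ?w / real D2 / 2)" using pos \<tau>\<beta> wpos D2 by simp
      then have "2 * (rcard W' - real \<theta>) / (\<rho> * real \<theta>) \<le> 2 * ?w / (\<rho> * (\<tau> * \<beta> * ?w / real D2 / 2))"
        using a b by (intro frac_le) auto
      also have "\<dots> = 4 * real D2 / (\<rho> * \<tau> * \<beta>)" using wpos pos \<tau>_pos D2 by (simp add: field_simps)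
      finally show ?thesis .
    qed
    then show ?thesis using W'' \<theta> by (intro exI[of _ W''] exI[of _ n]) auto
  qed
qed

text \<open>\<open>Y\<close> collects the pool vertices used so far, and \<open>U\<close> those that
  this level and all deeper ones use in addition. The budget bounds the use of each pool by a
  fraction \<open>\<tau>\<close> upon return. Since \<open>\<tau> \<le> \<epsilon>\<close> and an
  absorber tolerates the loss of a fraction \<open>\<epsilon>\<close> of its pool, it can still be
  completed afterwards.\<close>

lemma main_recursion:
  assumes "j \<le> N" "\<And>i. i < j \<Longrightarrow> finite (B i) \<and> card (B i) > 0"
    "\<And>i i'. i < j \<Longrightarrow> i' < j \<Longrightarrow> i \<noteq> i' \<Longrightarrow> B i \<inter> B i' = {}"
    "\<And>i v. i < j \<Longrightarrow> v \<in> B i \<Longrightarrow> bad i B v"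
    "finite W" "\<And>i. i < j \<Longrightarrow> W \<inter> B i = {}" "Y \<subseteq> (\<Union>i<j. B i)"
    "\<And>i. i < j \<Longrightarrow> rcard (Y \<inter> B i) + real D2 * rcard W \<le> \<tau> * rcard (B i)"
  shows "\<exists>U n. U \<subseteq> (\<Union>i<j. B i) - Y \<and> (\<forall>i<j. rcard ((Y \<union> U) \<inter> B i) \<le> \<tau> * rcard (B i)) \<and>
    tileable F c n (W \<union> U) \<and> real n \<le> real (N - j) * K2"
  using assms
proof (induction "N - j" arbitrary: j B W Y)
  case 0
  \<comment> \<open>There cannot be \<open>N\<close> pools that are all bad, so this depth is never
    reached.\<close>
  then have "j = N" by simp
  then show ?case using not_all_bad[of B] 0 by blast
next
  case (Suc x)
  note Bj = Suc.prems(2) and disjB = Suc.prems(3) and badB = Suc.prems(4) and fW = Suc.prems(5)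
    and WB = Suc.prems(6) and YB = Suc.prems(7) and budget = Suc.prems(8)
  let ?pool = "\<Union>i<j. B i"
  have jN: "j < N" using Suc.hyps(2) by simp
  have Wpool: "W \<inter> ?pool = {}" using WB by blast
  obtain G U1 n1 where G: "G \<subseteq> W" "\<forall>v\<in>W - G. bad j B v" and U1: "U1 \<subseteq> ?pool - Y"
      "card U1 \<le> D2 * card G"
    and n1: "tileable F c n1 (G \<union> U1)" "real n1 \<le> K1"
    using cover_good_vertices[where B = B and j = j and W = W and Y = Y, OF Bj Suc.prems(1) fW WB
        budget] by blast
  define W' where "W' = W - G"
  define Y1 where "Y1 = Y \<union> U1"
  have fpool: "finite ?pool" using Bj by blast
  have fU1: "finite U1" using U1(1) fpool by (meson Diff_subset finite_subset)
  have fW': "finite W'" using fW by (simp add: W'_def)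
  \<comment> \<open>The pool vertices spent on \<open>G\<close> are paid for by the removal of
    \<open>G\<close> from the remainder.\<close>
  have budget1: "rcard (Y1 \<inter> B i) + real D2 * rcard W' \<le> \<tau> * rcard (B i)" if i: "i < j" for i
  proof -
    have "card (Y1 \<inter> B i) \<le> card ((Y \<inter> B i) \<union> U1)" using Bj[OF i] fU1 unfolding Y1_def
        by (intro card_mono) auto
    also have "\<dots> \<le> card (Y \<inter> B i) + card U1" by (rule card_Un_le)
    also have "\<dots> \<le> card (Y \<inter> B i) + D2 * card G" using U1(2) by simp
    finally have "rcard (Y1 \<inter> B i) \<le> real (card (Y \<inter> B i) + D2 * card G)" by (rule of_nat_mono)
    moreover have "real D2 * rcard W' = real D2 * rcard W - real (D2 * card G)"
      unfolding W'_def real_card_Diff[OF fW G(1)] by (simp add: right_diff_distrib)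
    ultimately show ?thesis using budget[OF i] by linarith
  qed
  have Nj: "real (N - j) = real (N - (j + 1)) + 1" using jN by simp
  show ?case
  proof (cases "rcard W' < M1")
    \<comment> \<open>Fewer than \<open>M1\<close> vertices are left: they become singletons and the
      recursion stops.\<close>
    case True
    have "tileable F c (n1 + card W') ((G \<union> U1) \<union> W')"
      using n1(1) tileable_singletons[OF fW'] U1(1) Wpool G(1)
          by (intro tileable_Un) (auto simp: W'_def)
    moreover have "(G \<union> U1) \<union> W' = W \<union> U1" using G(1) by (auto simp: W'_def)
    moreover have "real (n1 + card W') \<le> real (N - j) * K2"
    proof -
      have "real (n1 + card W') \<le> K2" using n1(2) True K_pos(3,4) unfolding K2_def of_nat_add
          by linarith
      moreover have "1 * K2 \<le> real (N - j) * K2" using Nj K_pos by (intro mult_right_mono) auto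
      ultimately show ?thesis by simp
    qed
    moreover have "rcard ((Y \<union> U1) \<inter> B i) \<le> \<tau> * rcard (B i)" if "i < j" for i
    proof -
      have "0 \<le> real D2 * rcard W'" by simp
      then show ?thesis using budget1[OF that] unfolding Y1_def by linarith
    qed
    ultimately show ?thesis using U1(1) by (intro exI[of _ U1] exI[of _ "n1 + card W'"]) auto
  next
    case False
    then have big: "M1 \<le> rcard W'" by simp
    have "0 \<le> 2 * real D2 / (\<tau> * \<beta>)" using \<tau>_pos pos by simp
    then have "M0 \<le> rcard W'" using big unfolding M1_def by linarith
    from absorber[OF fW' this] obtain A Bn q where A: "A \<subseteq> W'" "Bn \<subseteq> W'" "A \<inter> Bn = {}"
      and Bn: "\<beta> * rcard W' \<le> rcard Bn" "rcard Bn \<le> 2 * real q"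
        "\<epsilon> * rcard Bn \<le> rcard Bn - real q"
      and absorb: "\<forall>B'\<subseteq>Bn. card B' = q \<longrightarrow> mono_tile F c (A \<union> B')" by blast
    define W1 where "W1 = W' - A - Bn"
    have "finite W1" "W1 \<subseteq> W'" using fW' by (auto simp: W1_def)
    from reduce_remainder[OF this(1) big this(2) fW' Bn(1)]
    obtain W2 n2 where W2: "W2 \<subseteq> W1" "real D2 * rcard W2 \<le> \<tau> * rcard Bn"
      "tileable F c n2 (W1 - W2)" "real n2 \<le> 4 * real D2 / (\<rho> * \<tau> * \<beta>) + 1" by blast
    have fBn: "finite Bn" using A fW' finite_subset by blast
    have w'pos: "0 < rcard W'" using \<open>M0 \<le> rcard W'\<close> pos by linarith
    then have "0 < \<beta> * rcard W'" using pos by simp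
    then have Bnpos: "0 < card Bn" using Bn(1) by linarith
    then have q: "1 \<le> q" using Bn(2) by linarith
    define B' where "B' = B(j := Bn)"
    have B'i: "B' i = B i" if "i < j" for i using that by (simp add: B'_def)
    have B'j: "B' j = Bn" by (simp add: B'_def)
    have pool': "(\<Union>i<j + 1. B' i) = ?pool \<union> Bn"
    proof -
      have "{..<j + 1} = insert j {..<j}" by auto
      then have "(\<Union>i<j + 1. B' i) = B' j \<union> (\<Union>i<j. B' i)" by simp
      also have "(\<Union>i<j. B' i) = ?pool" using B'i by simp
      finally show ?thesis using B'j by blast
    qed
    have W'pool: "W' \<inter> ?pool = {}" using Wpool by (auto simp: W'_def)
    have Y1pool: "Y1 \<subseteq> ?pool" using YB U1(1) by (auto simp: Y1_def)
    have "\<exists>U n. U \<subseteq> (\<Union>i<j + 1. B' i) - Y1 \<and> (\<forall>i<j + 1. rcard ((Y1 \<union> U) \<inter> B' i) \<le> \<tau> * rcard (B' i)) \<and>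
      tileable F c n (W2 \<union> U) \<and> real n \<le> real (N - (j + 1)) * K2"
    proof (rule Suc.hyps(1))
      show "x = N - (j + 1)" using Suc.hyps(2) by simp
      show "j + 1 \<le> N" using jN by simp
      show "finite (B' i) \<and> 0 < card (B' i)" if "i < j + 1" for i
        using that Bj[of i] fBn Bnpos by (cases "i = j") (auto simp: B'_def)
      show "B' i \<inter> B' i' = {}" if ii: "i < j + 1" "i' < j + 1" "i \<noteq> i'" for i i'
      proof -
        have *: "Bn \<inter> B l = {}" if "l < j" for l using A(2) W'pool that by blast
        consider "i < j" "i' < j" | "i = j" "i' < j" | "i < j" "i' = j" using ii by linarith
        then show ?thesis
        proof cases
          case 1 then show ?thesis using disjB ii B'i by simp
        next
          case 2 then show ?thesis using *[of i'] B'i B'j by simp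
        next
          case 3 then show ?thesis using *[of i] B'i B'j by (simp add: Int_commute)
        qed
      qed
      show "bad i B' v" if "i < j + 1" "v \<in> B' i" for i v
      proof (cases "i = j")
        case True
        then have "v \<in> W - G" using that A(2) by (auto simp: B'j W'_def)
        then have "bad j B v" using G(2) by blast
        then show ?thesis unfolding B'_def True bad_upd .
      next
        case False
        then have i: "i < j" using that by simp
        then have "bad i B v" using badB that B'i by simp
        then show ?thesis unfolding B'_def bad_upd_less[OF i] .
      qed
      have fW1: "finite W1" using fW' by (simp add: W1_def)
      show "finite W2" using W2(1) fW1 finite_subset by blast
      show "W2 \<inter> B' i = {}" if "i < j + 1" for i
      proof (cases "i = j")
        case True then show ?thesis using W2(1) by (auto simp: B'j W1_def)
      next
        case False
        then have i: "i < j" using that by simp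
        then have "W' \<inter> B i = {}" using W'pool by blast
        then show ?thesis using W2(1) B'i[OF i] by (auto simp: W1_def)
      qed
      show "Y1 \<subseteq> (\<Union>i<j + 1. B' i)" unfolding pool' using Y1pool by blast
      \<comment> \<open>The new pool is untouched so far, and \<open>reduce_remainder\<close> made
        \<open>W2\<close> small enough for it; for the earlier pools the remainder has only become
        smaller.\<close>
      show "rcard (Y1 \<inter> B' i) + real D2 * rcard W2 \<le> \<tau> * rcard (B' i)" if "i < j + 1" for i
      proof (cases "i = j")
        case True
        have "Y1 \<inter> Bn = {}" using Y1pool A(2) W'pool by blast
        then show ?thesis using True W2(2) by (simp add: B'j)
      next
        case False
        then have i: "i < j" using that by simp
        have "card W2 \<le> card W'" using W2(1) fW' by (intro card_mono) (auto simp: W1_def)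
        then have "real D2 * rcard W2 \<le> real D2 * rcard W'" by (intro mult_left_mono) auto
        then show ?thesis using budget1[OF i] unfolding B'i[OF i] by linarith
      qed
    qed
    then obtain U2 n3 where U2: "U2 \<subseteq> (?pool \<union> Bn) - Y1"
      and U2b: "\<forall>i<j + 1. rcard ((Y1 \<union> U2) \<inter> B' i) \<le> \<tau> * rcard (B' i)"
      and n3: "tileable F c n3 (W2 \<union> U2)" "real n3 \<le> real (N - (j + 1)) * K2" unfolding pool'
          by blast
    \<comment> \<open>\<open>R\<close> is what the deeper levels leave of the new pool. At least
      \<open>q\<close> vertices remain, the surplus is tiled greedily, and exactly \<open>q\<close>
      are absorbed together with \<open>A\<close>.\<close>
    define R where "R = Bn - U2"
    have fR: "finite R" using fBn by (simp add: R_def)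
    have cR: "q \<le> card R"
    proof -
      have "card (U2 \<inter> Bn) \<le> card ((Y1 \<union> U2) \<inter> Bn)" using fBn by (intro card_mono) auto
      then have "rcard (U2 \<inter> Bn) \<le> \<tau> * rcard Bn" using U2b[rule_format, of j] B'j by simp
      also have "\<dots> \<le> \<epsilon> * rcard Bn" using \<tau>_le by (intro mult_right_mono) auto
      finally have "rcard (U2 \<inter> Bn) \<le> rcard Bn - real q" using Bn(3) by linarith
      moreover have "R = Bn - (U2 \<inter> Bn)" by (auto simp: R_def)
      then have "rcard R = rcard Bn - rcard (U2 \<inter> Bn)" using real_card_Diff[OF fBn, of "U2 \<inter> Bn"]
          by simp
      ultimately show ?thesis by linarith
    qed
    from greedy_tiling[OF fR q cR] obtain R0 n4 where R0: "R0 \<subseteq> R" "card R0 = q"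
        "tileable F c n4 (R - R0)"
      "real n4 \<le> 2 * (rcard R - real q) / (\<rho> * real q) + 1" by blast
    have n4: "real n4 \<le> 2 / \<rho> + 1"
    proof -
      have "card R \<le> card Bn" unfolding R_def using fBn by (intro card_mono) auto
      then have "rcard R - real q \<le> real q" using Bn(2) by linarith
      then have "2 * (rcard R - real q) / (\<rho> * real q) \<le> 2 * real q / (\<rho> * real q)"
        using pos by (intro divide_right_mono) auto
      also have "\<dots> = 2 / \<rho>" using q by simp
      finally show ?thesis using R0(4) by linarith
    qed
    have tileA: "tileable F c 1 (A \<union> R0)" using absorb R0
        by (intro tileable_single) (auto simp: R_def)
    \<comment> \<open>The new pool lies inside \<open>W\<close>, so only the vertices of earlier
      pools are reported as additional.\<close>
    define U where "U = U1 \<union> (U2 - Bn)"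
    define n where "n = n1 + (n2 + (n3 + (n4 + 1)))"
    obtain PL where PL: "W \<inter> PL = {}" "U1 \<subseteq> PL" "U2 \<subseteq> PL \<union> Bn"
      using Wpool U1(1) U2 by (metis Diff_subset order_trans)
    have s1: "W1 \<subseteq> W'" "W1 \<inter> A = {}" "W1 \<inter> Bn = {}" "R \<subseteq> Bn" "R \<inter> U2 = {}" "G \<inter> W' = {}" "W' \<subseteq> W"
      by (auto simp: W1_def R_def W'_def)
    have s2: "U2 \<inter> U1 = {}" using U2 by (auto simp: Y1_def)
    have s3: "U2 \<inter> A = {}" "W1 \<inter> U2 = {}" using PL(1,3) s1(1,2,3,7) A by blast+
    have s4: "G \<inter> U2 = {}" using PL(1,3) A(2) s1(6) G(1) by blast
    have s5: "U1 \<inter> W' = {}" using PL(1,2) s1(7) by blast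
    have T4: "tileable F c (n4 + 1) ((R - R0) \<union> (A \<union> R0))"
      by (rule tileable_Un[OF R0(3) tileA]) (use A(3) R0(1) s1(4) in blast)
    have T3: "tileable F c (n3 + (n4 + 1)) ((W2 \<union> U2) \<union> ((R - R0) \<union> (A \<union> R0)))"
    proof (rule tileable_Un[OF n3(1) T4])
      have "W2 \<inter> (R \<union> A) = {}" using W2(1) s1(2,3,4) by blast
      then show "(W2 \<union> U2) \<inter> ((R - R0) \<union> (A \<union> R0)) = {}" using R0(1) s1(5) s3(1) by blast
    qed
    have T2: "tileable F c (n2 + (n3 + (n4 + 1))) ((W1 - W2) \<union> ((W2 \<union> U2) \<union> ((R - R0) \<union> (A \<union> R0))))"
    proof (rule tileable_Un[OF W2(3) T3])
      have "W1 \<inter> (R \<union> A) = {}" using s1(2,3,4) by blast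
      then show "(W1 - W2) \<inter> ((W2 \<union> U2) \<union> ((R - R0) \<union> (A \<union> R0))) = {}" using R0(1) s3(2) by blast
    qed
    have T1: "tileable F c n ((G \<union> U1) \<union> ((W1 - W2) \<union> ((W2 \<union> U2) \<union> ((R - R0) \<union> (A \<union> R0)))))"
      unfolding n_def
    proof (rule tileable_Un[OF n1(1) T2])
      have sub: "(W1 - W2) \<union> ((W2 \<union> U2) \<union> ((R - R0) \<union> (A \<union> R0))) \<subseteq> W' \<union> U2"
        using s1(1,4) A(1,2) W2(1) R0(1) by blast
      have "(G \<union> U1) \<inter> (W' \<union> U2) = {}" using s1(6) s2 s4 s5 by blast
      then show "(G \<union> U1) \<inter> ((W1 - W2) \<union> ((W2 \<union> U2) \<union> ((R - R0) \<union> (A \<union> R0)))) = {}" using sub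
          by blast
    qed
    have eq: "(G \<union> U1) \<union> ((W1 - W2) \<union> ((W2 \<union> U2) \<union> ((R - R0) \<union> (A \<union> R0)))) = W \<union> U"
    proof -
      have 1: "(W1 - W2) \<union> W2 = W1" "(R - R0) \<union> R0 = R" using W2(1) R0(1) by blast+
      have 2: "W1 \<union> A \<union> Bn = W'" using A by (auto simp: W1_def)
      have 3: "R \<union> U2 = Bn \<union> (U2 - Bn)" by (auto simp: R_def)
      have 4: "G \<union> W' = W" using G(1) by (auto simp: W'_def)
      have "(G \<union> U1) \<union> ((W1 - W2) \<union> ((W2 \<union> U2) \<union> ((R - R0) \<union> (A \<union> R0)))) =
          G \<union> U1 \<union> ((W1 - W2) \<union> W2) \<union> A \<union> (((R - R0) \<union> R0) \<union> U2)" by blast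
      also have "\<dots> = G \<union> U1 \<union> W1 \<union> A \<union> (Bn \<union> (U2 - Bn))" unfolding 1 3 ..
      also have "\<dots> = (G \<union> (W1 \<union> A \<union> Bn)) \<union> (U1 \<union> (U2 - Bn))" by blast
      finally show ?thesis unfolding 2 4 U_def .
    qed
    have "real n \<le> real (N - j) * K2"
    proof -
      have "real n = real n1 + real n2 + real n3 + real n4 + 1" by (simp add: n_def)
      also have "\<dots> \<le> K1 + (4 * real D2 / (\<rho> * \<tau> * \<beta>) + 1) + real (N - (j + 1)) * K2 + (2 / \<rho> + 1) +
          1"
        using n1(2) W2(4) n3(2) n4 by linarith
      also have "\<dots> \<le> K2 + real (N - (j + 1)) * K2" using K_pos(2) K2_def by linarith
      also have "\<dots> = real (N - j) * K2" unfolding Nj by (simp add: distrib_right)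
      finally show ?thesis .
    qed
    moreover have "tileable F c n (W \<union> U)" using T1 unfolding eq .
    moreover have "U \<subseteq> ?pool - Y" using U1(1) U2 by (auto simp: U_def Y1_def)
    moreover have "rcard ((Y \<union> U) \<inter> B i) \<le> \<tau> * rcard (B i)" if i: "i < j" for i
    proof -
      have "card ((Y \<union> U) \<inter> B i) \<le> card ((Y1 \<union> U2) \<inter> B' i)"
        using Bj[OF i] unfolding B'i[OF i] by (intro card_mono) (auto simp: U_def Y1_def)
      moreover have "rcard ((Y1 \<union> U2) \<inter> B' i) \<le> \<tau> * rcard (B' i)" using U2b i by simp
      ultimately show ?thesis unfolding B'i[OF i] by linarith
    qed
    ultimately show ?thesis by (intro exI[of _ U] exI[of _ n]) blast
  qed
qed

lemma tileable_bound:
  assumes "finite W"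
  shows "\<exists>n. tileable F c n W \<and> real n \<le> real N * K2"
  using main_recursion[where j = 0 and B = "\<lambda>_. {}" and W = W and Y = "{}"] assms by auto

end

section \<open>The bound\<close>

lemma mult_le_power_add:
  fixes a b E :: real
  assumes "0 \<le> a" "0 \<le> b" "a \<le> E ^ i" "b \<le> E ^ j"
  shows "a * b \<le> E ^ (i + j)"
  unfolding power_add using assms by (intro mult_mono) auto

text \<open>Every constant is a product of numerical factors, parameters and reciprocals that are
  each at most \<open>E\<close>, so it suffices to count factors. The dependence on
  \<open>\<Delta>\<close> enters the exponent through the power \<open>\<Delta> + 1\<close> of
  \<open>1 / \<mu>\<close> in \<open>K1\<close>. Six summands and the factor \<open>N\<close> cost
  one further power each.\<close>

lemma (in tiling_setup) K2_bound:
  assumes E: "16 \<le> E" "1 / \<mu> \<le> E" "1 / \<epsilon> \<le> E" "2 ^ N \<le> E" "real r \<le> E" "1 / \<delta> \<le> E" "real N \<le> E"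
    "real \<Delta> + 2 \<le> E" "real D2 \<le> E"
  shows "real N * K2 \<le> E ^ (\<Delta> + 18)"
proof -
  have p: "0 \<le> 1 / \<mu>" "0 \<le> 1 / \<epsilon>" "0 \<le> 1 / \<delta>" "0 \<le> 1 / \<rho>" "0 \<le> 1 / \<beta>" "0 \<le> 1 / \<tau>"
    using pos \<epsilon> \<delta> \<tau>_pos by auto
  have c: "2 \<le> E ^ 1" "4 \<le> E ^ 1" "3 \<le> E ^ 1" "6 \<le> E ^ 1" using E(1) by auto
  have e: "1 / \<mu> \<le> E ^ 1" "1 / \<epsilon> \<le> E ^ 1" "2 ^ N \<le> E ^ 1" "real r \<le> E ^ 1" "1 / \<delta> \<le> E ^ 1"
    "real N \<le> E ^ 1" "real \<Delta> + 2 \<le> E ^ 1" "real D2 \<le> E ^ 1" using E by simp_all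
  have \<rho>: "1 / \<rho> \<le> E ^ 4"
  proof -
    have "1 / \<rho> = ((2 * real N) * (1 / \<epsilon>)) * (1 / \<mu>)" by (simp add: \<rho>_def)
    also have "\<dots> \<le> E ^ (((1 + 1) + 1) + 1)" using p c e by (intro mult_le_power_add) auto
    finally show ?thesis by (simp add: eval_nat_numeral mult.assoc)
  qed
  have \<beta>: "1 / \<beta> \<le> E ^ 7"
  proof -
    have "1 / \<beta> = ((4 * (real \<Delta> + 2)) * (1 / \<mu>)) * (1 / \<rho>)" by (simp add: \<beta>_def)
    also have "\<dots> \<le> E ^ (((1 + 1) + 1) + 4)" using p c e \<rho> by (intro mult_le_power_add) auto
    finally show ?thesis by (simp add: eval_nat_numeral mult.assoc)
  qed
  have \<tau>: "1 / \<tau> \<le> E ^ 3"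
  proof -
    have "1 / \<tau> = (4 * (1 / \<epsilon>)) * (1 / \<mu>)" by (simp add: \<tau>_def)
    also have "\<dots> \<le> E ^ ((1 + 1) + 1)" using p c e by (intro mult_le_power_add) auto
    finally show ?thesis by (simp add: eval_nat_numeral mult.assoc)
  qed
  have M0: "M0 \<le> E ^ 8"
  proof -
    have "M0 = (((2 * (real \<Delta> + 2)) * (1 / \<epsilon>)) * (1 / \<mu>)) * (1 / \<rho>)" by (simp add: M0_def)
    also have "\<dots> \<le> E ^ ((((1 + 1) + 1) + 1) + 4)" using p c e \<rho> by (intro mult_le_power_add) auto
    finally show ?thesis by (simp add: eval_nat_numeral mult.assoc)
  qed
  have a1: "2 * real D2 / (\<tau> * \<beta>) \<le> E ^ 12"
  proof -
    have "2 * real D2 / (\<tau> * \<beta>) = ((2 * real D2) * (1 / \<tau>)) * (1 / \<beta>)" by simp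
    also have "\<dots> \<le> E ^ (((1 + 1) + 3) + 7)" using p c e \<tau> \<beta> by (intro mult_le_power_add) auto
    finally show ?thesis by (simp add: eval_nat_numeral mult.assoc)
  qed
  have a2: "4 * real D2 / (\<rho> * \<tau> * \<beta>) \<le> E ^ 16"
  proof -
    have "4 * real D2 / (\<rho> * \<tau> * \<beta>) = (((4 * real D2) * (1 / \<rho>)) * (1 / \<tau>)) * (1 / \<beta>)" by simp
    also have "\<dots> \<le> E ^ ((((1 + 1) + 4) + 3) + 7)" using p c e \<tau> \<beta> \<rho>
        by (intro mult_le_power_add) auto
    finally show ?thesis by (simp add: eval_nat_numeral mult.assoc)
  qed
  have a3: "2 / \<rho> \<le> E ^ 5"
  proof -
    have "2 / \<rho> = 2 * (1 / \<rho>)" by simp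
    also have "\<dots> \<le> E ^ (1 + 4)" using p c \<rho> by (intro mult_le_power_add) auto
    finally show ?thesis by (simp add: eval_nat_numeral mult.assoc)
  qed
  have a4: "K1 \<le> E ^ (\<Delta> + 5)"
  proof -
    have "(1 / \<mu>) ^ (\<Delta> + 1) \<le> E ^ (\<Delta> + 1)" using p E(2) by (intro power_mono) auto
    moreover have "K1 = ((2 ^ N * real r) * (2 * (1 / \<delta>))) * (1 / \<mu>) ^ (\<Delta> + 1)"
        by (simp add: K1_def power_divide)
    ultimately have "K1 \<le> E ^ (((1 + 1) + (1 + 1)) + (\<Delta> + 1))"
      using p c e by (simp only:) (intro mult_le_power_add mult_nonneg_nonneg zero_le_power, auto)
    moreover have "((1 + 1) + (1 + 1)) + (\<Delta> + 1) = \<Delta> + 5" by simp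
    ultimately show ?thesis by (simp only:)
  qed
  have up: "E ^ i \<le> E ^ (\<Delta> + 16)" if "i \<le> \<Delta> + 16" for i using that E(1)
      by (intro power_increasing) auto
  have "K2 \<le> 6 * E ^ (\<Delta> + 16)"
  proof -
    let ?y = "E ^ (\<Delta> + 16)"
    have "2 * real D2 / (\<tau> * \<beta>) \<le> ?y" "4 * real D2 / (\<rho> * \<tau> * \<beta>) \<le> ?y" "2 / \<rho> \<le> ?y" "K1 \<le> ?y"
        "M0 \<le> ?y" "3 \<le> ?y"
      by (rule order_trans[OF a1 up] order_trans[OF a2 up] order_trans[OF a3 up] order_trans[OF a4
          up]
          order_trans[OF M0 up] order_trans[OF c(3) up]; simp)+
    then show ?thesis unfolding K2_def M1_def by linarith
  qed
  also have "\<dots> \<le> E ^ (1 + (\<Delta> + 16))" using c E(1) by (intro mult_le_power_add) auto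
  finally have "K2 \<le> E ^ (1 + (\<Delta> + 16))" .
  then have "real N * K2 \<le> E ^ (1 + (1 + (\<Delta> + 16)))" using e K_pos by (intro mult_le_power_add) auto
  moreover have "1 + (1 + (\<Delta> + 16)) = \<Delta> + 18" by simp
  ultimately show ?thesis by (simp only:)
qed

lemma le_two_power: "n \<le> (2::nat) ^ n"
  by (simp add: less_imp_le)

lemma two_power_le_exp: "(2::real) ^ n \<le> exp (real n)"
proof -
  have "(2::real) \<le> exp 1" using exp_ge_add_one_self[of 1] by simp
  then have "(2::real) ^ n \<le> exp 1 ^ n" by (intro power_mono) auto
  then show ?thesis by (simp flip: exp_of_nat_mult)
qed

lemma tiling_bound:
  fixes c :: "nat set \<Rightarrow> nat" and F :: "nat \<Rightarrow> nat ugraph"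
  assumes r: "2 \<le> r" and \<Delta>: "2 \<le> \<Delta>" and F: "graph_sequence F" "\<And>i. 1 \<le> i \<Longrightarrow> max_degree (F i) \<le> \<Delta>"
    and c: "\<And>e. c e < r" and W: "finite W"
  shows "\<exists>n. tileable F c n W \<and> real n \<le> exp (exp (real r powr (11 * real r * real \<Delta> ^ 3)))"
proof -
  define N where "N = r ^ (r * (\<Delta> + 2))"
  \<comment> \<open>All parameters become powers of two. \<open>r \<le> 2 ^ N\<close> dictates
    \<open>\<delta>\<close>; the exponent \<open>A\<close> exceeds what
    \<open>14 * (\<Delta> + 1)\<close> and the powers of \<open>\<delta>\<close> require of
    \<open>\<epsilon>\<close>; and \<open>t\<close> equals
    \<open>2 / \<epsilon> ^ 3\<close>.\<close>
  define A where "A = 16 * (N * \<Delta>)"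
  define t :: nat where "t = 2 * 8 ^ A"
  define \<delta> :: real where "\<delta> = (1 / 2) ^ (2 * N)"
  define \<epsilon> :: real where "\<epsilon> = (1 / 2) ^ A"
  have "r ^ 1 \<le> N" unfolding N_def using r \<Delta> by (intro power_increasing) auto
  then have rN: "r \<le> N" by simp
  have "2 ^ \<Delta> \<le> r ^ \<Delta>" using r by (intro power_mono) auto
  also have "\<dots> \<le> N" unfolding N_def
  proof (rule power_increasing)
    have "1 * \<Delta> \<le> r * (\<Delta> + 2)" using r by (intro mult_mono) auto
    then show "\<Delta> \<le> r * (\<Delta> + 2)" by simp
  qed (use r in simp)
  finally have \<Delta>N: "\<Delta> \<le> N" using le_two_power[of \<Delta>] by (rule le_trans[rotated])
  have N1: "2 \<le> N" using rN r by simp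
  have "2 * 2 \<le> N * \<Delta>" using N1 \<Delta> by (rule mult_mono) auto
  moreover have "1 * \<Delta> \<le> N * \<Delta>" "N * 1 \<le> N * \<Delta>" "\<Delta> * \<Delta> \<le> N * \<Delta>"
    using N1 \<Delta> \<Delta>N by (intro mult_mono; simp)+
  ultimately have NA: "\<Delta> \<le> N * \<Delta>" "N \<le> N * \<Delta>" "\<Delta> * \<Delta> \<le> N * \<Delta>" "4 \<le> N * \<Delta>" by auto
  have A: "16 \<le> A" "N \<le> A" "2 * N \<le> A" "r \<le> A" "\<Delta> + 2 \<le> A" "\<Delta> * \<Delta> + \<Delta> \<le> A"
    unfolding A_def using NA rN by linarith+
  interpret tiling_setup r \<Delta> F c N t \<delta> \<epsilon>
  proof
    show "r ^ (r * (\<Delta> + 2)) \<le> N" by (simp add: N_def)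
    show "0 < \<delta>" "0 < \<epsilon>" by (auto simp: \<delta>_def \<epsilon>_def)
    have "r \<le> 2 ^ N" using rN le_two_power[of N] by (rule le_trans)
    then have "real r \<le> real (2 ^ N)" by (rule of_nat_mono)
    then have "real r * 2 ^ N * \<delta> \<le> 2 ^ N * 2 ^ N * \<delta>" by (intro mult_right_mono) (auto simp: \<delta>_def)
    also have "\<dots> = 1" by (simp add: \<delta>_def power_divide mult_2 power_add)
    finally show "real r * 2 ^ N * \<delta> \<le> 1" .
    show "14 * (real \<Delta> + 1) * \<epsilon> \<le> \<delta>\<^sup>2 / 8 * (\<delta> / 4) ^ \<Delta>"
    proof -
      let ?b = "4 * N + 3 + (2 * N + 2) * \<Delta>"
      have 1: "\<delta>\<^sup>2 / 8 * (\<delta> / 4) ^ \<Delta> = (1 / 2) ^ ?b"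
      proof -
        have "\<delta>\<^sup>2 = (1 / 2) ^ (4 * N)" by (simp add: \<delta>_def flip: power_mult)
        moreover have "\<delta> / 4 = (1 / 2) ^ (2 * N + 2)"
            by (simp add: \<delta>_def power_add power2_eq_square)
        then have "(\<delta> / 4) ^ \<Delta> = (1 / 2) ^ ((2 * N + 2) * \<Delta>)" by (simp only: power_mult)
        ultimately show ?thesis by (simp add: power_add power3_eq_cube)
      qed
      have "real \<Delta> + 1 \<le> 2 ^ \<Delta>"
      proof -
        have "Suc \<Delta> \<le> 2 ^ \<Delta>" by (simp add: Suc_leI)
        then have "real (Suc \<Delta>) \<le> real (2 ^ \<Delta>)" by (rule of_nat_mono)
        then show ?thesis by simp
      qed
      then have "14 * (real \<Delta> + 1) \<le> 2 ^ (\<Delta> + 4)" by (simp add: power_add)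
      then have "14 * (real \<Delta> + 1) * \<epsilon> \<le> 2 ^ (\<Delta> + 4) * \<epsilon>"
          by (intro mult_right_mono) (auto simp: \<epsilon>_def)
      also have "\<epsilon> \<le> (1 / 2) ^ ((\<Delta> + 4) + ?b)" unfolding \<epsilon>_def
      proof (rule power_decreasing)
        have "(2 * N + 2) * \<Delta> = 2 * (N * \<Delta>) + 2 * \<Delta>" by (simp add: distrib_right)
        then show "(\<Delta> + 4) + ?b \<le> A" unfolding A_def using NA by linarith
      qed auto
      also have "2 ^ (\<Delta> + 4) * (1 / 2) ^ ((\<Delta> + 4) + ?b) = ((1 / 2) ^ ?b :: real)"
        unfolding power_add[of "1 / 2 :: real"
            "\<Delta> + 4"] mult.assoc[symmetric] power_mult_distrib[symmetric] by simp
      finally show ?thesis using 1 by simp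
    qed
    show "2 / \<epsilon> ^ 3 \<le> real t"
    proof -
      have "\<epsilon> ^ 3 = (1 / 8) ^ A" unfolding \<epsilon>_def power_mult[symmetric]
          by (simp add: power_mult mult.commute[of A] power3_eq_cube)
      then show ?thesis by (simp add: t_def power_divide)
    qed
  qed (use r \<Delta> F c in auto)
  \<comment> \<open>This is \<open>1 / \<mu>\<close>, which dominates all the other
    quantities.\<close>
  define E :: real where "E = 2 ^ (A * t)"
  have "1 \<le> t" by (simp add: t_def)
  then have "A * 1 \<le> A * t" by (intro mult_left_mono) auto
  then have AE: "2 ^ A \<le> E" unfolding E_def by (intro power_increasing) auto
  have natE: "real n \<le> E" if "n \<le> A" for n
  proof -
    have "n \<le> 2 ^ A" using that le_two_power[of A] by (rule le_trans)
    then have "real n \<le> real (2 ^ A)" by (rule of_nat_mono)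
    also have "\<dots> = 2 ^ A" by simp
    also note AE
    finally show ?thesis .
  qed
  have powE: "2 ^ n \<le> E" if "n \<le> A" for n
    by (rule order_trans[OF power_increasing[OF that] AE]) simp
  have "real N * K2 \<le> E ^ (\<Delta> + 18)"
  proof (rule K2_bound)
    show "16 \<le> E" using natE[OF A(1)] by simp
    have "\<mu> = (1 / 2) ^ (A * t)" unfolding \<mu>_def unfolding \<epsilon>_def by (simp only: power_mult)
    then show "1 / \<mu> \<le> E" by (simp add: E_def power_divide)
    show "1 / \<epsilon> \<le> E" using AE by (simp add: \<epsilon>_def power_divide)
    show "2 ^ N \<le> E" "real r \<le> E" "real N \<le> E" using powE[OF A(2)] natE[OF A(4)] natE[OF A(2)]
        by auto
    show "1 / \<delta> \<le> E" using powE[OF A(3)] by (simp add: \<delta>_def power_divide)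
    show "real \<Delta> + 2 \<le> E" using natE[OF A(5)] by simp
    show "real D2 \<le> E" using natE[OF A(6)] by (simp add: D2_def)
  qed
  also have "E ^ (\<Delta> + 18) = 2 ^ (A * t * (\<Delta> + 18))" by (simp add: E_def power_mult)
  also have "\<dots> \<le> exp (real (A * t * (\<Delta> + 18)))" by (rule two_power_le_exp)
  also have "\<dots> \<le> exp (exp (real r powr (11 * real r * real \<Delta> ^ 3)))"
  proof -
    \<comment> \<open>Each factor is at most a power with exponent \<open>A\<close>, so the argument
      of the outer exponential is itself a single exponential in \<open>A\<close>.\<close>
    have "A * t * (\<Delta> + 18) \<le> 2 ^ A * (2 ^ A * 8 ^ A) * 2 ^ A"
    proof (intro mult_mono)
      show "A \<le> 2 ^ A" by (rule le_two_power)
      have "\<Delta> + 18 \<le> A" using NA unfolding A_def by linarith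
      then show "\<Delta> + 18 \<le> 2 ^ A" using le_two_power[of A] by (rule le_trans)
      have "2 \<le> A" using NA unfolding A_def by linarith
      then have "2 \<le> (2::nat) ^ A" using le_two_power[of A] by (rule le_trans)
      then show "t \<le> 2 ^ A * 8 ^ A" unfolding t_def by (rule mult_right_mono) simp
    qed auto
    also have "\<dots> = 64 ^ A" unfolding power_mult_distrib[symmetric] by simp
    also have "\<dots> = 2 ^ (6 * A)" unfolding power_mult by simp
    finally have "real (A * t * (\<Delta> + 18)) \<le> real (2 ^ (6 * A))" by (rule of_nat_mono)
    also have "\<dots> \<le> exp (real (6 * A))" using two_power_le_exp[of "6 * A"] by simp
    also have "\<dots> \<le> exp (real r powr (11 * real r * real \<Delta> ^ 3))"
    proof -
      have "6 * A = 96 * N * \<Delta>" by (simp add: A_def)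
      also have "\<dots> \<le> r ^ 7 * N * r ^ \<Delta>"
      proof (intro mult_mono)
        have "(2::nat) ^ 7 \<le> r ^ 7" using r by (intro power_mono) auto
        then show "96 \<le> r ^ 7" by simp
        show "\<Delta> \<le> r ^ \<Delta>" using le_two_power[of \<Delta>] power_mono[of 2 r \<Delta>] r by linarith
      qed auto
      also have "\<dots> = r ^ (7 + r * (\<Delta> + 2) + \<Delta>)" by (simp only: N_def power_add)
      \<comment> \<open>The exponent is linear in \<open>\<Delta>\<close>. Its terms
        \<open>r * \<Delta>\<close>, \<open>2 * r\<close> and \<open>\<Delta>\<close> are each at
        most \<open>r * \<Delta> ^ 3\<close>, and 7 is at most eight times this, whence 11.\<close>
      also have "\<dots> \<le> r ^ (11 * (r * \<Delta> ^ 3))"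
      proof (rule power_increasing)
        let ?x = "r * \<Delta> ^ 3"
        have "\<Delta> ^ 1 \<le> \<Delta> ^ 3" using assms(2) by (intro power_increasing) auto
        then have d: "\<Delta> \<le> \<Delta> ^ 3" by simp
        then have 1: "r * \<Delta> \<le> ?x" by (rule mult_left_mono) simp
        have "1 * \<Delta> \<le> r * \<Delta>" using assms(1) by (intro mult_right_mono) auto
        then have 2: "\<Delta> \<le> r * \<Delta>" by simp
        have "r * 2 \<le> r * \<Delta>" using assms(2) by (intro mult_left_mono) auto
        moreover have "r * (\<Delta> + 2) = r * \<Delta> + r * 2" by (simp add: distrib_left)
        ultimately show "7 + r * (\<Delta> + 2) + \<Delta> \<le> 11 * ?x" using 1 2 assms(1,2) by linarith
      qed (use r in simp)
      finally have "real (6 * A) \<le> real (r ^ (11 * (r * \<Delta> ^ 3)))" by (rule of_nat_mono)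
      also have "\<dots> = real r powr (real (11 * (r * \<Delta> ^ 3)))" using r
          by (simp add: powr_realpow del: of_nat_mult of_nat_numeral)
      also have "real (11 * (r * \<Delta> ^ 3)) = 11 * real r * real \<Delta> ^ 3" by simp
      finally show ?thesis by simp
    qed
    finally show ?thesis by simp
  qed
  finally have "real N * K2 \<le> exp (exp (real r powr (11 * real r * real \<Delta> ^ 3)))" .
  then show ?thesis using tileable_bound[OF W] by (meson order_trans)
qed

section \<open>From vertex sets to the tiling number\<close>

text \<open>Each part \<open>A\<close> is turned back into the subgraph that is the image of
  \<open>F i\<close>. Two colourings occur because \<open>c\<close> is constrained on edges only,
  whereas the construction runs with a colouring \<open>c'\<close> of all sets.\<close>

lemma tileable_imp_monochromatic_tiling:
  assumes F: "graph_sequence F" and T: "tileable F c' m {..<n}"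
    and cc: "\<And>e. e \<in> edges (complete_graph n) \<Longrightarrow> c' e = c e"
  shows "\<exists>T. monochromatic_tiling F (complete_graph n) c T \<and> finite T \<and> card T \<le> m"
proof -
  obtain P where P: "finite P" "card P \<le> m" "disjoint P" "\<Union>P = {..<n}" "\<forall>A\<in>P. mono_tile F c' A"
    using T unfolding tileable_def by blast
  define good where "good A H \<longleftrightarrow> verts H = A \<and> is_subgraph H (complete_graph n) \<and>
      (\<exists>i\<ge>1. is_copy_of H (F i)) \<and> monochromatic c H" for A H
  have "\<forall>A\<in>P. \<exists>H. good A H"
  proof
    fix A assume A: "A \<in> P"
    then have An: "A \<subseteq> {..<n}" using P(4) by blast
    obtain i f k where i: "i \<ge> 1" and f: "bij_betw f (verts (F i)) A"
        and k: "\<forall>e\<in>edges (F i). c' (f ` e) = k"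
      using P(5) A unfolding mono_tile_def by blast
    have gF: "edges (F i) \<subseteq> [verts (F i)]\<^bsup>2\<^esup>" using F i
        by (auto simp: graph_sequence_def ugraph_def)
    define H where "H = (A, (\<lambda>e. f ` e) ` edges (F i))"
    have HA: "edges H \<subseteq> [A]\<^bsup>2\<^esup>"
    proof
      fix e' assume "e' \<in> edges H"
      then obtain e where e: "e \<in> edges (F i)" "e' = f ` e" by (auto simp: H_def)
      then have "e \<subseteq> verts (F i)" "finite e" "card e = 2" using gF by (auto simp: nsets_def)
      moreover from this have "card (f ` e) = 2" using f
          by (metis bij_betw_def card_image inj_on_subset)
      ultimately show "e' \<in> [A]\<^bsup>2\<^esup>" using f e(2) by (auto simp: nsets_def bij_betw_def)
    qed
    have Hn: "edges H \<subseteq> edges (complete_graph n)"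
      using HA nsets_mono[OF An, of 2] by (auto simp: complete_graph_def)
    have "finite A" using An finite_subset by blast
    then have "is_subgraph H (complete_graph n)"
      unfolding is_subgraph_def ugraph_def using HA Hn An by (auto simp: H_def complete_graph_def)
    moreover have "is_copy_of H (F i)" unfolding is_copy_of_def using f by (auto simp: H_def)
    moreover have "monochromatic c H"
      unfolding monochromatic_def
    proof (intro exI[of _ k] ballI)
      fix e' assume e': "e' \<in> edges H"
      then have "c' e' = k" using k by (auto simp: H_def)
      then show "c e' = k" using cc Hn e' by auto
    qed
    ultimately show "\<exists>H. good A H" unfolding good_def using i
        by (intro exI[of _ H]) (auto simp: H_def)
  qed
  then obtain H where H: "\<forall>A\<in>P. good A (H A)" by (rule bchoice[THEN exE])
  have "monochromatic_tiling F (complete_graph n) c (H ` P)"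
    unfolding monochromatic_tiling_def is_tiling_def
  proof (intro conjI ballI impI)
    show "is_subgraph K (complete_graph n)" "\<exists>i\<ge>1. is_copy_of K (F i)" "monochromatic c K"
        if "K \<in> H ` P" for K
      using that H by (auto simp: good_def)
    show "verts K \<inter> verts K' = {}" if K: "K \<in> H ` P" "K' \<in> H ` P" "K \<noteq> K'" for K K'
    proof -
      obtain A A' where A: "A \<in> P" "A' \<in> P" "K = H A" "K' = H A'" using K by blast
      then have "A \<noteq> A'" using K(3) by blast
      then have "A \<inter> A' = {}" using P(3) A by (auto simp: disjoint_def)
      then show ?thesis using H A by (simp add: good_def)
    qed
    have "(\<Union>K\<in>H ` P. verts K) = (\<Union>A\<in>P. A)" using H by (auto simp: good_def)
    then show "(\<Union>K\<in>H ` P. verts K) = verts (complete_graph n)" using P(4)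
        by (simp add: complete_graph_def)
  qed
  moreover have "finite (H ` P)" "card (H ` P) \<le> m" using P(1,2) card_image_le[OF P(1), of H]
      by auto
  ultimately show ?thesis by blast
qed

lemma tiling_number_le:
  fixes F :: "nat \<Rightarrow> nat ugraph"
  assumes "2 \<le> r" "2 \<le> \<Delta>" "graph_sequence F" "\<forall>i\<ge>1. max_degree (F i) \<le> \<Delta>"
  shows "ereal_of_enat (tiling_number r F) \<le> ereal ((exp ^^ 2) (real r powr (11 * real r * real \<Delta> ^
      3)))"
proof -
  define X where "X = exp (exp (real r powr (11 * real r * real \<Delta> ^ 3)))"
  have X0: "0 \<le> X" by (simp add: X_def)
  have "tiling_number r F \<le> enat (nat \<lfloor>X\<rfloor>)"
    unfolding tiling_number_def
  proof (rule SUP_least)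
    fix n :: nat
    have "\<exists>T. monochromatic_tiling F (complete_graph n) c T \<and> finite T \<and> card T \<le> nat \<lfloor>X\<rfloor>"
      if c: "edge_colouring r (complete_graph n) c" for c
    proof -
      \<comment> \<open>The default colour 0 affects only sets that are not edges of the complete
        graph.\<close>
      define c' where "c' e = (if c e < r then c e else 0)" for e
      have "c' e < r" for e using assms(1) by (simp add: c'_def)
      then obtain m where m: "tileable F c' m {..<n}" "real m \<le> X"
        using tiling_bound[OF assms(1,2,3), of c' "{..<n}"] assms(4) unfolding X_def by auto
      have "m \<le> nat \<lfloor>X\<rfloor>" using m(2) X0 by (simp add: le_nat_iff le_floor_iff)
      then have "tileable F c' (nat \<lfloor>X\<rfloor>) {..<n}" using m(1) tileable_mono by blast
      then show ?thesis
        using c by (intro tileable_imp_monochromatic_tiling[OF assms(3), where c' = c']) (auto simp: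
            c'_def edge_colouring_def)
    qed
    then show "tiling_number_at r F n \<le> enat (nat \<lfloor>X\<rfloor>)"
      unfolding tiling_number_at_def by (intro Inf_lower) blast
  qed
  then have "ereal_of_enat (tiling_number r F) \<le> ereal_of_enat (enat (nat \<lfloor>X\<rfloor>))"
    by (rule ereal_of_enat_le_iff[THEN iffD2])
  also have "\<dots> = ereal (real (nat \<lfloor>X\<rfloor>))" by simp
  also have "\<dots> \<le> ereal X" using X0 by simp
  finally show ?thesis by (simp add: X_def numeral_2_eq_2)
qed

theorem theorem1p2:
  "(\<exists>K::real. K > 0 \<and>
      (\<forall>(r::nat) (\<Delta>::nat) (F :: nat \<Rightarrow> nat ugraph).
         r \<ge> 2 \<longrightarrow> \<Delta> \<ge> 2 \<longrightarrow> graph_sequence F \<longrightarrow> (\<forall>i\<ge>1. max_degree (F i) \<le> \<Delta>) \<longrightarrow>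
         ereal_of_enat (tiling_number r F)
           \<le> ereal ((exp ^^ 2) (real r powr (K * real r * real \<Delta> ^ 3)))))
   \<and> (\<forall>(r::nat) (F :: nat \<Rightarrow> nat ugraph).
         r \<ge> 2 \<longrightarrow> graph_sequence F \<longrightarrow> (SUP i\<in>{1..}. enat (max_degree (F i))) < \<infinity> \<longrightarrow>
         tiling_number r F < \<infinity>)"
proof (intro conjI allI impI)
  show "\<exists>K::real. K > 0 \<and>
      (\<forall>(r::nat) (\<Delta>::nat) (F :: nat \<Rightarrow> nat ugraph).
         r \<ge> 2 \<longrightarrow> \<Delta> \<ge> 2 \<longrightarrow> graph_sequence F \<longrightarrow> (\<forall>i\<ge>1. max_degree (F i) \<le> \<Delta>) \<longrightarrow>
         ereal_of_enat (tiling_number r F)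
           \<le> ereal ((exp ^^ 2) (real r powr (K * real r * real \<Delta> ^ 3))))"
    using tiling_number_le by (intro exI[of _ 11]) simp
next
  fix r :: nat and F :: "nat \<Rightarrow> nat ugraph"
  assume r: "2 \<le> r" and F: "graph_sequence F" and fin: "(SUP i\<in>{1..}. enat (max_degree (F i))) < \<infinity>"
  then obtain D where D: "(SUP i\<in>{1..}. enat (max_degree (F i))) = enat D" by auto
  \<comment> \<open>The quantitative bound is stated for degree bounds of at least 2, hence the
    maximum.\<close>
  have "max_degree (F i) \<le> max 2 D" if "1 \<le> i" for i
  proof -
    have "enat (max_degree (F i)) \<le> enat D" unfolding D[symmetric] using that
        by (intro SUP_upper) simp
    then show ?thesis by simp
  qed
  then have "ereal_of_enat (tiling_number r F)
      \<le> ereal ((exp ^^ 2) (real r powr (11 * real r * real (max 2 D) ^ 3)))"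
    using r F by (intro tiling_number_le) auto
  then show "tiling_number r F < \<infinity>" by (cases "tiling_number r F") auto
qed

end
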